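(* Let $R$ be a ring with a right noetherian point annihilator set $\mathcal{S}$. The following are equivalent: (1) $R$ is right artinian; (2) $R$ is right noetherian and, for all $P \in \mathcal{S}$, the right module $(R/P)_R$ has finite length; (3) for all $P \in \mathcal{S}$, $P_R$ is finitely generated and $(R/P)_R$ has finite length; (4) for all $P \in \mathcal{S}$, $P_R$ is finitely generated and $(R/P)_R$ is finitely cogenerated; (5) $R$ is right noetherian and every cocritical right ideal of $R$ is maximal; (6) every cocritical right ideal of $R$ is finitely generated and maximal.
   Context: Rings are associative with identity; modules are unital right modules. A point annihilator of a right module $M$ is the annihilator $\mathrm{ann}(m)=\{r\in R: mr=0\}$ of some nonzero $m \in M$. A set $\mathcal{S}$ of right ideals of $R$ is a right noetherian point annihilator set for $R$ if every nonzero noetherian right $R$-module has a point annihilator lying in $\mathcal{S}$ (members of $\mathcal{S}$ are otherwise arbitrary). A module $M$ is finitely cogenerated if any family of submodules of $M$ whose intersection is zero has a finite subfamily whose intersection is zero. Krull dimension here is the Gabriel–Rentschler Krull dimension: $\mathcal{K}_{-1}$ is the class consisting of the zero module; for an ordinal $\alpha \ge 0$, $\mathcal{K}_\alpha$ is the class of modules $M$ such that for every descending chain $M_0 \supseteq M_1 \supseteq \cdots$ of submodules of $M$, $M_i/M_{i+1} \in \bigcup_{\beta<\alpha}\mathcal{K}_\beta$ for all but finitely many $i$; $\mathrm{K.dim}(M)$ is the least $\alpha$ (where $-1$ counts as an ordinal) with $M \in \mathcal{K}_\alpha$, if it exists. A module $M$ is $\alpha$-critical ($\alpha \geq 0$ an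 ordinal) if $\mathrm{K.dim}(M) = \alpha$ and $\mathrm{K.dim}(M/N) < \alpha$ for every nonzero submodule $N$ of $M$; it is critical if it is $\alpha$-critical for some $\alpha$. A right ideal $I$ of $R$ is cocritical if the right module $R/I$ is critical. *)

theory Defs
  imports "HOL-Algebra.AbelCoset" "HOL-Library.Option_ord"
begin

section \<open>Right modules\<close>

record ('a, 'b) rmodule = "'b ring" +
  rsmult :: "['b, 'a] \<Rightarrow> 'b" (infixl \<open>\<cdot>\<index>\<close> 70)

locale right_module = R?: ring R + M?: abelian_group M
  for R :: "('a, 'r) ring_scheme" (structure) and M :: "('a, 'b) rmodule" (structure) +
  assumes rsmult_closed [simp, intro]:
      "\<lbrakk>x \<in> carrier M; a \<in> carrier R\<rbrakk> \<Longrightarrow> x \<cdot>\<^bsub>M\<^esub> a \<in> carrier M"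
    and rsmult_l_distr:
      "\<lbrakk>x \<in> carrier M; y \<in> carrier M; a \<in> carrier R\<rbrakk> \<Longrightarrow>
        (x \<oplus>\<^bsub>M\<^esub> y) \<cdot>\<^bsub>M\<^esub> a = x \<cdot>\<^bsub>M\<^esub> a \<oplus>\<^bsub>M\<^esub> y \<cdot>\<^bsub>M\<^esub> a"
    and rsmult_r_distr:
      "\<lbrakk>x \<in> carrier M; a \<in> carrier R; b \<in> carrier R\<rbrakk> \<Longrightarrow>
        x \<cdot>\<^bsub>M\<^esub> (a \<oplus>\<^bsub>R\<^esub> b) = x \<cdot>\<^bsub>M\<^esub> a \<oplus>\<^bsub>M\<^esub> x \<cdot>\<^bsub>M\<^esub> b"
    and rsmult_assoc:
      "\<lbrakk>x \<in> carrier M; a \<in> carrier R; b \<in> carrier R\<rbrakk> \<Longrightarrow>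
        x \<cdot>\<^bsub>M\<^esub> (a \<otimes>\<^bsub>R\<^esub> b) = (x \<cdot>\<^bsub>M\<^esub> a) \<cdot>\<^bsub>M\<^esub> b"
    and rsmult_one [simp]:
      "x \<in> carrier M \<Longrightarrow> x \<cdot>\<^bsub>M\<^esub> \<one>\<^bsub>R\<^esub> = x"

definition rsubmodule :: "('a, 'r) ring_scheme \<Rightarrow> ('a, 'b) rmodule \<Rightarrow> 'b set \<Rightarrow> bool" where
  "rsubmodule R M N \<longleftrightarrow>
     additive_subgroup N M \<and> (\<forall>x\<in>N. \<forall>a\<in>carrier R. x \<cdot>\<^bsub>M\<^esub> a \<in> N)"

definition submod :: "('a, 'b) rmodule \<Rightarrow> 'b set \<Rightarrow> ('a, 'b) rmodule" where
  "submod M N = M\<lparr>carrier := N\<rparr>"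

text \<open>As in HOL-Algebra, a module record extends a ring record, whose fields
  \<^const>\<open>mult\<close> and \<^const>\<open>one\<close> are never used for modules.\<close>

definition quotmod :: "('a, 'b) rmodule \<Rightarrow> 'b set \<Rightarrow> ('a, 'b set) rmodule" where
  "quotmod M N =
     \<lparr>carrier = a_rcosets\<^bsub>M\<^esub> N, mult = undefined, one = undefined,
      zero = N, add = set_add M,
      rsmult = (\<lambda>X a. \<Union>x\<in>X. N +>\<^bsub>M\<^esub> (x \<cdot>\<^bsub>M\<^esub> a))\<rparr>"

definition regmod :: "('a, 'r) ring_scheme \<Rightarrow> ('a, 'a) rmodule" where
  "regmod R =
     \<lparr>carrier = carrier R, mult = undefined, one = undefined,
      zero = zero R, add = add R, rsmult = mult R\<rparr>"

definition rmod_iso ::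
    "('a, 'r) ring_scheme \<Rightarrow> ('a, 'b) rmodule \<Rightarrow> ('a, 'c) rmodule \<Rightarrow> ('b \<Rightarrow> 'c) set" where
  "rmod_iso R M N =
     {f \<in> iso (add_monoid M) (add_monoid N).
        \<forall>x\<in>carrier M. \<forall>a\<in>carrier R. f (x \<cdot>\<^bsub>M\<^esub> a) = f x \<cdot>\<^bsub>N\<^esub> a}"

definition zero_module :: "('a, 'b) rmodule \<Rightarrow> bool" where
  "zero_module M \<longleftrightarrow> carrier M = {\<zero>\<^bsub>M\<^esub>}"

definition span_rmod :: "('a, 'r) ring_scheme \<Rightarrow> ('a, 'b) rmodule \<Rightarrow> 'b set \<Rightarrow> 'b set" where
  "span_rmod R M X = \<Inter>{N. rsubmodule R M N \<and> X \<subseteq> N}"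

definition finitely_generated :: "('a, 'r) ring_scheme \<Rightarrow> ('a, 'b) rmodule \<Rightarrow> bool" where
  "finitely_generated R M \<longleftrightarrow>
     (\<exists>X. finite X \<and> X \<subseteq> carrier M \<and> span_rmod R M X = carrier M)"

definition descending_chain ::
    "('a, 'r) ring_scheme \<Rightarrow> ('a, 'b) rmodule \<Rightarrow> (nat \<Rightarrow> 'b set) \<Rightarrow> bool" where
  "descending_chain R M C \<longleftrightarrow> (\<forall>i. rsubmodule R M (C i) \<and> C (Suc i) \<subseteq> C i)"

definition ascending_chain ::
    "('a, 'r) ring_scheme \<Rightarrow> ('a, 'b) rmodule \<Rightarrow> (nat \<Rightarrow> 'b set) \<Rightarrow> bool" where
  "ascending_chain R M C \<longleftrightarrow> (\<forall>i. rsubmodule R M (C i) \<and> C i \<subseteq> C (Suc i))"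

definition noetherian_module :: "('a, 'r) ring_scheme \<Rightarrow> ('a, 'b) rmodule \<Rightarrow> bool" where
  "noetherian_module R M \<longleftrightarrow>
     (\<forall>C. ascending_chain R M C \<longrightarrow> (\<exists>n. \<forall>i\<ge>n. C i = C n))"

definition artinian_module :: "('a, 'r) ring_scheme \<Rightarrow> ('a, 'b) rmodule \<Rightarrow> bool" where
  "artinian_module R M \<longleftrightarrow>
     (\<forall>C. descending_chain R M C \<longrightarrow> (\<exists>n. \<forall>i\<ge>n. C i = C n))"

definition simple_module :: "('a, 'r) ring_scheme \<Rightarrow> ('a, 'b) rmodule \<Rightarrow> bool" where
  "simple_module R M \<longleftrightarrow>
     \<not> zero_module M \<and> (\<forall>N. rsubmodule R M N \<longrightarrow> N = {\<zero>\<^bsub>M\<^esub>} \<or> N = carrier M)"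

definition finite_length :: "('a, 'r) ring_scheme \<Rightarrow> ('a, 'b) rmodule \<Rightarrow> bool" where
  "finite_length R M \<longleftrightarrow>
     (\<exists>n C. C 0 = {\<zero>\<^bsub>M\<^esub>} \<and> C n = carrier M \<and> (\<forall>i\<le>n. rsubmodule R M (C i)) \<and>
       (\<forall>i<n. C i \<subseteq> C (Suc i) \<and> simple_module R (quotmod (submod M (C (Suc i))) (C i))))"

text \<open>Intersections are taken inside the module, so that the empty family has
  intersection \<^term>\<open>carrier M\<close>.\<close>

definition finitely_cogenerated :: "('a, 'r) ring_scheme \<Rightarrow> ('a, 'b) rmodule \<Rightarrow> bool" where
  "finitely_cogenerated R M \<longleftrightarrow>
     (\<forall>F. F \<subseteq> Collect (rsubmodule R M) \<and> carrier M \<inter> \<Inter>F = {\<zero>\<^bsub>M\<^esub>} \<longrightarrow>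
       (\<exists>G. G \<subseteq> F \<and> finite G \<and> carrier M \<inter> \<Inter>G = {\<zero>\<^bsub>M\<^esub>}))"

definition right_ideal :: "('a, 'r) ring_scheme \<Rightarrow> 'a set \<Rightarrow> bool" where
  "right_ideal R I \<longleftrightarrow> rsubmodule R (regmod R) I"

definition maximal_right_ideal :: "('a, 'r) ring_scheme \<Rightarrow> 'a set \<Rightarrow> bool" where
  "maximal_right_ideal R I \<longleftrightarrow>
     right_ideal R I \<and> I \<noteq> carrier R \<and>
     (\<forall>J. right_ideal R J \<and> I \<subseteq> J \<longrightarrow> J = I \<or> J = carrier R)"

definition right_noetherian :: "('a, 'r) ring_scheme \<Rightarrow> bool" where
  "right_noetherian R \<longleftrightarrow> noetherian_module R (regmod R)"

definition right_artinian :: "('a, 'r) ring_scheme \<Rightarrow> bool" where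
  "right_artinian R \<longleftrightarrow> artinian_module R (regmod R)"


section \<open>Point annihilators\<close>

definition annih :: "('a, 'r) ring_scheme \<Rightarrow> ('a, 'b) rmodule \<Rightarrow> 'b \<Rightarrow> 'a set" where
  "annih R M m = {r \<in> carrier R. m \<cdot>\<^bsub>M\<^esub> r = \<zero>\<^bsub>M\<^esub>}"

definition point_annihilator ::
    "('a, 'r) ring_scheme \<Rightarrow> ('a, 'b) rmodule \<Rightarrow> 'a set \<Rightarrow> bool" where
  "point_annihilator R M I \<longleftrightarrow> (\<exists>m\<in>carrier M. m \<noteq> \<zero>\<^bsub>M\<^esub> \<and> I = annih R M m)"

text \<open>A definition cannot quantify over modules of all types, so the modules tested here
  are those with elements of type \<open>'a set\<close>, such as \<open>R/I\<close>.  This is no restriction: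
  lemma \<open>right_noetherian_point_annihilator_setD\<close> below gives
  the property for modules of every carrier type, because a nonzero module contains
  a nonzero cyclic module, which is isomorphic to some \<open>R/I\<close>.\<close>

definition right_noetherian_point_annihilator_set ::
    "('a, 'r) ring_scheme \<Rightarrow> 'a set set \<Rightarrow> bool" where
  "right_noetherian_point_annihilator_set R S \<longleftrightarrow>
     (\<forall>I\<in>S. right_ideal R I) \<and>
     (\<forall>M :: ('a, 'a set) rmodule.
        right_module R M \<and> noetherian_module R M \<and> \<not> zero_module M \<longrightarrow>
        (\<exists>I\<in>S. point_annihilator R M I))"


section \<open>Ordinals\<close>

text \<open>The ordinals of cardinality at most that of \<open>'c\<close>: order types of
  well-orders on subsets of \<open>'c\<close>.\<close>

quotient_type 'c ordinal = "'c rel" / partial: "\<lambda>r s. (r, s) \<in> ordIso"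
proof (rule part_equivpI)
  show "\<exists>r :: 'c rel. (r, r) \<in> ordIso" using card_of_refl by blast
  show "symp (\<lambda>r s :: 'c rel. (r, s) \<in> ordIso)"
    by (auto intro: sympI ordIso_symmetric)
  show "transp (\<lambda>r s :: 'c rel. (r, s) \<in> ordIso)"
    by (auto intro: transpI ordIso_transitive)
qed

instantiation ordinal :: (type) wellorder
begin

lift_definition less_eq_ordinal :: "'c ordinal \<Rightarrow> 'c ordinal \<Rightarrow> bool"
  is "\<lambda>r s. (r, s) \<in> ordLeq"
  by (meson ordIso_ordLeq_trans ordIso_symmetric ordLeq_ordIso_trans)

lift_definition less_ordinal :: "'c ordinal \<Rightarrow> 'c ordinal \<Rightarrow> bool"
  is "\<lambda>r s. (r, s) \<in> ordLess"
  by (meson ordIso_ordLess_trans ordIso_symmetric ordLess_ordIso_trans)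

instance
proof
  fix x y z :: "'c ordinal"
  have WO: "Well_order r" if "(r, r) \<in> ordIso" for r :: "'c rel"
    using that by (simp add: ordIso_def)
  show "x < y \<longleftrightarrow> x \<le> y \<and> \<not> y \<le> x"
    by transfer (metis WO not_ordLess_iff_ordLeq ordLess_imp_ordLeq)
  show "x \<le> x"
    by transfer (metis WO ordLeq_reflexive)
  show "x \<le> z" if "x \<le> y" "y \<le> z"
    using that by transfer (metis ordLeq_transitive)
  show "x = y" if "x \<le> y" "y \<le> x"
    using that by transfer (metis ordIso_iff_ordLeq)
  show "x \<le> y \<or> y \<le> x"
    by transfer (metis WO ordLeq_total)
next
  have WO: "Well_order r" if "(r, r) \<in> ordIso" for r :: "'c rel"
    using that by (simp add: ordIso_def)
  fix P :: "'c ordinal \<Rightarrow> bool" and a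
  assume step: "\<And>x. (\<And>y. y < x \<Longrightarrow> P y) \<Longrightarrow> P x"
  have rep: "\<exists>r. Well_order r \<and> x = abs_ordinal r" for x :: "'c ordinal"
  proof (intro exI conjI)
    show "Well_order (rep_ordinal x)"
      by (rule WO) (rule Quotient_rep_reflp[OF Quotient_ordinal])
    show "x = abs_ordinal (rep_ordinal x)"
      by (rule Quotient_abs_rep[OF Quotient_ordinal, symmetric])
  qed
  have "P (abs_ordinal r)" if "Well_order r" for r
    using wf_ordLess that
  proof (induction r rule: wf_induct_rule)
    case (less r)
    show ?case
    proof (rule step)
      fix y assume y: "y < abs_ordinal r"
      obtain s where s: "Well_order s" "y = abs_ordinal s"
        using rep[of y] by (elim exE conjE)
      have "(s, r) \<in> ordLess"
        using y less.prems unfolding s(2)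
        by (subst (asm) less_ordinal.abs_eq) (simp_all add: s(1) ordIso_reflexive)
      then show "P y" unfolding s(2) using s(1) by (rule less.IH)
    qed
  qed
  then show "P a" using rep[of a] by (elim exE conjE) simp
qed

end


section \<open>Gabriel--Rentschler Krull dimension\<close>

text \<open>\<open>krull_class R \<alpha> M\<close> states that \<open>M\<close> belongs to the class of index \<open>\<alpha>\<close>.
  The index ranges over \<open>'o option\<close>, where \<open>'o\<close> is a type of ordinals: \<^const>\<open>None\<close> is
  the index \<open>-1\<close>, and it lies below all \<open>Some a\<close> in the library's order on options.
  The factor \<open>M\<^sub>i/M\<^sub>i\<^sub>+\<^sub>1\<close> has a carrier of sets, so the recursion passes to an
  isomorphic module on the original type; one exists, on a set of coset representatives.\<close>

inductive krull_class ::
    "('a, 'r) ring_scheme \<Rightarrow> 'o::wellorder option \<Rightarrow> ('a, 'b) rmodule \<Rightarrow> bool"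
  for R :: "('a, 'r) ring_scheme" where
  minus_one: "right_module R M \<Longrightarrow> zero_module M \<Longrightarrow> krull_class R None M"
| ordinal: "right_module R M \<Longrightarrow>
    (\<forall>C. descending_chain R M C \<longrightarrow>
       (\<exists>n. \<forall>i\<ge>n. \<exists>\<beta><Some a. \<exists>N. krull_class R \<beta> N \<and>
          rmod_iso R (quotmod (submod M (C i)) (C (Suc i))) N \<noteq> {})) \<Longrightarrow>
    krull_class R (Some a) M"

definition has_Kdim ::
    "('a, 'r) ring_scheme \<Rightarrow> ('a, 'b) rmodule \<Rightarrow> 'o::wellorder option \<Rightarrow> bool" where
  "has_Kdim R M \<alpha> \<longleftrightarrow> krull_class R \<alpha> M \<and> (\<forall>\<beta><\<alpha>. \<not> krull_class R \<beta> M)"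

definition critical_of_dim ::
    "('a, 'r) ring_scheme \<Rightarrow> 'o::wellorder \<Rightarrow> ('a, 'b) rmodule \<Rightarrow> bool" where
  "critical_of_dim R a M \<longleftrightarrow>
     has_Kdim R M (Some a) \<and>
     (\<forall>N. rsubmodule R M N \<and> N \<noteq> {\<zero>\<^bsub>M\<^esub>} \<longrightarrow>
        (\<exists>\<beta><Some a. has_Kdim R (quotmod M N) \<beta>))"

text \<open>The ordinals used here suffice: the Krull dimensions attained by
  modules of type \<open>('a, 'b) rmodule\<close> form an initial segment of the ordinals, and
  distinct ones are attained by distinct modules.  Lemma \<open>critical_of_dim_imp_critical\<close>
  below makes this precise.\<close>

definition critical :: "('a, 'r) ring_scheme \<Rightarrow> ('a, 'b) rmodule \<Rightarrow> bool" where
  "critical R M \<longleftrightarrow> (\<exists>a :: ('a, 'b) rmodule ordinal. critical_of_dim R a M)"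

definition cocritical :: "('a, 'r) ring_scheme \<Rightarrow> 'a set \<Rightarrow> bool" where
  "cocritical R I \<longleftrightarrow> right_ideal R I \<and> critical R (quotmod (regmod R) I)"


section \<open>Independence of the carrier types\<close>

lemma rmodule_transport:
  fixes N :: "('a, 'b) rmodule" and \<phi> :: "'b \<Rightarrow> 'c"
  assumes N: "right_module R N" and inj: "inj_on \<phi> (carrier N)"
  shows "\<exists>N' :: ('a, 'c) rmodule. right_module R N' \<and> \<phi> \<in> rmod_iso R N N' \<and>
           carrier N' = \<phi> ` carrier N \<and> \<zero>\<^bsub>N'\<^esub> = \<phi> \<zero>\<^bsub>N\<^esub>"
proof -
  interpret right_module R N by fact
  define \<psi> where "\<psi> = inv_into (carrier N) \<phi>"
  have \<psi>: "\<psi> (\<phi> x) = x" if "x \<in> carrier N" for x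
    using that inj by (simp add: \<psi>_def)
  define N' :: "('a, 'c) rmodule" where
    "N' = \<lparr>carrier = \<phi> ` carrier N, mult = undefined, one = undefined, zero = \<phi> \<zero>\<^bsub>N\<^esub>,
           add = (\<lambda>x y. \<phi> (\<psi> x \<oplus>\<^bsub>N\<^esub> \<psi> y)), rsmult = (\<lambda>x a. \<phi> (\<psi> x \<cdot>\<^bsub>N\<^esub> a))\<rparr>"
  have ab: "abelian_group N'"
  proof (rule abelian_groupI)
    fix x assume "x \<in> carrier N'"
    then obtain y where y: "y \<in> carrier N" "x = \<phi> y" by (auto simp: N'_def)
    then show "\<exists>y\<in>carrier N'. y \<oplus>\<^bsub>N'\<^esub> x = \<zero>\<^bsub>N'\<^esub>"
      by (intro bexI[of _ "\<phi> (\<ominus>\<^bsub>N\<^esub> y)"]) (auto simp: N'_def \<psi> M.l_neg)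
  qed (auto simp: N'_def \<psi> M.a_assoc M.a_comm M.a_lcomm)
  have mod: "right_module R N'"
    by (intro right_module.intro right_module_axioms.intro ab R.ring_axioms)
       (auto simp: N'_def \<psi> rsmult_l_distr rsmult_r_distr rsmult_assoc)
  have "\<phi> \<in> rmod_iso R N N'"
    using inj by (auto simp: rmod_iso_def iso_def hom_def bij_betw_def N'_def \<psi>)
  then show ?thesis using mod by (auto simp: N'_def)
qed

lemma right_noetherian_point_annihilator_setD:
  fixes M :: "('a, 'b) rmodule"
  assumes S: "right_noetherian_point_annihilator_set R S"
    and M: "right_module R M" "noetherian_module R M" "\<not> zero_module M"
  shows "\<exists>I\<in>S. point_annihilator R M I"
proof -
  interpret right_module R M by fact
  obtain m where m: "m \<in> carrier M" "m \<noteq> \<zero>\<^bsub>M\<^esub>"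
    using M(3) M.zero_closed by (auto simp: zero_module_def)
  have rsmult_minus: "x \<cdot>\<^bsub>M\<^esub> (\<ominus>\<^bsub>R\<^esub> a) = \<ominus>\<^bsub>M\<^esub> (x \<cdot>\<^bsub>M\<^esub> a)"
    if "x \<in> carrier M" "a \<in> carrier R" for x a
  proof -
    have z: "x \<cdot>\<^bsub>M\<^esub> \<zero>\<^bsub>R\<^esub> = \<zero>\<^bsub>M\<^esub>"
      using rsmult_r_distr[OF that(1), of "\<zero>\<^bsub>R\<^esub>" "\<zero>\<^bsub>R\<^esub>"] that
      by (metis M.add.l_cancel_one R.l_zero R.zero_closed rsmult_closed)
    show ?thesis
      using rsmult_r_distr[of x "\<ominus>\<^bsub>R\<^esub> a" a] that
      by (metis M.minus_equality R.a_inv_closed R.l_neg rsmult_closed z)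
  qed
  define mR where "mR = (\<lambda>r. m \<cdot>\<^bsub>M\<^esub> r) ` carrier R"
  have mR_sub: "mR \<subseteq> carrier M" using m by (auto simp: mR_def)
  have mR_add: "x \<oplus>\<^bsub>M\<^esub> y \<in> mR" if "x \<in> mR" "y \<in> mR" for x y
    using that m rsmult_r_distr[symmetric] by (auto simp: mR_def)
  have mR_neg: "\<ominus>\<^bsub>M\<^esub> x \<in> mR" if "x \<in> mR" for x
    using that m rsmult_minus[symmetric] by (auto simp: mR_def)
  have mR_mult: "x \<cdot>\<^bsub>M\<^esub> a \<in> mR" if "x \<in> mR" "a \<in> carrier R" for x a
    using that m rsmult_assoc[symmetric] by (auto simp: mR_def)
  have mR_m: "m \<in> mR" using m by (force simp: mR_def)
  have mR_zero: "\<zero>\<^bsub>M\<^esub> \<in> mR"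
    using mR_add[OF mR_m mR_neg[OF mR_m]] m by (simp add: M.r_neg)
  have N: "right_module R (submod M mR)"
  proof (intro right_module.intro right_module_axioms.intro R.ring_axioms abelian_groupI)
    fix x assume "x \<in> carrier (submod M mR)"
    then show "\<exists>y\<in>carrier (submod M mR). y \<oplus>\<^bsub>submod M mR\<^esub> x = \<zero>\<^bsub>submod M mR\<^esub>"
      using mR_neg mR_sub by (auto simp: submod_def intro!: bexI[of _ "\<ominus>\<^bsub>M\<^esub> x"] M.l_neg)
  qed (use mR_sub in \<open>auto simp: submod_def mR_add mR_zero mR_mult rsmult_l_distr
         rsmult_r_distr rsmult_assoc subset_iff M.a_assoc M.a_comm M.a_lcomm\<close>)
  define \<phi> where "\<phi> x = {r \<in> carrier R. m \<cdot>\<^bsub>M\<^esub> r = x}" for x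
  have inj: "inj_on \<phi> mR"
    by (rule inj_onI) (auto simp: \<phi>_def mR_def set_eq_iff)
  obtain N' :: "('a, 'a set) rmodule" where N':
    "right_module R N'" "\<phi> \<in> rmod_iso R (submod M mR) N'" "carrier N' = \<phi> ` mR"
    "\<zero>\<^bsub>N'\<^esub> = \<phi> \<zero>\<^bsub>M\<^esub>"
    using rmodule_transport[OF N, of \<phi>] inj by (auto simp: submod_def)
  interpret N': right_module R N' by fact
  have \<phi>_add: "\<phi> (x \<oplus>\<^bsub>M\<^esub> y) = \<phi> x \<oplus>\<^bsub>N'\<^esub> \<phi> y" if "x \<in> mR" "y \<in> mR" for x y
    using N'(2) that by (auto simp: rmod_iso_def iso_def hom_def submod_def)
  have \<phi>_mult: "\<phi> (x \<cdot>\<^bsub>M\<^esub> a) = \<phi> x \<cdot>\<^bsub>N'\<^esub> a" if "x \<in> mR" "a \<in> carrier R" for x a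
    using N'(2) that by (auto simp: rmod_iso_def submod_def)
  have \<phi>_neg: "\<phi> (\<ominus>\<^bsub>M\<^esub> x) = \<ominus>\<^bsub>N'\<^esub> \<phi> x" if "x \<in> mR" for x
  proof -
    have "\<phi> (\<ominus>\<^bsub>M\<^esub> x) \<oplus>\<^bsub>N'\<^esub> \<phi> x = \<zero>\<^bsub>N'\<^esub>"
      using \<phi>_add[OF mR_neg[OF that] that] that mR_sub N'(4)
      by (simp add: M.l_neg subset_iff)
    then show ?thesis
      using that mR_neg N'(3) by (metis N'.M.minus_equality image_eqI)
  qed
  have pull: "rsubmodule R M {x \<in> mR. \<phi> x \<in> K}" if K: "rsubmodule R N' K" for K
  proof -
    interpret K: additive_subgroup K N' using K by (simp add: rsubmodule_def)
    have "additive_subgroup {x \<in> mR. \<phi> x \<in> K} M"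
    proof (rule additive_subgroupI, rule M.add.subgroupI)
      show "{x \<in> mR. \<phi> x \<in> K} \<noteq> {}"
        using mR_zero N'(4) K.zero_closed by auto
      fix x assume "x \<in> {x \<in> mR. \<phi> x \<in> K}"
      then show "\<ominus>\<^bsub>M\<^esub> x \<in> {x \<in> mR. \<phi> x \<in> K}"
        using mR_neg \<phi>_neg K.a_inv_closed by simp
    qed (use mR_sub mR_add \<phi>_add K.a_closed in auto)
    moreover have "\<phi> (x \<cdot>\<^bsub>M\<^esub> a) \<in> K" if "x \<in> mR" "\<phi> x \<in> K" "a \<in> carrier R" for x a
      using that \<phi>_mult K by (simp add: rsubmodule_def)
    ultimately show ?thesis using mR_mult by (simp add: rsubmodule_def)
  qed
  have "noetherian_module R N'"
    unfolding noetherian_module_def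
  proof (intro allI impI)
    fix C assume C: "ascending_chain R N' C"
    define D where "D i = {x \<in> mR. \<phi> x \<in> C i}" for i
    have "C i \<subseteq> carrier N'" for i
      using C additive_subgroup.a_subset by (fastforce simp: ascending_chain_def rsubmodule_def)
    then have CD: "C i = \<phi> ` D i" for i
      using N'(3) by (auto simp: D_def)
    have "ascending_chain R M D"
      using C pull by (auto simp: ascending_chain_def D_def)
    then obtain n where "\<forall>i\<ge>n. D i = D n"
      using M(2) by (auto simp: noetherian_module_def)
    then show "\<exists>n. \<forall>i\<ge>n. C i = C n" by (auto simp: CD)
  qed
  moreover have "\<not> zero_module N'"
    using N'(3,4) mR_m inj_on_eq_iff[OF inj mR_m mR_zero] m by (auto simp: zero_module_def)
  ultimately obtain I where I: "I \<in> S" "point_annihilator R N' I"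
    using S N'(1) by (auto simp: right_noetherian_point_annihilator_set_def)
  then obtain x where x: "x \<in> mR" "\<phi> x \<noteq> \<phi> \<zero>\<^bsub>M\<^esub>" "I = annih R N' (\<phi> x)"
    using N'(3,4) by (auto simp: point_annihilator_def)
  have "\<phi> x \<cdot>\<^bsub>N'\<^esub> r = \<zero>\<^bsub>N'\<^esub> \<longleftrightarrow> x \<cdot>\<^bsub>M\<^esub> r = \<zero>\<^bsub>M\<^esub>" if "r \<in> carrier R" for r
    using inj_on_eq_iff[OF inj mR_mult[OF x(1) that] mR_zero] \<phi>_mult[OF x(1) that] N'(4)
    by simp
  then have "I = annih R M x" using x(3) by (auto simp: annih_def)
  then show ?thesis
    using I(1) x(1,2) mR_sub unfolding point_annihilator_def by (metis subsetD)
qed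

lemma krull_class_None: "krull_class R None M \<longleftrightarrow> right_module R M \<and> zero_module M"
  by (auto elim: krull_class.cases intro: krull_class.minus_one)

lemma krull_class_Some:
  fixes M :: "('a, 'b) rmodule"
  shows "krull_class R (Some a) M \<longleftrightarrow> right_module R M \<and>
    (\<forall>C. descending_chain R M C \<longrightarrow>
       (\<exists>n. \<forall>i\<ge>n. \<exists>\<beta><Some a. \<exists>N :: ('a, 'b) rmodule. krull_class R \<beta> N \<and>
          rmod_iso R (quotmod (submod M (C i)) (C (Suc i))) N \<noteq> {}))"
  by (subst krull_class.simps) simp

lemma Kdim_initial_segment:
  fixes M :: "('a, 'b) rmodule" and b :: "'o::wellorder"
  assumes M: "has_Kdim R M \<alpha>" and le: "Some b \<le> \<alpha>"
  shows "\<exists>W :: ('a, 'b) rmodule. has_Kdim R W (Some b)"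
proof (rule ccontr)
  assume no: "\<not> ?thesis"
  have "\<exists>\<delta><Some b. krull_class R \<delta> W"
    if "krull_class R \<gamma> W" "Some b \<le> \<gamma>" for \<gamma> and W :: "('a, 'b) rmodule"
    using that
  proof (induction \<gamma> arbitrary: W rule: less_induct)
    case (less \<gamma>)
    then obtain c where c: "\<gamma> = Some c" by (cases \<gamma>) auto
    have lower: "\<exists>\<delta>'<Some b. krull_class R \<delta>' N"
      if "\<delta> < Some c" "krull_class R \<delta> N" for \<delta> and N :: "('a, 'b) rmodule"
      using less.IH[of \<delta> N] that c by (cases "\<delta> < Some b") auto
    have "krull_class R (Some b) W"
      unfolding krull_class_Some
    proof (intro conjI allI impI)
      show "right_module R W" using less.prems c by (simp add: krull_class_Some)
      fix C assume "descending_chain R W C"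
      then obtain n where n: "\<forall>i\<ge>n. \<exists>\<beta><Some c. \<exists>N :: ('a, 'b) rmodule. krull_class R \<beta> N \<and>
          rmod_iso R (quotmod (submod W (C i)) (C (Suc i))) N \<noteq> {}"
        using less.prems c by (auto simp: krull_class_Some)
      show "\<exists>n. \<forall>i\<ge>n. \<exists>\<beta><Some b. \<exists>N :: ('a, 'b) rmodule. krull_class R \<beta> N \<and>
          rmod_iso R (quotmod (submod W (C i)) (C (Suc i))) N \<noteq> {}"
      proof (intro exI[of _ n] allI impI)
        fix i assume "n \<le> i"
        then obtain \<delta> and N :: "('a, 'b) rmodule"
          where N: "\<delta> < Some c" "krull_class R \<delta> N"
            "rmod_iso R (quotmod (submod W (C i)) (C (Suc i))) N \<noteq> {}"
          using n by blast
        from lower[OF N(1,2)] N(3)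
        show "\<exists>\<beta><Some b. \<exists>N :: ('a, 'b) rmodule. krull_class R \<beta> N \<and>
            rmod_iso R (quotmod (submod W (C i)) (C (Suc i))) N \<noteq> {}" by blast
      qed
    qed
    then show ?case using no by (auto simp: has_Kdim_def)
  qed
  from this[of \<alpha> M] M le show False
    by (auto simp: has_Kdim_def dest: order_less_le_trans)
qed

lemma Kdim_transfer:
  fixes f :: "'o::wellorder \<Rightarrow> 'p::wellorder" and M :: "('a, 'b) rmodule"
  assumes mono: "\<And>b c. c < b \<Longrightarrow> b \<le> a \<Longrightarrow> f c < f b"
    and down: "\<And>b q. b \<le> a \<Longrightarrow> q < f b \<Longrightarrow> \<exists>c<b. q = f c"
    and \<beta>: "\<beta> \<le> Some a"
  shows "has_Kdim R M (map_option f \<beta>) \<longleftrightarrow> has_Kdim R M \<beta>"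
proof -
  have below: "(\<exists>\<delta><map_option f \<beta>. P \<delta>) \<longleftrightarrow> (\<exists>\<delta><\<beta>. P (map_option f \<delta>))"
    if le: "\<beta> \<le> Some a" for \<beta> P
  proof (cases \<beta>)
    case (Some b)
    show ?thesis
    proof
      assume "\<exists>\<delta><map_option f \<beta>. P \<delta>"
      then obtain \<delta> where \<delta>: "\<delta> < Some (f b)" "P \<delta>" using Some by auto
      show "\<exists>\<delta><\<beta>. P (map_option f \<delta>)"
      proof (cases \<delta>)
        case None
        then show ?thesis using Some \<delta> by (intro exI[of _ None]) auto
      next
        case (Some q)
        then obtain c where "c < b" "q = f c"
          using down[of b q] \<delta> le \<open>\<beta> = Some b\<close> by auto
        then show ?thesis using Some \<delta> \<open>\<beta> = Some b\<close> by (intro exI[of _ "Some c"]) auto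
      qed
    next
      assume "\<exists>\<delta><\<beta>. P (map_option f \<delta>)"
      then obtain \<delta> where "\<delta> < Some b" "P (map_option f \<delta>)" using Some by auto
      then show "\<exists>\<delta><map_option f \<beta>. P \<delta>"
        using mono[of _ b] le Some by (intro exI[of _ "map_option f \<delta>"]) (cases \<delta>, auto)
    qed
  qed auto
  have K: "krull_class R (map_option f \<beta>) W \<longleftrightarrow> krull_class R \<beta> W"
    if "\<beta> \<le> Some a" for \<beta> and W :: "('a, 'b) rmodule"
    using that
  proof (induction \<beta> arbitrary: W rule: less_induct)
    case (less \<beta>)
    show ?case
    proof (cases \<beta>)
      case None
      then show ?thesis by (simp add: krull_class_None)
    next
      case (Some b)
      have IH: "krull_class R (map_option f \<delta>) N \<longleftrightarrow> krull_class R \<delta> N"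
        if "\<delta> < Some b" for \<delta> and N :: "('a, 'b) rmodule"
        using less.IH[of \<delta> N] less.prems that Some order_trans[OF less_imp_le[OF that]] by simp
      have "(\<exists>\<delta><Some (f b). \<exists>N. krull_class R \<delta> N \<and> Q N) \<longleftrightarrow>
          (\<exists>\<delta><Some b. \<exists>N. krull_class R \<delta> N \<and> Q N)" for Q :: "('a, 'b) rmodule \<Rightarrow> bool"
        using below[OF less.prems, of "\<lambda>\<delta>. \<exists>N. krull_class R \<delta> N \<and> Q N"] IH Some by auto
      then show ?thesis using Some by (simp add: krull_class_Some)
    qed
  qed
  have "(\<exists>\<delta><map_option f \<beta>. krull_class R \<delta> M) \<longleftrightarrow> (\<exists>\<delta><\<beta>. krull_class R \<delta> M)"
    unfolding below[OF \<beta>] using K order_trans[OF less_imp_le \<beta>] by blast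
  then show ?thesis using K \<beta> by (auto simp: has_Kdim_def)
qed

lemma ordinal_embedding:
  fixes W :: "'o::wellorder \<Rightarrow> 'c"
  assumes inj: "inj_on W {..a}"
  shows "\<exists>f :: 'o \<Rightarrow> 'c ordinal. (\<forall>b c. c < b \<longrightarrow> b \<le> a \<longrightarrow> f c < f b) \<and>
           (\<forall>b q. b \<le> a \<longrightarrow> q < f b \<longrightarrow> (\<exists>c<b. q = f c))"
proof -
  define r where "r b = {(W x, W y) |x y. x \<le> y \<and> y < b}" for b
  have W_eq: "W x = W y \<longleftrightarrow> x = y" if "x \<le> a" "y \<le> a" for x y
    using inj that by (simp add: inj_on_eq_iff)
  have mem: "(W x, W y) \<in> r b \<longleftrightarrow> x \<le> y \<and> y < b" if "x \<le> a" "y \<le> a" "b \<le> a" for x y b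
    using that by (auto simp: r_def W_eq)
  have rD: "\<exists>x y. u = W x \<and> v = W y \<and> x \<le> y \<and> y < b" if "(u, v) \<in> r b" for u v b
    using that unfolding r_def by blast
  have Fld: "Field (r b) = W ` {..<b}" for b
    by (force simp: r_def Field_def)
  have lin: "Linear_order (r b)" if b: "b \<le> a" for b
    unfolding order_on_defs
  proof (intro conjI)
    show "refl_on (Field (r b)) (r b)"
      unfolding refl_on_def Fld by (auto simp: r_def)
    show "trans (r b)"
    proof (rule transI)
      fix u v w assume "(u, v) \<in> r b" "(v, w) \<in> r b"
      then obtain x y y' z where *: "u = W x" "v = W y" "v = W y'" "w = W z"
        "x \<le> y" "y < b" "y' \<le> z" "z < b"
        using rD by meson
      moreover have "y = y'" using * b W_eq[of y y'] by simp
      ultimately show "(u, w) \<in> r b" using b by (simp add: mem)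
    qed
    show "antisym (r b)"
    proof (rule antisymI)
      fix u v assume "(u, v) \<in> r b" "(v, u) \<in> r b"
      then obtain x y x' y' where *: "u = W x" "v = W y" "v = W y'" "u = W x'"
        "x \<le> y" "y < b" "y' \<le> x'" "x' < b"
        using rD by meson
      moreover have "y = y'" "x = x'" using * b W_eq[of y y'] W_eq[of x x'] by simp_all
      ultimately show "u = v" by simp
    qed
    show "total_on (Field (r b)) (r b)"
      unfolding total_on_def Fld using b by (auto simp: r_def) (metis linear)
  qed (auto simp: r_def Field_def)
  have WO: "Well_order (r b)" if b: "b \<le> a" for b
    unfolding Linear_order_Well_order_iff[OF lin[OF b]]
  proof (intro allI impI)
    fix A assume A: "A \<subseteq> Field (r b)" "A \<noteq> {}"
    then obtain x where x: "x < b" "W x \<in> A" by (auto simp: Fld)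
    define m where "m = (LEAST x. x < b \<and> W x \<in> A)"
    have m: "m < b \<and> W m \<in> A"
      unfolding m_def using x LeastI[of "\<lambda>x. x < b \<and> W x \<in> A" x] by simp
    have "(W m, y) \<in> r b" if y: "y \<in> A" for y
    proof -
      obtain z where z: "z < b" "y = W z" using y A unfolding Fld by blast
      then have "m \<le> z" unfolding m_def using y Least_le[of "\<lambda>x. x < b \<and> W x \<in> A" z] by simp
      then show ?thesis using z by (auto simp: r_def)
    qed
    then show "\<exists>x\<in>A. \<forall>y\<in>A. (x, y) \<in> r b" using m by blast
  qed
  have seg: "Restr (r b) (underS (r b) (W c)) = r c" if "c < b" "b \<le> a" for b c
  proof -
    have ca: "x \<le> a" if "x \<le> c" for x
      using that \<open>c < b\<close> \<open>b \<le> a\<close> by simp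
    have "u \<in> underS (r b) (W c) \<longleftrightarrow> u \<in> W ` {..<c}" for u
    proof
      assume u: "u \<in> underS (r b) (W c)"
      then have "(u, W c) \<in> r b" by (simp add: underS_def)
      from rD[OF this] obtain x y where *: "u = W x" "W c = W y" "x \<le> y" "y < b"
        by (elim exE conjE)
      then have "y = c" using that W_eq[of c y] by simp
      moreover have "x \<noteq> c" using u *(1) by (auto simp: underS_def)
      ultimately have "x < c" using *(3) by simp
      then show "u \<in> W ` {..<c}" unfolding *(1) by simp
    next
      assume "u \<in> W ` {..<c}"
      then obtain x where "u = W x" "x < c" by auto
      then show "u \<in> underS (r b) (W c)"
        using that W_eq[of x c] mem[of x c b] ca by (simp add: underS_def less_imp_le)
    qed
    then have U: "underS (r b) (W c) = W ` {..<c}" by blast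
    have WU: "W y \<in> W ` {..<c} \<longleftrightarrow> y < c" if "y < b" for y
    proof
      assume "W y \<in> W ` {..<c}"
      then obtain x where x: "W y = W x" "x < c" by auto
      then show "y < c" using W_eq[of y x] ca[of x] that \<open>b \<le> a\<close> by simp
    qed auto
    show ?thesis
    proof (intro equalityI subsetI)
      fix p assume "p \<in> Restr (r b) (underS (r b) (W c))"
      then have p: "(fst p, snd p) \<in> r b" "snd p \<in> W ` {..<c}" unfolding U by auto
      from rD[OF p(1)] obtain x y where *: "fst p = W x" "snd p = W y" "x \<le> y" "y < b"
        by (elim exE conjE)
      then have "y < c" using WU p(2) by simp
      then have "(W x, W y) \<in> r c" using * mem[of x y c] ca[of y] ca[of x] ca[of c] by simp
      then show "p \<in> r c" using * by (metis prod.collapse)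
    next
      fix p assume "p \<in> r c"
      then have "(fst p, snd p) \<in> r c" by simp
      from rD[OF this] obtain x y where "fst p = W x" "snd p = W y" and xy: "x \<le> y" "y < c"
        by (elim exE conjE)
      then have *: "p = (W x, W y)" by (metis prod.collapse)
      then have "p \<in> r b" using ca[of y] ca[of x] that mem[of x y b] xy * by simp
      then show "p \<in> Restr (r b) (underS (r b) (W c))"
        unfolding U using * xy by simp
    qed
  qed
  define f where "f b = abs_ordinal (r b)" for b
  have lt: "(s, r b) \<in> ordLess \<longleftrightarrow> (\<exists>c<b. (s, r c) \<in> ordIso)"
    if "b \<le> a" "Well_order s" for s b
    using ordLess_iff_ordIso_Restr[OF WO[OF that(1)] that(2)] seg that(1) by (auto simp: Fld)
  have "f c < f b" if "c < b" "b \<le> a" for b c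
  proof -
    have "c \<le> a" using that by simp
    then show ?thesis
      using lt[OF that(2) WO[of c]] that WO
      by (auto simp: f_def less_ordinal.abs_eq ordIso_reflexive)
  qed
  moreover have "\<exists>c<b. q = f c" if b: "b \<le> a" "q < f b" for b q
  proof -
    define s where "s = rep_ordinal q"
    have s: "(s, s) \<in> ordIso" "q = abs_ordinal s"
      using Quotient_rep_reflp[OF Quotient_ordinal, of q]
        Quotient_abs_rep[OF Quotient_ordinal, of q] by (simp_all add: s_def)
    have WOs: "Well_order s" using s(1) by (simp add: ordIso_def)
    have "(s, r b) \<in> ordLess"
      using b(2) WO[OF b(1)] s unfolding f_def
      by (simp add: less_ordinal.abs_eq ordIso_reflexive)
    then obtain c where c: "c < b" "(s, r c) \<in> ordIso"
      using lt[OF b(1) WOs] by blast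
    then have "q = f c"
      using s(2) Quotient_rel_abs[OF Quotient_ordinal, of s "r c"] by (simp add: f_def)
    then show ?thesis using c by blast
  qed
  ultimately show ?thesis by blast
qed

lemma critical_of_dim_imp_critical:
  fixes M :: "('a, 'b) rmodule" and a :: "'o::wellorder"
  assumes crit: "critical_of_dim R a M"
  shows "critical R M"
proof -
  have M: "has_Kdim R M (Some a)" using crit by (simp add: critical_of_dim_def)
  have "\<forall>b. \<exists>W :: ('a, 'b) rmodule. b \<le> a \<longrightarrow> has_Kdim R W (Some b)"
    using Kdim_initial_segment[OF M] by (metis less_eq_option_Some)
  then obtain W :: "'o \<Rightarrow> ('a, 'b) rmodule"
    where W: "\<And>b. b \<le> a \<Longrightarrow> has_Kdim R (W b) (Some b)" by metis
  have "inj_on W {..a}"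
  proof (rule inj_onI)
    fix x y assume xy: "x \<in> {..a}" "y \<in> {..a}" "W x = W y"
    then have "has_Kdim R (W x) (Some x)" "has_Kdim R (W x) (Some y)"
      using W[of x] W[of y] by auto
    then have "\<not> Some x < Some y" "\<not> Some y < Some x" by (auto simp: has_Kdim_def)
    then show "x = y" by auto
  qed
  then obtain f :: "'o \<Rightarrow> ('a, 'b) rmodule ordinal"
    where mono: "\<And>b c. c < b \<Longrightarrow> b \<le> a \<Longrightarrow> f c < f b"
      and down: "\<And>b q. b \<le> a \<Longrightarrow> q < f b \<Longrightarrow> \<exists>c<b. q = f c"
    using ordinal_embedding[of W a] by blast
  have "critical_of_dim R (f a) M"
    unfolding critical_of_dim_def
  proof (intro conjI allI impI)
    show "has_Kdim R M (Some (f a))"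
      using Kdim_transfer[of a f "Some a" R M, OF mono down] M by simp
    fix N assume "rsubmodule R M N \<and> N \<noteq> {\<zero>\<^bsub>M\<^esub>}"
    then obtain \<beta> where \<beta>: "\<beta> < Some a" "has_Kdim R (quotmod M N) \<beta>"
      using crit by (auto simp: critical_of_dim_def)
    have "has_Kdim R (quotmod M N) (map_option f \<beta>)"
      using Kdim_transfer[of a f \<beta> R "quotmod M N", OF mono down] \<beta> by simp
    moreover have "map_option f \<beta> < Some (f a)"
      using \<beta>(1) mono[of _ a] by (cases \<beta>) auto
    ultimately show "\<exists>\<beta><Some (f a). has_Kdim R (quotmod M N) \<beta>" by blast
  qed
  then show ?thesis by (auto simp: critical_def)
qed

end

theory Submission
  imports Defs
begin

text \<open>All module notions are translated to intervals \<open>[A, B]\<close> of right ideals.  If every member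
  of a point annihilator set is finitely generated, then \<open>R\<close> is right noetherian: for \<open>I\<close> maximal
  among the right ideals that are not finitely generated, \<open>R/I\<close> is noetherian, some residual
  \<open>(I : x)\<close> with \<open>x \<notin> I\<close> is in the set, and \<open>I + x R\<close> and \<open>(I : x)\<close> finitely generated force \<open>I\<close>
  to be so, as in Cohen's theorem.  If \<open>R\<close> is right noetherian and every \<open>R/P\<close> is finitely
  cogenerated, take \<open>I\<close> maximal with \<open>R/I\<close> not artinian; the submodule \<open>x R \<cong> R/(I : x)\<close> of \<open>R/I\<close>
  has artinian proper factors and is finitely cogenerated, hence is artinian, a contradiction.
  Conversely, right artinian rings are right noetherian by Hopkins--Levitzki.  The conditions on
  cocritical right ideals are the same statement for another set, since the cocritical right ideals
  form a point annihilator set (nonzero noetherian modules contain critical submodules) and over a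
  right artinian ring a critical cyclic module has Krull dimension \<open>0\<close>, so is simple.\<close>

section \<open>Submodules and quotient modules\<close>

text \<open>Each factor of a module has sets as its elements, so factors of factors climb through
  the types \<open>'a set\<close>, \<open>'a set set\<close> and so on. Right ideals stay in
  \<open>'a set\<close>; that is why chain conditions, length, cogeneration and Krull dimension are
  attached to a pair \<open>A \<subseteq> B\<close>, standing for \<open>B/A\<close>, and the locale
  \<open>presentation\<close> transfers each of them once. The isomorphism
  \<open>R/(I : x) \<cong> (I + x R)/I\<close> becomes the pair of inverse maps
  \<open>adjoin\<close> and \<open>residual\<close> between intervals. Finite length is used only
  through finite cogeneration, and is recovered from both chain conditions together. For
  Hopkins--Levitzki no semisimple module is decomposed: a right ideal maximal among those avoiding
  one given element cuts out a simple factor. That a noetherian module has a Krull dimension is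
  usually shown with a supremum of ordinals; in a fixed type this is replaced by an element above
  all dimensions attained on one carrier type, and such an element exists by Cantor's
  theorem.\<close>

context right_module
begin

lemma rsmult_zero [simp]: "x \<in> carrier M \<Longrightarrow> x \<cdot>\<^bsub>M\<^esub> \<zero>\<^bsub>R\<^esub> = \<zero>\<^bsub>M\<^esub>"
  using rsmult_r_distr[of x "\<zero>\<^bsub>R\<^esub>" "\<zero>\<^bsub>R\<^esub>"]
  by (metis M.add.l_cancel_one R.l_zero R.zero_closed rsmult_closed)

lemma rsmult_minus:
  assumes "x \<in> carrier M" "a \<in> carrier R"
  shows "x \<cdot>\<^bsub>M\<^esub> (\<ominus>\<^bsub>R\<^esub> a) = \<ominus>\<^bsub>M\<^esub> (x \<cdot>\<^bsub>M\<^esub> a)"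
  using rsmult_r_distr[of x "\<ominus>\<^bsub>R\<^esub> a" a] assms
  by (metis M.minus_equality R.a_inv_closed R.l_neg rsmult_closed rsmult_zero)

text \<open>Closure under negatives is automatic, since
  \<open>x \<cdot> (- 1) = - x\<close>.\<close>

lemma rsubmodule_iff:
  "rsubmodule R M N \<longleftrightarrow> N \<subseteq> carrier M \<and> \<zero>\<^bsub>M\<^esub> \<in> N \<and> (\<forall>x\<in>N. \<forall>y\<in>N. x \<oplus>\<^bsub>M\<^esub> y \<in> N) \<and>
     (\<forall>x\<in>N. \<forall>a\<in>carrier R. x \<cdot>\<^bsub>M\<^esub> a \<in> N)"
proof
  assume N: "rsubmodule R M N"
  then interpret N: additive_subgroup N M by (simp add: rsubmodule_def)
  show "N \<subseteq> carrier M \<and> \<zero>\<^bsub>M\<^esub> \<in> N \<and> (\<forall>x\<in>N. \<forall>y\<in>N. x \<oplus>\<^bsub>M\<^esub> y \<in> N) \<and>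
     (\<forall>x\<in>N. \<forall>a\<in>carrier R. x \<cdot>\<^bsub>M\<^esub> a \<in> N)"
    using N N.a_subset by (auto simp: rsubmodule_def)
next
  assume N: "N \<subseteq> carrier M \<and> \<zero>\<^bsub>M\<^esub> \<in> N \<and> (\<forall>x\<in>N. \<forall>y\<in>N. x \<oplus>\<^bsub>M\<^esub> y \<in> N) \<and>
     (\<forall>x\<in>N. \<forall>a\<in>carrier R. x \<cdot>\<^bsub>M\<^esub> a \<in> N)"
  have "\<ominus>\<^bsub>M\<^esub> x \<in> N" if "x \<in> N" for x
    using N that rsmult_minus[of x "\<one>\<^bsub>R\<^esub>"]
    by (metis R.a_inv_closed R.one_closed rsmult_one subsetD)
  then have "additive_subgroup N M"
    using N by (intro additive_subgroupI M.add.subgroupI) auto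
  then show "rsubmodule R M N" using N by (simp add: rsubmodule_def)
qed

lemma submod_right_module:
  assumes "rsubmodule R M N"
  shows "right_module R (submod M N)"
proof -
  have N: "N \<subseteq> carrier M" "\<zero>\<^bsub>M\<^esub> \<in> N" "\<And>x y. x \<in> N \<Longrightarrow> y \<in> N \<Longrightarrow> x \<oplus>\<^bsub>M\<^esub> y \<in> N"
    "\<And>x a. x \<in> N \<Longrightarrow> a \<in> carrier R \<Longrightarrow> x \<cdot>\<^bsub>M\<^esub> a \<in> N"
    using assms by (auto simp: rsubmodule_iff)
  have neg: "\<ominus>\<^bsub>M\<^esub> x \<in> N" if "x \<in> N" for x
    using assms that additive_subgroup.a_inv_closed abelian_group_axioms
    by (metis M.abelian_group_axioms rsubmodule_def)
  show ?thesis
  proof (intro right_module.intro right_module_axioms.intro R.ring_axioms abelian_groupI)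
    fix x assume "x \<in> carrier (submod M N)"
    then show "\<exists>y\<in>carrier (submod M N). y \<oplus>\<^bsub>submod M N\<^esub> x = \<zero>\<^bsub>submod M N\<^esub>"
      using neg N(1) by (auto simp: submod_def intro!: bexI[of _ "\<ominus>\<^bsub>M\<^esub> x"] M.l_neg)
  qed (use N in \<open>auto simp: submod_def rsmult_l_distr
         rsmult_r_distr rsmult_assoc subset_iff M.a_assoc M.a_comm M.a_lcomm\<close>)
qed

text \<open>The last four conclusions say that \<open>x \<mapsto> N + x\<close> is a surjective
  homomorphism with kernel \<open>N\<close>; they replace the record fields of
  \<open>quotmod\<close> from here on. The action is written there as a union over representatives,
  and it is well defined because all representatives of a coset give the same term.\<close>

lemma quotmod_right_module:
  assumes N: "rsubmodule R M N"
  shows "right_module R (quotmod M N)"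
    and "carrier (quotmod M N) = (\<lambda>x. N +>\<^bsub>M\<^esub> x) ` carrier M"
    and "\<And>x y. x \<in> carrier M \<Longrightarrow> y \<in> carrier M \<Longrightarrow>
      N +>\<^bsub>M\<^esub> (x \<oplus>\<^bsub>M\<^esub> y) = (N +>\<^bsub>M\<^esub> x) \<oplus>\<^bsub>quotmod M N\<^esub> (N +>\<^bsub>M\<^esub> y)"
    and "\<And>x a. x \<in> carrier M \<Longrightarrow> a \<in> carrier R \<Longrightarrow>
      N +>\<^bsub>M\<^esub> (x \<cdot>\<^bsub>M\<^esub> a) = (N +>\<^bsub>M\<^esub> x) \<cdot>\<^bsub>quotmod M N\<^esub> a"
    and "\<And>x. x \<in> carrier M \<Longrightarrow> N +>\<^bsub>M\<^esub> x = \<zero>\<^bsub>quotmod M N\<^esub> \<longleftrightarrow> x \<in> N"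
proof -
  interpret N: abelian_subgroup N M
    using N M.abelian_group_axioms by (intro abelian_subgroupI3) (auto simp: rsubmodule_def)
  have mult: "x \<cdot>\<^bsub>M\<^esub> a \<in> N" if "x \<in> N" "a \<in> carrier R" for x a
    using N that by (simp add: rsubmodule_def)
  show car: "carrier (quotmod M N) = (\<lambda>x. N +>\<^bsub>M\<^esub> x) ` carrier M"
    by (auto simp: quotmod_def A_RCOSETS_def')
  show add: "N +>\<^bsub>M\<^esub> (x \<oplus>\<^bsub>M\<^esub> y) = (N +>\<^bsub>M\<^esub> x) \<oplus>\<^bsub>quotmod M N\<^esub> (N +>\<^bsub>M\<^esub> y)"
    if "x \<in> carrier M" "y \<in> carrier M" for x y
    using N.a_rcos_sum[OF that] by (simp add: quotmod_def)
  show smult: "N +>\<^bsub>M\<^esub> (x \<cdot>\<^bsub>M\<^esub> a) = (N +>\<^bsub>M\<^esub> x) \<cdot>\<^bsub>quotmod M N\<^esub> a"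
    if x: "x \<in> carrier M" and a: "a \<in> carrier R" for x a
  proof -
    have "N +>\<^bsub>M\<^esub> (y \<cdot>\<^bsub>M\<^esub> a) = N +>\<^bsub>M\<^esub> (x \<cdot>\<^bsub>M\<^esub> a)" if y: "y \<in> N +>\<^bsub>M\<^esub> x" for y
    proof -
      obtain n where n: "n \<in> N" "y = n \<oplus>\<^bsub>M\<^esub> x" using y by (auto simp: a_r_coset_def')
      have "y \<cdot>\<^bsub>M\<^esub> a = (n \<cdot>\<^bsub>M\<^esub> a) \<oplus>\<^bsub>M\<^esub> (x \<cdot>\<^bsub>M\<^esub> a)"
        using n x a N.a_subset by (auto intro!: rsmult_l_distr)
      then have "y \<cdot>\<^bsub>M\<^esub> a \<in> N +>\<^bsub>M\<^esub> (x \<cdot>\<^bsub>M\<^esub> a)"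
        using mult[OF n(1) a] by (auto simp: a_r_coset_def')
      from N.a_repr_independence'[OF this rsmult_closed[OF x a]] show ?thesis by (rule sym)
    qed
    moreover have "N +>\<^bsub>M\<^esub> x \<noteq> {}" using N.a_rcos_self[OF x] by blast
    ultimately have "(\<Union>y\<in>N +>\<^bsub>M\<^esub> x. N +>\<^bsub>M\<^esub> (y \<cdot>\<^bsub>M\<^esub> a)) = N +>\<^bsub>M\<^esub> (x \<cdot>\<^bsub>M\<^esub> a)"
      by (intro SUP_eq_const)
    then show ?thesis by (simp add: quotmod_def)
  qed
  show zero: "N +>\<^bsub>M\<^esub> x = \<zero>\<^bsub>quotmod M N\<^esub> \<longleftrightarrow> x \<in> N" if "x \<in> carrier M" for x
    using that N.a_rcos_const N.a_rcos_self by (auto simp: quotmod_def)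
  have zeroE: "\<zero>\<^bsub>quotmod M N\<^esub> = N +>\<^bsub>M\<^esub> \<zero>\<^bsub>M\<^esub>"
    using zero[of "\<zero>\<^bsub>M\<^esub>"] N.zero_closed by simp
  have Q: "abelian_group (quotmod M N)"
  proof (rule abelian_groupI)
    fix X assume "X \<in> carrier (quotmod M N)"
    then obtain x where "x \<in> carrier M" "X = N +>\<^bsub>M\<^esub> x" by (auto simp: car)
    then show "\<exists>Y\<in>carrier (quotmod M N). Y \<oplus>\<^bsub>quotmod M N\<^esub> X = \<zero>\<^bsub>quotmod M N\<^esub>"
      by (intro bexI[of _ "N +>\<^bsub>M\<^esub> (\<ominus>\<^bsub>M\<^esub> x)"]) (auto simp: car zeroE add[symmetric] M.l_neg)
  qed (auto simp: car zeroE add[symmetric] M.a_assoc M.a_comm M.a_lcomm)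
  show "right_module R (quotmod M N)"
  proof (intro right_module.intro right_module_axioms.intro R.ring_axioms Q)
    fix X Y a b assume "X \<in> carrier (quotmod M N)"
    then obtain x where x: "x \<in> carrier M" "X = N +>\<^bsub>M\<^esub> x" by (auto simp: car)
    show "X \<cdot>\<^bsub>quotmod M N\<^esub> \<one>\<^bsub>R\<^esub> = X" using x smult[of x "\<one>\<^bsub>R\<^esub>"] by simp
    assume a: "a \<in> carrier R"
    show "X \<cdot>\<^bsub>quotmod M N\<^esub> a \<in> carrier (quotmod M N)"
      using x a smult[of x a, symmetric] by (auto simp: car)
    show "(X \<oplus>\<^bsub>quotmod M N\<^esub> Y) \<cdot>\<^bsub>quotmod M N\<^esub> a =
        X \<cdot>\<^bsub>quotmod M N\<^esub> a \<oplus>\<^bsub>quotmod M N\<^esub> Y \<cdot>\<^bsub>quotmod M N\<^esub> a"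
      if "Y \<in> carrier (quotmod M N)"
    proof -
      obtain y where "y \<in> carrier M" "Y = N +>\<^bsub>M\<^esub> y" using \<open>Y \<in> _\<close> by (auto simp: car)
      then show ?thesis using x a by (simp add: add[symmetric] smult[symmetric] rsmult_l_distr)
    qed
    assume b: "b \<in> carrier R"
    show "X \<cdot>\<^bsub>quotmod M N\<^esub> (a \<oplus>\<^bsub>R\<^esub> b) = X \<cdot>\<^bsub>quotmod M N\<^esub> a \<oplus>\<^bsub>quotmod M N\<^esub> X \<cdot>\<^bsub>quotmod M N\<^esub> b"
      using x a b by (simp add: add[symmetric] smult[symmetric] rsmult_r_distr)
    show "X \<cdot>\<^bsub>quotmod M N\<^esub> (a \<otimes>\<^bsub>R\<^esub> b) = (X \<cdot>\<^bsub>quotmod M N\<^esub> a) \<cdot>\<^bsub>quotmod M N\<^esub> b"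
      using x a b by (simp add: smult[symmetric] rsmult_assoc)
  qed
qed

end

lemma (in ring) regmod_right_module: "right_module R (regmod R)"
proof (intro right_module.intro right_module_axioms.intro ring_axioms abelian_groupI)
  fix x assume "x \<in> carrier (regmod R)"
  then show "\<exists>y\<in>carrier (regmod R). y \<oplus>\<^bsub>regmod R\<^esub> x = \<zero>\<^bsub>regmod R\<^esub>"
    by (auto simp: regmod_def l_neg intro!: bexI[of _ "\<ominus> x"])
qed (auto simp: regmod_def l_distr r_distr m_assoc a_assoc a_comm a_lcomm)

lemma (in ring) right_ideal_iff:
  "right_ideal R I \<longleftrightarrow> I \<subseteq> carrier R \<and> \<zero> \<in> I \<and> (\<forall>x\<in>I. \<forall>y\<in>I. x \<oplus> y \<in> I) \<and>
     (\<forall>x\<in>I. \<forall>a\<in>carrier R. x \<otimes> a \<in> I)"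
  using right_module.rsubmodule_iff[OF regmod_right_module, of I]
  by (simp add: right_ideal_def regmod_def)

no_notation Sum_Type.Plus (infixr "<+>" 65)

section \<open>Right ideals\<close>

definition ideal_interval :: "('a, 'r) ring_scheme \<Rightarrow> 'a set \<Rightarrow> 'a set \<Rightarrow> 'a set set" where
  "ideal_interval R A B = {C. right_ideal R C \<and> A \<subseteq> C \<and> C \<subseteq> B}"

text \<open>Well-foundedness rather than chains: a nonempty family then has an extremal member at
  once, and both chain conditions are instances of one statement about a relation.\<close>

abbreviation acc :: "'a set set \<Rightarrow> bool" where
  "acc L \<equiv> wfp_on L (\<lambda>x y. y \<subset> x)"

abbreviation dcc :: "'a set set \<Rightarrow> bool" where
  "dcc L \<equiv> wfp_on L (\<lambda>x y. x \<subset> y)"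

text \<open>A minimal element of the range of a chain is its stable value; conversely, iterating a
  choice of smaller elements in a set without minimal elements gives a chain that never
  stops.\<close>

lemma wfp_on_iff_chain:
  "wfp_on L (<) \<longleftrightarrow>
     (\<forall>C :: nat \<Rightarrow> 'b::order. (\<forall>i. C i \<in> L \<and> C (Suc i) \<le> C i) \<longrightarrow> (\<exists>n. \<forall>i\<ge>n. C i = C n))"
proof
  assume wf: "wfp_on L (<)"
  show "\<forall>C. (\<forall>i. C i \<in> L \<and> C (Suc i) \<le> C i) \<longrightarrow> (\<exists>n. \<forall>i\<ge>n. C i = C n)"
  proof (intro allI impI)
    fix C :: "nat \<Rightarrow> 'b" assume C: "\<forall>i. C i \<in> L \<and> C (Suc i) \<le> C i"
    then have "range C \<subseteq> L" "range C \<noteq> {}" by auto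
    then obtain z where "z \<in> range C" and z: "\<forall>y. y < z \<longrightarrow> y \<notin> range C"
      using wf unfolding wfp_on_iff_ex_minimal by metis
    then obtain n where n: "\<And>y. y < C n \<Longrightarrow> y \<notin> range C" by blast
    have "C i \<le> C n" if "n \<le> i" for i
      using that
    proof (induction i rule: dec_induct)
      case (step i)
      then show ?case using C order_trans by blast
    qed simp
    then have "C i = C n" if "n \<le> i" for i
      using n[of "C i"] that by (auto simp: order_le_less)
    then show "\<exists>n. \<forall>i\<ge>n. C i = C n" by blast
  qed
next
  assume C: "\<forall>C :: nat \<Rightarrow> 'b. (\<forall>i. C i \<in> L \<and> C (Suc i) \<le> C i) \<longrightarrow> (\<exists>n. \<forall>i\<ge>n. C i = C n)"
  show "wfp_on L (<)"
  proof (rule ccontr)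
    assume "\<not> wfp_on L (<)"
    then obtain X where X: "X \<subseteq> L" "X \<noteq> {}" "\<And>z. z \<in> X \<Longrightarrow> \<exists>y. y < z \<and> y \<in> X"
      unfolding wfp_on_iff_ex_minimal by auto
    obtain x where x: "x \<in> X" using X(2) by blast
    obtain f where f: "\<And>z. z \<in> X \<Longrightarrow> f z < z \<and> f z \<in> X" using X(3) by metis
    define C where "C i = (f ^^ i) x" for i
    have CX: "C i \<in> X" for i using x f by (induction i) (auto simp: C_def)
    have lt: "C (Suc i) < C i" for i using f[OF CX[of i]] by (simp add: C_def)
    then obtain n where "\<forall>i\<ge>n. C i = C n" using C CX X(1) by (meson order_less_imp_le subsetD)
    then show False using lt[of n] by (metis le_Suc_eq less_irrefl order_refl)
  qed
qed

lemma dcc_iff_chain: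
  "dcc L \<longleftrightarrow> (\<forall>C :: nat \<Rightarrow> 'b set. (\<forall>i. C i \<in> L \<and> C (Suc i) \<subseteq> C i) \<longrightarrow> (\<exists>n. \<forall>i\<ge>n. C i = C n))"
  by (rule wfp_on_iff_chain)

text \<open>Complementation reverses inclusion, so this is the descending case for the family of
  complements.\<close>

lemma acc_iff_chain:
  "acc L \<longleftrightarrow> (\<forall>C :: nat \<Rightarrow> 'b set. (\<forall>i. C i \<in> L \<and> C i \<subseteq> C (Suc i)) \<longrightarrow> (\<exists>n. \<forall>i\<ge>n. C i = C n))"
proof -
  have eq: "wfp_on L (\<lambda>x y. y \<subset> x) \<longleftrightarrow> wfp_on (uminus ` L) (<)"
    by (simp add: wfp_on_image compl_less_compl_iff less_le_not_le)
  show ?thesis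
    unfolding eq wfp_on_iff_chain
  proof (intro iffI allI impI)
    fix C :: "nat \<Rightarrow> 'b set"
    assume *: "\<forall>C. (\<forall>i. C i \<in> uminus ` L \<and> C (Suc i) \<subseteq> C i) \<longrightarrow> (\<exists>n. \<forall>i\<ge>n. C i = C n)"
      and "\<forall>i. C i \<in> L \<and> C i \<subseteq> C (Suc i)"
    then have "\<exists>n. \<forall>i\<ge>n. - C i = - C n" by (intro *[rule_format]) auto
    then show "\<exists>n. \<forall>i\<ge>n. C i = C n" by simp
  next
    fix C :: "nat \<Rightarrow> 'b set"
    assume *: "\<forall>C. (\<forall>i. C i \<in> L \<and> C i \<subseteq> C (Suc i)) \<longrightarrow> (\<exists>n. \<forall>i\<ge>n. C i = C n)"
      and "\<forall>i. C i \<in> uminus ` L \<and> C (Suc i) \<subseteq> C i"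
    then have "\<exists>n. \<forall>i\<ge>n. - C i = - C n"
      by (intro *[rule_format]) (metis Compl_anti_mono double_compl imageE)
    then show "\<exists>n. \<forall>i\<ge>n. C i = C n" by simp
  qed
qed

context ring
begin

lemma right_ideal_carrier: "right_ideal R I \<Longrightarrow> x \<in> I \<Longrightarrow> x \<in> carrier R"
  by (auto simp: right_ideal_iff)

lemma right_ideal_zero: "right_ideal R I \<Longrightarrow> \<zero> \<in> I"
  by (auto simp: right_ideal_iff)

lemma right_ideal_add: "right_ideal R I \<Longrightarrow> x \<in> I \<Longrightarrow> y \<in> I \<Longrightarrow> x \<oplus> y \<in> I"
  by (auto simp: right_ideal_iff)

lemma right_ideal_mult: "right_ideal R I \<Longrightarrow> x \<in> I \<Longrightarrow> a \<in> carrier R \<Longrightarrow> x \<otimes> a \<in> I"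
  by (auto simp: right_ideal_iff)

lemma right_ideal_minus:
  assumes I: "right_ideal R I" and "x \<in> I"
  shows "\<ominus> x \<in> I"
  using right_ideal_mult[OF assms, of "\<ominus> \<one>"] right_ideal_carrier[OF assms] by (simp add: r_minus)

lemma right_ideal_diff: "right_ideal R I \<Longrightarrow> x \<in> I \<Longrightarrow> y \<in> I \<Longrightarrow> x \<ominus> y \<in> I"
  by (simp add: minus_eq right_ideal_add right_ideal_minus)

lemma right_ideal_diffD:
  assumes "right_ideal R I" "x \<ominus> y \<in> I" "y \<in> I" "x \<in> carrier R"
  shows "x \<in> I"
  using right_ideal_add[OF assms(1-3)] right_ideal_carrier[OF assms(1,3)] assms(4)
  by (simp add: minus_eq a_assoc l_neg)

lemma right_ideal_add_cancel:
  assumes "right_ideal R I" "x \<oplus> y \<in> I" "x \<in> I" "y \<in> carrier R"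
  shows "y \<in> I"
  using right_ideal_add[OF assms(1) right_ideal_minus[OF assms(1,3)] assms(2)]
    right_ideal_carrier[OF assms(1,3)] assms(4)
  by (simp add: a_assoc[symmetric] l_neg)

lemma set_add_iff: "x \<in> A <+> B \<longleftrightarrow> (\<exists>a\<in>A. \<exists>b\<in>B. x = a \<oplus> b)"
  by (auto simp: set_add_def')

lemma right_ideal_sum:
  assumes A: "right_ideal R A" and B: "right_ideal R B"
  shows "right_ideal R (A <+> B)"
  unfolding right_ideal_iff
proof (intro conjI ballI)
  show "A <+> B \<subseteq> carrier R"
    using right_ideal_carrier[OF A] right_ideal_carrier[OF B] by (auto simp: set_add_iff)
  show "\<zero> \<in> A <+> B"
    using right_ideal_zero[OF A] right_ideal_zero[OF B] by (force simp: set_add_iff)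
next
  fix x y assume "x \<in> A <+> B" "y \<in> A <+> B"
  then obtain a b c d where *: "a \<in> A" "b \<in> B" "x = a \<oplus> b" "c \<in> A" "d \<in> B" "y = c \<oplus> d"
    by (auto simp: set_add_iff)
  then have "x \<oplus> y = (a \<oplus> c) \<oplus> (b \<oplus> d)"
    using right_ideal_carrier[OF A] right_ideal_carrier[OF B] by (simp add: a_ac)
  then show "x \<oplus> y \<in> A <+> B"
    unfolding set_add_iff
    using right_ideal_add[OF A *(1,4)] right_ideal_add[OF B *(2,5)] by (intro bexI)
next
  fix x r assume "x \<in> A <+> B" and r: "r \<in> carrier R"
  then obtain a b where *: "a \<in> A" "b \<in> B" "x = a \<oplus> b" by (auto simp: set_add_iff)
  then have "x \<otimes> r = a \<otimes> r \<oplus> b \<otimes> r"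
    using right_ideal_carrier[OF A] right_ideal_carrier[OF B] r by (simp add: l_distr)
  then show "x \<otimes> r \<in> A <+> B"
    unfolding set_add_iff
    using right_ideal_mult[OF A *(1) r] right_ideal_mult[OF B *(2) r] by (intro bexI)
qed

lemma right_ideal_sum_upper:
  assumes "right_ideal R A" "right_ideal R B"
  shows "A \<subseteq> A <+> B" "B \<subseteq> A <+> B"
proof -
  have "x = x \<oplus> \<zero>" "x = \<zero> \<oplus> x" if "x \<in> A \<or> x \<in> B" for x
    using that right_ideal_carrier[OF assms(1)] right_ideal_carrier[OF assms(2)] by auto
  then show "A \<subseteq> A <+> B" "B \<subseteq> A <+> B"
    using right_ideal_zero[OF assms(1)] right_ideal_zero[OF assms(2)]
    unfolding set_add_iff subset_iff by blast+
qed

lemma right_ideal_sum_least: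
  "right_ideal R C \<Longrightarrow> A \<subseteq> C \<Longrightarrow> B \<subseteq> C \<Longrightarrow> A <+> B \<subseteq> C"
  by (auto simp: set_add_iff intro!: right_ideal_add)

lemma right_ideal_Int: "right_ideal R A \<Longrightarrow> right_ideal R B \<Longrightarrow> right_ideal R (A \<inter> B)"
  by (auto simp: right_ideal_iff)

lemma right_ideal_Inter:
  "(\<And>A. A \<in> F \<Longrightarrow> right_ideal R A) \<Longrightarrow> right_ideal R (carrier R \<inter> \<Inter>F)"
  by (auto simp: right_ideal_iff)

lemma right_ideal_full: "right_ideal R (carrier R)"
  by (auto simp: right_ideal_iff)

lemma right_ideal_trivial: "right_ideal R {\<zero>}"
  by (auto simp: right_ideal_iff)

lemma right_ideal_image:
  assumes B: "right_ideal R B" and x: "x \<in> carrier R"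
  shows "right_ideal R ((\<otimes>) x ` B)"
proof -
  have "\<zero> \<in> (\<otimes>) x ` B" using x right_ideal_zero[OF B] by (metis image_eqI r_null)
  moreover have "x \<otimes> b \<oplus> x \<otimes> c \<in> (\<otimes>) x ` B" if "b \<in> B" "c \<in> B" for b c
    using that x right_ideal_carrier[OF B] right_ideal_add[OF B] by (simp add: r_distr[symmetric])
  moreover have "x \<otimes> b \<otimes> a \<in> (\<otimes>) x ` B" if "b \<in> B" "a \<in> carrier R" for b a
    using that x right_ideal_carrier[OF B] right_ideal_mult[OF B] by (simp add: m_assoc)
  ultimately show ?thesis using x right_ideal_carrier[OF B] by (auto simp: right_ideal_iff)
qed

lemma right_ideal_one: "right_ideal R I \<Longrightarrow> \<one> \<in> I \<Longrightarrow> I = carrier R"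
  using right_ideal_mult[of I \<one>] by (auto simp: right_ideal_iff)

lemma right_ideal_Union_chain:
  assumes F: "F \<noteq> {}" "\<And>A. A \<in> F \<Longrightarrow> right_ideal R A"
    and chain: "\<And>A B. A \<in> F \<Longrightarrow> B \<in> F \<Longrightarrow> A \<subseteq> B \<or> B \<subseteq> A"
  shows "right_ideal R (\<Union>F)"
  unfolding right_ideal_iff
proof (intro conjI ballI)
  fix x y assume "x \<in> \<Union>F" "y \<in> \<Union>F"
  then obtain A B where AB: "A \<in> F" "x \<in> A" "B \<in> F" "y \<in> B" by blast
  then consider "x \<in> B" | "y \<in> A" using chain[of A B] by blast
  then show "x \<oplus> y \<in> \<Union>F"
    using AB right_ideal_add[OF F(2)[OF AB(1)]] right_ideal_add[OF F(2)[OF AB(3)]] by cases blast+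
next
  fix x a assume "x \<in> \<Union>F" "a \<in> carrier R"
  then show "x \<otimes> a \<in> \<Union>F" using F(2) right_ideal_mult by blast
next
  show "\<Union>F \<subseteq> carrier R" using F(2) right_ideal_carrier by blast
  show "\<zero> \<in> \<Union>F" using F right_ideal_zero by blast
qed

section \<open>Residuals \<open>(I : x)\<close> and the right ideals \<open>I + x D\<close>\<close>

definition (in -) residual :: "('a, 'r) ring_scheme \<Rightarrow> 'a set \<Rightarrow> 'a \<Rightarrow> 'a set" where
  "residual R I x = {r \<in> carrier R. x \<otimes>\<^bsub>R\<^esub> r \<in> I}"

lemma right_ideal_residual:
  assumes I: "right_ideal R I" and x: "x \<in> carrier R"
  shows "right_ideal R (residual R I x)"
  unfolding right_ideal_iff residual_def
  using I x by (auto simp: r_distr m_assoc[symmetric] right_ideal_zero right_ideal_add right_ideal_mult)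

definition (in -) adjoin :: "('a, 'r) ring_scheme \<Rightarrow> 'a set \<Rightarrow> 'a \<Rightarrow> 'a set \<Rightarrow> 'a set" where
  "adjoin R I x D = I <+>\<^bsub>R\<^esub> (\<otimes>\<^bsub>R\<^esub>) x ` D"

lemma adjoin_iff: "y \<in> adjoin R I x D \<longleftrightarrow> (\<exists>i\<in>I. \<exists>r\<in>D. y = i \<oplus> x \<otimes> r)"
  by (auto simp: adjoin_def set_add_iff)

lemma right_ideal_adjoin:
  "right_ideal R I \<Longrightarrow> right_ideal R D \<Longrightarrow> x \<in> carrier R \<Longrightarrow> right_ideal R (adjoin R I x D)"
  by (simp add: adjoin_def right_ideal_sum right_ideal_image)

lemma adjoin_upper:
  "right_ideal R I \<Longrightarrow> right_ideal R D \<Longrightarrow> x \<in> carrier R \<Longrightarrow> I \<subseteq> adjoin R I x D"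
  by (simp add: adjoin_def right_ideal_sum_upper right_ideal_image)

lemma adjoin_mem:
  assumes "right_ideal R I" "right_ideal R D" "x \<in> carrier R" "r \<in> D"
  shows "x \<otimes> r \<in> adjoin R I x D"
  using right_ideal_sum_upper(2)[OF assms(1) right_ideal_image[OF assms(2,3)]] assms(4)
  by (auto simp: adjoin_def)

lemma adjoin_self:
  "right_ideal R I \<Longrightarrow> x \<in> carrier R \<Longrightarrow> x \<in> adjoin R I x (carrier R)"
  using adjoin_mem[OF _ right_ideal_full, of I x \<one>] by simp

lemma adjoin_least:
  assumes "right_ideal R K" "I \<subseteq> K" "x \<in> K" "D \<subseteq> carrier R"
  shows "adjoin R I x D \<subseteq> K"
  unfolding adjoin_def
  using assms by (intro right_ideal_sum_least) (auto intro: right_ideal_mult)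

text \<open>Together with \<open>adjoin_residual\<close>: sending \<open>D\<close> to
  \<open>I + x D\<close> and \<open>K\<close> to \<open>(K : x)\<close> are inverse bijections
  between the right ideals above \<open>(I : x)\<close> and those between \<open>I\<close> and
  \<open>I + x R\<close>. This is the lattice side of
  \<open>R/(I : x) \<cong> (I + x R)/I\<close>.\<close>

lemma residual_adjoin:
  assumes I: "right_ideal R I" and D: "right_ideal R D" and x: "x \<in> carrier R"
    and sub: "residual R I x \<subseteq> D"
  shows "residual R (adjoin R I x D) x = D"
proof
  show "D \<subseteq> residual R (adjoin R I x D) x"
    using adjoin_mem[OF I D x] right_ideal_carrier[OF D] by (auto simp: residual_def)
  show "residual R (adjoin R I x D) x \<subseteq> D"
  proof
    fix r assume "r \<in> residual R (adjoin R I x D) x"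
    then obtain i d where r: "r \<in> carrier R" and *: "i \<in> I" "d \<in> D" "x \<otimes> r = i \<oplus> x \<otimes> d"
      by (auto simp: residual_def adjoin_iff)
    have d: "d \<in> carrier R" "i \<in> carrier R"
      using * right_ideal_carrier[OF D] right_ideal_carrier[OF I] by auto
    have "x \<otimes> (r \<ominus> d) = i"
      using * x r d by (simp add: minus_eq r_distr r_minus a_assoc r_neg)
    then have "r \<ominus> d \<in> D" using sub * r d by (auto simp: residual_def)
    then show "r \<in> D" using right_ideal_diffD[OF D] * r by blast
  qed
qed

lemma adjoin_residual:
  assumes I: "right_ideal R I" and K: "right_ideal R K" and x: "x \<in> carrier R"
    and sub: "I \<subseteq> K" "K \<subseteq> adjoin R I x (carrier R)"
  shows "adjoin R I x (residual R K x) = K"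
proof
  show "adjoin R I x (residual R K x) \<subseteq> K"
    unfolding adjoin_def using sub(1)
    by (intro right_ideal_sum_least K) (auto simp: residual_def)
  show "K \<subseteq> adjoin R I x (residual R K x)"
  proof
    fix k assume k: "k \<in> K"
    then obtain i r where *: "i \<in> I" "r \<in> carrier R" "k = i \<oplus> x \<otimes> r"
      using sub(2) unfolding subset_iff adjoin_iff by blast
    have "x \<otimes> r \<in> K"
      using right_ideal_add_cancel[OF K, of i "x \<otimes> r"] k * sub(1) x by auto
    then show "k \<in> adjoin R I x (residual R K x)"
      using * unfolding adjoin_iff residual_def by blast
  qed
qed

lemma modular:
  assumes "right_ideal R A" "right_ideal R B" "right_ideal R C" "A \<subseteq> C"
  shows "(A <+> B) \<inter> C = A <+> (B \<inter> C)"
proof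
  show "(A <+> B) \<inter> C \<subseteq> A <+> (B \<inter> C)"
  proof
    fix x assume x: "x \<in> (A <+> B) \<inter> C"
    then obtain a b where "a \<in> A" "b \<in> B" "x = a \<oplus> b" by (auto simp: set_add_iff)
    then show "x \<in> A <+> (B \<inter> C)"
      using right_ideal_add_cancel[OF assms(3), of a b] x assms(4) right_ideal_carrier[OF assms(2)]
      by (auto simp: set_add_iff)
  qed
  have "A <+> (B \<inter> C) \<subseteq> A <+> B" unfolding set_add_iff subset_iff by blast
  moreover have "A <+> (B \<inter> C) \<subseteq> C" using assms(3,4) by (intro right_ideal_sum_least) auto
  ultimately show "A <+> (B \<inter> C) \<subseteq> (A <+> B) \<inter> C" by blast
qed

text \<open>Comparable elements of a modular lattice with the same join and meet with
  \<open>B\<close> are equal; this is why a family between \<open>A\<close> and \<open>C\<close> is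
  controlled by its traces above and below \<open>B\<close>.\<close>

lemma modular_eq:
  assumes X: "right_ideal R X" and Y: "right_ideal R Y" and B: "right_ideal R B"
    and "X \<subseteq> Y" and sum: "Y <+> B \<subseteq> X <+> B" and int: "Y \<inter> B \<subseteq> X \<inter> B"
  shows "X = Y"
proof -
  have "Y \<subseteq> (X <+> B) \<inter> Y" using right_ideal_sum_upper(1)[OF Y B] sum by blast
  also have "\<dots> = X <+> (B \<inter> Y)" by (rule modular[OF X B Y \<open>X \<subseteq> Y\<close>])
  also have "\<dots> \<subseteq> X" using int by (intro right_ideal_sum_least[OF X]) auto
  finally show ?thesis using \<open>X \<subseteq> Y\<close> by blast
qed

lemma set_add_mono: "A \<subseteq> A' \<Longrightarrow> B \<subseteq> B' \<Longrightarrow> A <+> B \<subseteq> A' <+> B'"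
  unfolding set_add_iff subset_iff by blast

end
section \<open>Chain conditions on intervals of right ideals\<close>

text \<open>With \<open>r\<close> one of the two strict inclusions, each closure property below is
  proved once for ACC and DCC.\<close>

definition inclusion_order :: "('b set \<Rightarrow> 'b set \<Rightarrow> bool) \<Rightarrow> bool" where
  "inclusion_order r \<longleftrightarrow> r = (\<lambda>x y. x \<subset> y) \<or> r = (\<lambda>x y. y \<subset> x)"

lemma inclusion_order_simps [simp]:
  "inclusion_order (\<lambda>x y. x \<subset> y)" "inclusion_order (\<lambda>x y. y \<subset> x)"
  by (simp_all add: inclusion_order_def)

lemma inclusion_order_mono:
  assumes "inclusion_order r" "r x y" "\<And>x y. x \<subset> y \<Longrightarrow> f x \<subseteq> f y"
  shows "r (f x) (f y) \<or> f x = f y"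
  using assms unfolding inclusion_order_def by blast

lemma inclusion_order_finite: "inclusion_order r \<Longrightarrow> finite L \<Longrightarrow> wfp_on L r"
  by (rule strict_partial_order_wfp_on_finite_set)
     (auto simp: inclusion_order_def transp_on_def asymp_on_def)

lemma wfp_on_strict_mono:
  assumes r: "inclusion_order r" and wf: "wfp_on L' r"
    and map: "\<And>x. x \<in> L \<Longrightarrow> f x \<in> L'"
    and mono: "\<And>x y. x \<in> L \<Longrightarrow> y \<in> L \<Longrightarrow> x \<subset> y \<Longrightarrow> f x \<subset> f y"
  shows "wfp_on L r"
proof (rule wfp_on_mono_stronger[OF wf, of f])
  show "f ` L \<subseteq> L'" using map by blast
  show "r (f x) (f y)" if "x \<in> L" "y \<in> L" "r x y" for x y
    using that mono[of x y] mono[of y x] r unfolding inclusion_order_def by auto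
qed

lemma wfp_on_minimal:
  assumes "wfp_on L r" "X \<subseteq> L" "X \<noteq> {}"
  obtains m where "m \<in> X" "\<And>x. x \<in> X \<Longrightarrow> \<not> r x m"
  using assms unfolding wfp_on_iff_ex_minimal by metis

context ring
begin

lemma interval_iff: "C \<in> ideal_interval R A B \<longleftrightarrow> right_ideal R C \<and> A \<subseteq> C \<and> C \<subseteq> B"
  by (simp add: ideal_interval_def)

lemma interval_mono: "A \<subseteq> A' \<Longrightarrow> B' \<subseteq> B \<Longrightarrow> ideal_interval R A' B' \<subseteq> ideal_interval R A B"
  by (auto simp: ideal_interval_def)

lemma interval_self: "ideal_interval R A A \<subseteq> {A}"
  by (auto simp: ideal_interval_def)

lemma right_ideal_ge_zero: "right_ideal R A \<Longrightarrow> {\<zero>} \<subseteq> A"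
  by (simp add: right_ideal_zero)

lemma right_ideal_le_carrier: "right_ideal R A \<Longrightarrow> A \<subseteq> carrier R"
  using right_ideal_carrier by blast

lemma right_ideal_in_interval: "right_ideal R A \<Longrightarrow> A \<in> ideal_interval R {\<zero>} (carrier R)"
  by (simp add: interval_iff right_ideal_zero right_ideal_le_carrier)

text \<open>An extremal member of \<open>X\<close> is found in two stages: extremal for
  \<open>x + B\<close> first, then for \<open>x \<inter> B\<close> among those. By
  \<open>modular_eq\<close> no member of \<open>X\<close> lies beyond it. So a chain condition
  passes from \<open>B/A\<close> and \<open>C/B\<close> to the extension \<open>C/A\<close>.\<close>

lemma wfp_on_interval_extend:
  assumes r: "inclusion_order r" and B: "right_ideal R B" and le: "A \<subseteq> B" "B \<subseteq> C"
    and C: "right_ideal R C"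
    and AB: "wfp_on (ideal_interval R A B) r" and BC: "wfp_on (ideal_interval R B C) r"
  shows "wfp_on (ideal_interval R A C) r"
  unfolding wfp_on_iff_ex_minimal
proof (intro allI impI)
  fix X assume X: "X \<subseteq> ideal_interval R A C" "X \<noteq> {}"
  have Xr: "right_ideal R x" "A \<subseteq> x" "x \<subseteq> C" if "x \<in> X" for x
    using subsetD[OF X(1) that] by (simp_all add: interval_iff)
  have "(\<lambda>x. x <+> B) ` X \<subseteq> ideal_interval R B C"
  proof
    fix y assume "y \<in> (\<lambda>x. x <+> B) ` X"
    then obtain x where "x \<in> X" and y: "y = x <+> B" by blast
    note x = Xr[OF this(1)]
    show "y \<in> ideal_interval R B C"
      using right_ideal_sum[OF x(1) B] right_ideal_sum_upper(2)[OF x(1) B]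
        right_ideal_sum_least[OF C x(3) le(2)]
      by (simp add: interval_iff y)
  qed
  then obtain z where z: "z \<in> (\<lambda>x. x <+> B) ` X" "\<And>w. w \<in> (\<lambda>x. x <+> B) ` X \<Longrightarrow> \<not> r w z"
    using wfp_on_minimal[OF BC] X(2) by (metis image_is_empty)
  define Y where "Y = {x \<in> X. x <+> B = z}"
  have Y: "Y \<subseteq> X" "Y \<noteq> {}" using z(1) by (auto simp: Y_def)
  have "(\<lambda>x. x \<inter> B) ` Y \<subseteq> ideal_interval R A B"
    using Xr B le(1) Y by (auto simp: interval_iff right_ideal_Int)
  then obtain w where w: "w \<in> (\<lambda>x. x \<inter> B) ` Y" "\<And>v. v \<in> (\<lambda>x. x \<inter> B) ` Y \<Longrightarrow> \<not> r v w"
    using wfp_on_minimal[OF AB] Y(2) by (metis image_is_empty)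
  obtain x where x: "x \<in> Y" "w = x \<inter> B" using w(1) by blast
  have "y \<notin> X" if yx: "r y x" for y
  proof
    assume y: "y \<in> X"
    have xX: "x \<in> X" and xz: "x <+> B = z" using x by (auto simp: Y_def)
    have "r (y <+> B) (x <+> B) \<or> y <+> B = x <+> B"
      using r yx by (rule inclusion_order_mono) (simp add: set_add_mono)
    then have yB: "y <+> B = x <+> B" using z(2) y xz by blast
    then have yY: "y \<in> Y" using y xz by (simp add: Y_def)
    have "r (y \<inter> B) (x \<inter> B) \<or> y \<inter> B = x \<inter> B"
      using r yx by (rule inclusion_order_mono) blast
    then have yB': "y \<inter> B = x \<inter> B" using w(2) yY x(2) by blast
    have "x \<subset> y \<or> y \<subset> x" using r yx by (auto simp: inclusion_order_def)
    then show False
      using modular_eq[OF Xr(1)[OF y] Xr(1)[OF xX] B] modular_eq[OF Xr(1)[OF xX] Xr(1)[OF y] B]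
        yB yB' by (auto simp: psubset_eq)
  qed
  then show "\<exists>z\<in>X. \<forall>y. r y z \<longrightarrow> y \<notin> X" using x Y(1) by blast
qed

text \<open>\<open>K/(K \<inter> K') \<cong> (K + K')/K'\<close> is a submodule of
  \<open>C/K'\<close>; extending it by \<open>C/K\<close> gives
  \<open>C/(K \<inter> K')\<close>.\<close>

lemma wfp_on_interval_Int:
  assumes r: "inclusion_order r" and K: "right_ideal R K" "right_ideal R K'" "K \<subseteq> C" "K' \<subseteq> C"
    and C: "right_ideal R C"
    and wf: "wfp_on (ideal_interval R K C) r" and wf': "wfp_on (ideal_interval R K' C) r"
  shows "wfp_on (ideal_interval R (K \<inter> K') C) r"
proof (rule wfp_on_interval_extend[OF r K(1) _ K(3) C _ wf])
  show "wfp_on (ideal_interval R (K \<inter> K') K) r"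
  proof (rule wfp_on_strict_mono[OF r wf', of _ "\<lambda>D. D <+> K'"])
    fix D assume "D \<in> ideal_interval R (K \<inter> K') K"
    then have D: "right_ideal R D" "D \<subseteq> C" using K by (auto simp: interval_iff)
    then show "D <+> K' \<in> ideal_interval R K' C"
      using K C right_ideal_sum_upper(2)[OF D(1) K(2)]
      by (simp add: interval_iff right_ideal_sum right_ideal_sum_least)
  next
    fix D E assume "D \<in> ideal_interval R (K \<inter> K') K" "E \<in> ideal_interval R (K \<inter> K') K" "D \<subset> E"
    then have *: "right_ideal R D" "right_ideal R E" "K \<inter> K' \<subseteq> D" "E \<subseteq> K" "D \<subset> E"
      by (auto simp: interval_iff)
    then have "D <+> K' \<noteq> E <+> K'"
      using modular_eq[OF *(1,2) K(2)] by blast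
    then show "D <+> K' \<subset> E <+> K'"
      using set_add_mono[of D E K' K'] *(5) by blast
  qed
qed auto

lemma wfp_on_interval_Inter:
  assumes r: "inclusion_order r" and C: "right_ideal R C"
    and G: "finite G" "\<And>K. K \<in> G \<Longrightarrow> right_ideal R K \<and> K \<subseteq> C \<and> wfp_on (ideal_interval R K C) r"
  shows "right_ideal R (C \<inter> \<Inter>G) \<and> wfp_on (ideal_interval R (C \<inter> \<Inter>G) C) r"
  using G
proof (induction G)
  case empty
  show ?case using C r interval_self[of C]
    by (simp add: inclusion_order_finite finite_subset)
next
  case (insert K G)
  then have *: "right_ideal R (C \<inter> \<Inter>G)" "wfp_on (ideal_interval R (C \<inter> \<Inter>G) C) r"
    and K: "right_ideal R K" "K \<subseteq> C" "wfp_on (ideal_interval R K C) r" by auto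
  have eq: "C \<inter> \<Inter>(insert K G) = K \<inter> (C \<inter> \<Inter>G)" by blast
  show ?case unfolding eq
    using wfp_on_interval_Int[OF r K(1) *(1) K(2) _ C K(3) *(2)] right_ideal_Int[OF K(1) *(1)]
    by blast
qed

lemma wfp_on_interval_adjoin:
  assumes r: "inclusion_order r" and I: "right_ideal R I" and x: "x \<in> carrier R"
    and wf: "wfp_on (ideal_interval R (residual R I x) (carrier R)) r"
  shows "wfp_on (ideal_interval R I (adjoin R I x (carrier R))) r"
proof (rule wfp_on_strict_mono[OF r wf, of _ "\<lambda>K. residual R K x"])
  fix K assume "K \<in> ideal_interval R I (adjoin R I x (carrier R))"
  then show "residual R K x \<in> ideal_interval R (residual R I x) (carrier R)"
    using x right_ideal_residual[of K x] by (auto simp: interval_iff residual_def)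
next
  fix K L assume K: "K \<in> ideal_interval R I (adjoin R I x (carrier R))"
    and L: "L \<in> ideal_interval R I (adjoin R I x (carrier R))" and "K \<subset> L"
  then have "residual R K x \<subseteq> residual R L x" by (auto simp: residual_def)
  moreover have "residual R K x \<noteq> residual R L x"
  proof
    assume "residual R K x = residual R L x"
    moreover have "adjoin R I x (residual R K x) = K" "adjoin R I x (residual R L x) = L"
      using K L by (intro adjoin_residual[OF I _ x]; simp add: interval_iff)+
    ultimately have "K = L" by metis
    then show False using \<open>K \<subset> L\<close> by blast
  qed
  ultimately show "residual R K x \<subset> residual R L x" by blast
qed

text \<open>As \<open>(I : x) \<subseteq> D\<close>, the factor
  \<open>R/D \<cong> (I + x R)/(I + x D)\<close> is a submodule of \<open>R/(I + x D)\<close> and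
  inherits its chain condition.\<close>

lemma wfp_on_interval_residual:
  assumes r: "inclusion_order r" and I: "right_ideal R I" and x: "x \<in> carrier R"
    and D: "right_ideal R D" "residual R I x \<subseteq> D"
    and wf: "wfp_on (ideal_interval R (adjoin R I x D) (carrier R)) r"
  shows "wfp_on (ideal_interval R D (carrier R)) r"
proof (rule wfp_on_strict_mono[OF r wf, of _ "adjoin R I x"])
  have mono: "adjoin R I x E \<subseteq> adjoin R I x F" if "E \<subseteq> F" for E F
    using that unfolding adjoin_def by (intro set_add_mono) auto
  fix E assume E: "E \<in> ideal_interval R D (carrier R)"
  then have "right_ideal R E" by (simp add: interval_iff)
  from right_ideal_adjoin[OF I this x]
  show "adjoin R I x E \<in> ideal_interval R (adjoin R I x D) (carrier R)"
    using E mono[of D E] right_ideal_le_carrier by (simp add: interval_iff)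
  fix F assume F: "F \<in> ideal_interval R D (carrier R)" and "E \<subset> F"
  have "adjoin R I x E \<noteq> adjoin R I x F"
  proof
    assume "adjoin R I x E = adjoin R I x F"
    moreover have "residual R (adjoin R I x E) x = E" "residual R (adjoin R I x F) x = F"
      using E F D(2) by (intro residual_adjoin[OF I _ x]; force simp: interval_iff)+
    ultimately have "E = F" by metis
    then show False using \<open>E \<subset> F\<close> by blast
  qed
  then show "adjoin R I x E \<subset> adjoin R I x F" using mono[of E F] \<open>E \<subset> F\<close> by blast
qed

end

section \<open>Cohen's theorem for point annihilator sets\<close>

text \<open>That \<open>X\<close> generates \<open>P\<close> is expressed by the universal property
  of the span: to show \<open>P \<subseteq> N\<close> it is enough to check the generators.\<close>

definition fg_ideal :: "('a, 'r) ring_scheme \<Rightarrow> 'a set \<Rightarrow> bool" where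
  "fg_ideal R P \<longleftrightarrow> right_ideal R P \<and>
     (\<exists>X. finite X \<and> X \<subseteq> P \<and> (\<forall>N. right_ideal R N \<and> X \<subseteq> N \<longrightarrow> P \<subseteq> N))"

lemma fg_idealE:
  assumes "fg_ideal R P"
  obtains X where "finite X" "X \<subseteq> P"
    "\<forall>N. right_ideal R N \<longrightarrow> X \<subseteq> N \<longrightarrow> P \<subseteq> N"
  using assms unfolding fg_ideal_def by auto

lemma fg_ideal_right_ideal: "fg_ideal R P \<Longrightarrow> right_ideal R P"
  by (simp add: fg_ideal_def)

text \<open>The defining property of a right noetherian point annihilator set, tested on cyclic
  modules: the annihilator of \<open>x + I\<close> in \<open>R/I\<close> is the residual \<open>{r. x r \<in> I}\<close>.\<close>

definition residual_test_set :: "('a, 'r) ring_scheme \<Rightarrow> 'a set set \<Rightarrow> bool" where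
  "residual_test_set R S \<longleftrightarrow>
     (\<forall>I. right_ideal R I \<and> I \<noteq> carrier R \<and> acc (ideal_interval R I (carrier R)) \<longrightarrow>
       (\<exists>x\<in>carrier R. x \<notin> I \<and> residual R I x \<in> S))"

context ring
begin

text \<open>Finitely many generators of the union lie in a single member of the chain, which is then
  the whole union.\<close>

lemma fg_chain_Union:
  assumes F: "F \<noteq> {}" "\<And>A. A \<in> F \<Longrightarrow> right_ideal R A"
    and chain: "\<And>A B. A \<in> F \<Longrightarrow> B \<in> F \<Longrightarrow> A \<subseteq> B \<or> B \<subseteq> A"
    and fg: "fg_ideal R (\<Union>F)"
  shows "\<Union>F \<in> F"
proof -
  obtain X where X': "finite X" "X \<subseteq> \<Union>F" "\<forall>N. right_ideal R N \<longrightarrow> X \<subseteq> N \<longrightarrow> \<Union>F \<subseteq> N"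
    using fg by (rule fg_idealE)
  note X = X'(1,2) X'(3)[rule_format]
  obtain A where "A \<in> F" "X \<subseteq> A"
    using finite_subset_Union_chain[OF X(1,2) F(1)] chain unfolding subset_chain_def by blast
  then have "\<Union>F = A" using X(3) F(2) by blast
  then show ?thesis using \<open>A \<in> F\<close> by simp
qed

text \<open>Finite generation is assumed strictly above \<open>I\<close>, because in
  \<open>cohen\<close> the right ideal \<open>I\<close> is a maximal counterexample. A chain with
  union \<open>I\<close> is constant; any other chain has a finitely generated union.\<close>

lemma acc_if_fg:
  assumes fg: "\<And>N. right_ideal R N \<Longrightarrow> I \<subset> N \<Longrightarrow> fg_ideal R N"
  shows "acc (ideal_interval R I B)"
  unfolding acc_iff_chain
proof (intro allI impI)
  fix C :: "nat \<Rightarrow> 'a set"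
  assume C: "\<forall>i. C i \<in> ideal_interval R I B \<and> C i \<subseteq> C (Suc i)"
  have mono: "C i \<subseteq> C j" if "i \<le> j" for i j
    using that
  proof (induction j rule: dec_induct)
    case (step j)
    then show ?case using C order_trans by blast
  qed simp
  have sub: "\<And>i. right_ideal R (C i)" "\<And>i. I \<subseteq> C i" using C by (auto simp: interval_iff)
  have chain: "A \<subseteq> A' \<or> A' \<subseteq> A" if "A \<in> range C" "A' \<in> range C" for A A'
    using that mono nat_le_linear by blast
  have "\<Union>(range C) \<in> range C"
  proof (cases "I = \<Union>(range C)")
    case True
    then have "C 0 = \<Union>(range C)" using sub(2)[of 0] by blast
    then show ?thesis by (metis rangeI)
  next
    case False
    have U: "right_ideal R (\<Union>(range C))"
      by (rule right_ideal_Union_chain) (use sub chain in auto)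
    have "fg_ideal R (\<Union>(range C))"
      using fg[OF U] False sub(2) by blast
    then show ?thesis using sub(1) chain by (intro fg_chain_Union) auto
  qed
  then obtain n where n: "\<Union>(range C) = C n" by blast
  then have "C i = C n" if "n \<le> i" for i using mono[OF that] by blast
  then show "\<exists>n. \<forall>i\<ge>n. C i = C n" by blast
qed

text \<open>A maximal finitely generated right ideal inside \<open>I\<close> absorbs every element
  of \<open>I\<close>.\<close>

lemma fg_if_acc:
  assumes acc: "acc (ideal_interval R {\<zero>} (carrier R))" and I: "right_ideal R I"
  shows "fg_ideal R I"
proof -
  define \<F> where "\<F> = {K. fg_ideal R K \<and> K \<subseteq> I}"
  have "fg_ideal R {\<zero>}"
    unfolding fg_ideal_def using right_ideal_trivial by (intro conjI exI[of _ "{}"])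
      (auto simp: right_ideal_zero)
  then have "\<F> \<noteq> {}" using right_ideal_zero[OF I] by (auto simp: \<F>_def)
  moreover have "\<F> \<subseteq> ideal_interval R {\<zero>} (carrier R)"
    by (auto simp: \<F>_def fg_ideal_def intro: right_ideal_in_interval)
  ultimately obtain K where K: "K \<in> \<F>" "\<And>L. L \<in> \<F> \<Longrightarrow> \<not> K \<subset> L"
    using wfp_on_minimal[OF acc, of \<F>] by blast
  then have "fg_ideal R K" and KI: "right_ideal R K" "K \<subseteq> I"
    by (simp_all add: \<F>_def fg_ideal_right_ideal)
  from this(1) obtain X where X': "finite X" "X \<subseteq> K"
    "\<forall>N. right_ideal R N \<longrightarrow> X \<subseteq> N \<longrightarrow> K \<subseteq> N"
    by (rule fg_idealE)
  note X = X'(1,2) X'(3)[rule_format]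
  have "x \<in> K" if x: "x \<in> I" for x
  proof -
    have xR: "x \<in> carrier R" using x right_ideal_carrier[OF I] by simp
    let ?K = "adjoin R K x (carrier R)"
    have ri: "right_ideal R ?K" by (rule right_ideal_adjoin[OF KI(1) right_ideal_full xR])
    have up: "K \<subseteq> ?K" by (rule adjoin_upper[OF KI(1) right_ideal_full xR])
    have xK: "x \<in> ?K" by (rule adjoin_self[OF KI(1) xR])
    have "fg_ideal R ?K"
      unfolding fg_ideal_def
    proof (intro conjI exI[of _ "insert x X"] allI impI)
      fix N assume "right_ideal R N \<and> insert x X \<subseteq> N"
      then show "?K \<subseteq> N" using X(3)[of N] by (intro adjoin_least) auto
    qed (use ri X up xK in auto)
    moreover have "?K \<subseteq> I" using I KI(2) x by (intro adjoin_least) auto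
    ultimately have "\<not> K \<subset> ?K" using K(2) by (simp add: \<F>_def)
    then show ?thesis using up xK by blast
  qed
  then have "K = I" using KI by blast
  then show ?thesis using K(1) by (simp add: \<F>_def)
qed

text \<open>Choose a finite \<open>Y \<subseteq> I\<close> such that \<open>Y\<close> and \<open>x\<close> generate \<open>I + x R\<close>; then \<open>I\<close> is generated
  by \<open>Y\<close> and \<open>x (I : x)\<close>.\<close>

lemma fg_if_residual_fg:
  assumes I: "right_ideal R I" and x: "x \<in> carrier R"
    and fg1: "fg_ideal R (adjoin R I x (carrier R))" and fg2: "fg_ideal R (residual R I x)"
  shows "fg_ideal R I"
proof -
  let ?J = "adjoin R I x (carrier R)" and ?P = "residual R I x"
  obtain X where X': "finite X" "X \<subseteq> ?J" "\<forall>N. right_ideal R N \<longrightarrow> X \<subseteq> N \<longrightarrow> ?J \<subseteq> N"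
    using fg1 by (rule fg_idealE)
  note X = X'(1,2) X'(3)[rule_format]
  obtain Z where Z': "finite Z" "Z \<subseteq> ?P" "\<forall>N. right_ideal R N \<longrightarrow> Z \<subseteq> N \<longrightarrow> ?P \<subseteq> N"
    using fg2 by (rule fg_idealE)
  note Z = Z'(1,2) Z'(3)[rule_format]
  have "\<forall>z\<in>X. \<exists>i. i \<in> I \<and> (\<exists>r\<in>carrier R. z = i \<oplus> x \<otimes> r)"
    using X(2) unfolding subset_iff adjoin_iff by blast
  then obtain f where f: "\<And>z. z \<in> X \<Longrightarrow> f z \<in> I \<and> (\<exists>r\<in>carrier R. z = f z \<oplus> x \<otimes> r)"
    by metis
  define W where "W = f ` X \<union> (\<otimes>) x ` Z"
  have "I \<subseteq> N" if N: "right_ideal R N" "W \<subseteq> N" for N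
  proof
    fix i assume i: "i \<in> I"
    \<comment> \<open>The \<open>I\<close>-components of the generators lie in \<open>N\<close>, so
      \<open>I + x R\<close> is contained in \<open>(N \<inter> I) + x R\<close>. Writing
      \<open>i = n + x r\<close> with \<open>n \<in> N \<inter> I\<close> makes \<open>x r\<close>
      an element of \<open>I\<close>, that is \<open>r \<in> (I : x)\<close>.\<close>
    have "X \<subseteq> adjoin R (N \<inter> I) x (carrier R)"
      using f N(2) unfolding W_def subset_iff adjoin_iff by blast
    then have "i \<in> adjoin R (N \<inter> I) x (carrier R)"
      using X(3)[OF right_ideal_adjoin[OF right_ideal_Int[OF N(1) I] right_ideal_full x]]
        adjoin_upper[OF I right_ideal_full x] i by blast
    then obtain n r where nr: "n \<in> N" "n \<in> I" "r \<in> carrier R" "i = n \<oplus> x \<otimes> r"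
      by (auto simp: adjoin_iff)
    then have "r \<in> ?P"
      using right_ideal_add_cancel[OF I, of n "x \<otimes> r"] i x by (simp add: residual_def)
    moreover have "?P \<subseteq> residual R N x"
    proof (rule Z(3)[OF right_ideal_residual[OF N(1) x]])
      show "Z \<subseteq> residual R N x" using N(2) Z(2) by (auto simp: W_def residual_def)
    qed
    ultimately show "i \<in> N" using nr right_ideal_add[OF N(1)] by (auto simp: residual_def)
  qed
  moreover have "finite W" using X Z by (simp add: W_def)
  moreover have "W \<subseteq> I" using f Z(2) by (auto simp: W_def residual_def)
  ultimately show ?thesis unfolding fg_ideal_def using I by blast
qed

theorem cohen:
  assumes S: "residual_test_set R S" and fg: "\<And>P. P \<in> S \<Longrightarrow> fg_ideal R P"
  shows "acc (ideal_interval R {\<zero>} (carrier R))"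
proof -
  have "fg_ideal R I" if "right_ideal R I" for I
  proof (rule ccontr)
    assume nfg: "\<not> fg_ideal R I"
    define \<N> where "\<N> = {K. right_ideal R K \<and> \<not> fg_ideal R K}"
    have "\<exists>M\<in>\<N>. \<forall>X\<in>\<N>. M \<subseteq> X \<longrightarrow> X = M"
    proof (rule subset_Zorn_nonempty)
      show "\<N> \<noteq> {}" using nfg that by (auto simp: \<N>_def)
      fix \<C> assume C: "\<C> \<noteq> {}" "subset.chain \<N> \<C>"
      then have ri: "\<And>A. A \<in> \<C> \<Longrightarrow> right_ideal R A"
        and lin: "\<And>A B. A \<in> \<C> \<Longrightarrow> B \<in> \<C> \<Longrightarrow> A \<subseteq> B \<or> B \<subseteq> A"
        and nfg: "\<And>A. A \<in> \<C> \<Longrightarrow> \<not> fg_ideal R A"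
        unfolding subset_chain_def \<N>_def by blast+
      have "\<not> fg_ideal R (\<Union>\<C>)"
        using fg_chain_Union[OF C(1) ri lin] nfg by blast
      then show "\<Union>\<C> \<in> \<N>"
        using right_ideal_Union_chain[OF C(1) ri lin] by (simp add: \<N>_def)
    qed
    then obtain M where M: "right_ideal R M" "\<not> fg_ideal R M"
      and max: "\<And>N. right_ideal R N \<Longrightarrow> M \<subset> N \<Longrightarrow> fg_ideal R N"
      unfolding \<N>_def by blast
    have "fg_ideal R (carrier R)"
      unfolding fg_ideal_def
      using right_ideal_one by (intro conjI right_ideal_full exI[of _ "{\<one>}"]) auto
    then have "M \<noteq> carrier R" using M by blast
    moreover have "acc (ideal_interval R M (carrier R))" using max by (rule acc_if_fg)
    ultimately obtain x where x: "x \<in> carrier R" "x \<notin> M" "residual R M x \<in> S"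
      using S M(1) unfolding residual_test_set_def by blast
    have "M \<subset> adjoin R M x (carrier R)"
      using adjoin_upper[OF M(1) right_ideal_full x(1)] adjoin_self[OF M(1) x(1)] x(2) by blast
    then have "fg_ideal R (adjoin R M x (carrier R))"
      using max right_ideal_adjoin[OF M(1) right_ideal_full x(1)] by blast
    then show False
      using fg_if_residual_fg[OF M(1) x(1)] fg[OF x(3)] M(2) by blast
  qed
  then show ?thesis by (intro acc_if_fg)
qed

end

section \<open>Finitely cogenerated factors\<close>

definition cogen_ideal :: "('a, 'r) ring_scheme \<Rightarrow> 'a set \<Rightarrow> bool" where
  "cogen_ideal R P \<longleftrightarrow> right_ideal R P \<and>
     (\<forall>F. F \<subseteq> ideal_interval R P (carrier R) \<and> carrier R \<inter> \<Inter>F = P \<longrightarrow>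
       (\<exists>G. G \<subseteq> F \<and> finite G \<and> carrier R \<inter> \<Inter>G = P))"

context ring
begin

text \<open>A minimal one among the finite intersections of members of the family lies in every
  member, hence equals \<open>P\<close>.\<close>

lemma cogen_if_dcc:
  assumes P: "right_ideal R P" and dcc: "dcc (ideal_interval R P (carrier R))"
  shows "cogen_ideal R P"
  unfolding cogen_ideal_def
proof (intro conjI P allI impI)
  fix F assume F: "F \<subseteq> ideal_interval R P (carrier R) \<and> carrier R \<inter> \<Inter>F = P"
  define X where "X = {carrier R \<inter> \<Inter>G |G. G \<subseteq> F \<and> finite G}"
  have "K \<in> ideal_interval R P (carrier R)" if "K \<in> X" for K
  proof -
    obtain G where G: "K = carrier R \<inter> \<Inter>G" "G \<subseteq> F" using \<open>K \<in> X\<close> by (auto simp: X_def)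
    then have "right_ideal R K" using F by (auto intro!: right_ideal_Inter simp: interval_iff)
    then show ?thesis using G F right_ideal_le_carrier[OF P] by (auto simp: interval_iff)
  qed
  moreover have "X \<noteq> {}" by (auto simp: X_def)
  ultimately obtain K where K: "K \<in> X" "\<And>L. L \<in> X \<Longrightarrow> \<not> L \<subset> K"
    using wfp_on_minimal[OF dcc, of X] by blast
  then obtain G where G: "K = carrier R \<inter> \<Inter>G" "G \<subseteq> F" "finite G" by (auto simp: X_def)
  have "K \<subseteq> A" if "A \<in> F" for A
  proof -
    have "carrier R \<inter> \<Inter>(insert A G) \<in> X" unfolding X_def using that G by blast
    then show ?thesis using K(2) G(1) by blast
  qed
  then have "K = P" using F G by auto
  then show "\<exists>G. G \<subseteq> F \<and> finite G \<and> carrier R \<inter> \<Inter>G = P" using G by blast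
qed

text \<open>Let \<open>A\<close> be the intersection of all right ideals strictly above
  \<open>P\<close>. If \<open>A = P\<close>, then finitely many of them already intersect in
  \<open>P\<close>, and \<open>R/P\<close> embeds in a finite product of artinian factors. Otherwise
  \<open>A\<close> is the least right ideal strictly above \<open>P\<close>, so \<open>A/P\<close>
  is simple, while \<open>R/A\<close> is artinian by hypothesis.\<close>

lemma dcc_if_cogen:
  assumes cogen: "cogen_ideal R P"
    and above: "\<And>D. right_ideal R D \<Longrightarrow> P \<subset> D \<Longrightarrow> dcc (ideal_interval R D (carrier R))"
  shows "dcc (ideal_interval R P (carrier R))"
proof -
  have P: "right_ideal R P" using cogen by (simp add: cogen_ideal_def)
  define F where "F = {D. right_ideal R D \<and> P \<subset> D}"
  let ?A = "carrier R \<inter> \<Inter>F"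
  have A: "right_ideal R ?A" by (rule right_ideal_Inter) (auto simp: F_def)
  have PA: "P \<subseteq> ?A" using right_ideal_le_carrier[OF P] by (auto simp: F_def)
  show ?thesis
  proof (cases "?A = P")
    case True
    then obtain G where G: "G \<subseteq> F" "finite G" "carrier R \<inter> \<Inter>G = P"
      using cogen right_ideal_le_carrier unfolding cogen_ideal_def F_def ideal_interval_def
      by (smt (verit) mem_Collect_eq psubset_eq subset_eq)
    have "dcc (ideal_interval R (carrier R \<inter> \<Inter>G) (carrier R))"
    proof (rule wfp_on_interval_Inter[THEN conjunct2, OF _ right_ideal_full G(2)])
      fix K assume "K \<in> G"
      then have "right_ideal R K" "P \<subset> K" using G(1) by (auto simp: F_def)
      then show "right_ideal R K \<and> K \<subseteq> carrier R \<and> dcc (ideal_interval R K (carrier R))"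
        using above right_ideal_le_carrier by simp
    qed simp
    then show ?thesis using G(3) by simp
  next
    case False
    have "ideal_interval R P ?A \<subseteq> {P, ?A}"
    proof
      fix M assume M: "M \<in> ideal_interval R P ?A"
      have "?A \<subseteq> M" if "M \<noteq> P" using M that by (auto simp: interval_iff F_def)
      then show "M \<in> {P, ?A}" using M unfolding interval_iff by blast
    qed
    then have "dcc (ideal_interval R P ?A)"
      by (intro inclusion_order_finite) (auto intro: finite_subset)
    moreover have "dcc (ideal_interval R ?A (carrier R))"
      using above[OF A] PA False by blast
    ultimately show ?thesis
      using wfp_on_interval_extend[OF _ A PA _ right_ideal_full] by simp
  qed
qed

theorem dcc_if_cogen_test_set:
  assumes acc: "acc (ideal_interval R {\<zero>} (carrier R))"
    and S: "residual_test_set R S" and cogen: "\<And>P. P \<in> S \<Longrightarrow> cogen_ideal R P"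
  shows "dcc (ideal_interval R {\<zero>} (carrier R))"
proof (rule ccontr)
  assume notdcc: "\<not> ?thesis"
  define X where "X = {I. right_ideal R I \<and> \<not> dcc (ideal_interval R I (carrier R))}"
  have "X \<subseteq> ideal_interval R {\<zero>} (carrier R)"
    by (auto simp: X_def intro: right_ideal_in_interval)
  moreover have "X \<noteq> {}" using notdcc right_ideal_trivial by (auto simp: X_def)
  ultimately obtain I where I: "I \<in> X" "\<And>K. K \<in> X \<Longrightarrow> \<not> I \<subset> K"
    using wfp_on_minimal[OF acc, of X] by blast
  then have rI: "right_ideal R I" and ndcc: "\<not> dcc (ideal_interval R I (carrier R))"
    and above: "\<And>K. right_ideal R K \<Longrightarrow> I \<subset> K \<Longrightarrow> dcc (ideal_interval R K (carrier R))"
    by (auto simp: X_def)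
  have "I \<noteq> carrier R"
    using ndcc interval_self[of "carrier R"] inclusion_order_finite finite_subset
    by (metis finite.emptyI finite.insertI inclusion_order_simps(1))
  moreover have "acc (ideal_interval R I (carrier R))"
    using wfp_on_subset[OF acc interval_mono[OF right_ideal_ge_zero[OF rI] order_refl]] .
  ultimately obtain x where x: "x \<in> carrier R" "x \<notin> I" "residual R I x \<in> S"
    using S rI unfolding residual_test_set_def by blast
  let ?P = "residual R I x" and ?J = "adjoin R I x (carrier R)"
  have "dcc (ideal_interval R ?P (carrier R))"
  proof (rule dcc_if_cogen[OF cogen[OF x(3)]])
    \<comment> \<open>Some \<open>d \<in> D\<close> has \<open>x d \<notin> I\<close>, so
      \<open>I + x D\<close> strictly contains \<open>I\<close> and has an artinian factor by the
      choice of \<open>I\<close>; \<open>R/D\<close> embeds in that factor.\<close>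
    fix D assume D: "right_ideal R D" "?P \<subset> D"
    then obtain d where "d \<in> D" "d \<notin> ?P" by blast
    then have "x \<otimes> d \<in> adjoin R I x D" "x \<otimes> d \<notin> I"
      using adjoin_mem[OF rI D(1) x(1)] right_ideal_carrier[OF D(1)] by (auto simp: residual_def)
    then have "I \<subset> adjoin R I x D" using adjoin_upper[OF rI D(1) x(1)] by blast
    then have "dcc (ideal_interval R (adjoin R I x D) (carrier R))"
      using above right_ideal_adjoin[OF rI D(1) x(1)] by blast
    from wfp_on_interval_residual[OF inclusion_order_simps(1) rI x(1) D(1) _ this]
    show "dcc (ideal_interval R D (carrier R))" using D(2) by blast
  qed
  then have "dcc (ideal_interval R I ?J)"
    by (rule wfp_on_interval_adjoin[OF inclusion_order_simps(1) rI x(1)])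
  moreover have IJ: "I \<subset> ?J"
    using adjoin_upper[OF rI right_ideal_full x(1)] adjoin_self[OF rI x(1)] x(2) by blast
  moreover have J: "right_ideal R ?J" by (rule right_ideal_adjoin[OF rI right_ideal_full x(1)])
  ultimately have "dcc (ideal_interval R I (carrier R))"
    using wfp_on_interval_extend[OF inclusion_order_simps(1) J _ _ right_ideal_full]
      above[OF J] right_ideal_le_carrier[OF J] by blast
  then show False using ndcc by simp
qed

end

section \<open>Composition series\<close>

definition composition_series ::
    "('a, 'r) ring_scheme \<Rightarrow> 'a set \<Rightarrow> 'a set \<Rightarrow> nat \<Rightarrow> (nat \<Rightarrow> 'a set) \<Rightarrow> bool" where
  "composition_series R A B n C \<longleftrightarrow> C 0 = A \<and> C n = B \<and> (\<forall>i\<le>n. right_ideal R (C i)) \<and>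
     (\<forall>i<n. C i \<subset> C (Suc i) \<and> ideal_interval R (C i) (C (Suc i)) \<subseteq> {C i, C (Suc i)})"

lemma composition_series_le: "composition_series R A B n C \<Longrightarrow> A \<subseteq> B"
proof (induction n arbitrary: B)
  case (Suc n)
  then have "composition_series R A (C n) n C" "C n \<subseteq> B"
    by (auto simp: composition_series_def)
  then show ?case using Suc.IH by blast
qed (simp add: composition_series_def)

context ring
begin

lemma dcc_if_composition_series:
  assumes "composition_series R A B n C"
  shows "dcc (ideal_interval R A B)"
  using assms
proof (induction n arbitrary: B)
  case 0
  then have "A = B" unfolding composition_series_def by blast
  then show ?case using interval_self[of B]
    by (intro inclusion_order_finite) (auto intro: finite_subset)
next
  case (Suc n)
  then have *: "composition_series R A (C n) n C" by (simp add: composition_series_def)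
  have B: "C (Suc n) = B" "right_ideal R (C n)" "right_ideal R B" "C n \<subset> B"
    "ideal_interval R (C n) B \<subseteq> {C n, B}"
    using Suc.prems by (auto simp: composition_series_def)
  have "A \<subseteq> C n"
    by (rule composition_series_le[OF *])
  moreover have "dcc (ideal_interval R (C n) B)"
    using B(5) by (intro inclusion_order_finite) (auto intro: finite_subset)
  ultimately show ?case
    using wfp_on_interval_extend[OF inclusion_order_simps(1) B(2) _ _ B(3)] Suc.IH[OF *] B(4)
    by blast
qed

text \<open>ACC gives a maximal right ideal reached from \<open>A\<close> by a finite series; if it
  were not \<open>B\<close>, DCC would give a minimal one strictly above it and prolong the
  series.\<close>

lemma composition_series_if_acc_dcc:
  assumes A: "right_ideal R A" and B: "right_ideal R B" "A \<subseteq> B"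
    and acc: "acc (ideal_interval R A B)" and dcc: "dcc (ideal_interval R A B)"
  shows "\<exists>n C. composition_series R A B n C"
proof -
  define X where "X = {K \<in> ideal_interval R A B. \<exists>n C. composition_series R A K n C}"
  have "composition_series R A A 0 (\<lambda>_. A)" using A by (simp add: composition_series_def)
  then have "A \<in> X" using A B by (auto simp: X_def interval_iff)
  then obtain K where K: "K \<in> X" "\<And>L. L \<in> X \<Longrightarrow> \<not> K \<subset> L"
    using wfp_on_minimal[OF acc, of X] X_def by blast
  then obtain n C where C: "composition_series R A K n C"
    and KAB: "right_ideal R K" "A \<subseteq> K" "K \<subseteq> B" by (auto simp: X_def interval_iff)
  have "K = B"
  proof (rule ccontr)
    assume "K \<noteq> B"
    define Y where "Y = {L \<in> ideal_interval R A B. K \<subset> L}"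
    have "B \<in> Y" using B KAB \<open>K \<noteq> B\<close> by (auto simp: Y_def interval_iff)
    then obtain L where L: "L \<in> Y" "\<And>M. M \<in> Y \<Longrightarrow> \<not> M \<subset> L"
      using wfp_on_minimal[OF dcc, of Y] Y_def by blast
    have "ideal_interval R K L \<subseteq> {K, L}"
    proof
      fix M assume M: "M \<in> ideal_interval R K L"
      have "M = K \<or> M \<in> Y" using M L(1) KAB(2) by (auto simp: Y_def interval_iff)
      then show "M \<in> {K, L}" using L(2)[of M] M by (auto simp: interval_iff)
    qed
    then have "composition_series R A L (Suc n) (C(Suc n := L))"
      using C L(1) by (auto simp: composition_series_def Y_def interval_iff less_Suc_eq le_Suc_eq)
    then have "L \<in> X" using L(1) by (auto simp: X_def Y_def)
    then show False using K(2) L(1) by (auto simp: Y_def)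
  qed
  then show ?thesis using C by blast
qed

end
section \<open>The Hopkins--Levitzki theorem\<close>

definition jacobson :: "('a, 'r) ring_scheme \<Rightarrow> 'a set" where
  "jacobson R = carrier R \<inter> \<Inter>{m. maximal_right_ideal R m}"

text \<open>The right ideal generated by the products, written as an intersection so that its
  universal property is available without finite sums. Exponent \<open>0\<close> gives
  \<open>R\<close>, where the filtration in \<open>hopkins_levitzki\<close> starts.\<close>

primrec jacobson_power :: "('a, 'r) ring_scheme \<Rightarrow> nat \<Rightarrow> 'a set" where
  "jacobson_power R 0 = carrier R"
| "jacobson_power R (Suc n) =
     carrier R \<inter> \<Inter>{N. right_ideal R N \<and> (\<forall>x\<in>jacobson_power R n. \<forall>y\<in>jacobson R. x \<otimes>\<^bsub>R\<^esub> y \<in> N)}"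

context ring
begin

section \<open>Maximal right ideals and the Jacobson radical \<open>J\<close>\<close>

lemma maximal_right_idealD:
  assumes "maximal_right_ideal R m"
  shows "right_ideal R m" "m \<noteq> carrier R" "\<And>J. right_ideal R J \<Longrightarrow> m \<subset> J \<Longrightarrow> J = carrier R"
  using assms unfolding maximal_right_ideal_def by blast+

text \<open>By Zorn's lemma. Every nonzero submodule of \<open>R/K\<close> contains
  \<open>s + K\<close>, so \<open>R/K\<close> has a least nonzero submodule. With
  \<open>s = 1\<close> this yields maximal right ideals.\<close>

lemma exists_maximal_avoiding:
  assumes I: "right_ideal R I" and s: "s \<notin> I"
  obtains K where "right_ideal R K" "I \<subseteq> K" "s \<notin> K" "\<And>N. right_ideal R N \<Longrightarrow> K \<subset> N \<Longrightarrow> s \<in> N"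
proof -
  define \<N> where "\<N> = {K. right_ideal R K \<and> I \<subseteq> K \<and> s \<notin> K}"
  have "\<exists>M\<in>\<N>. \<forall>X\<in>\<N>. M \<subseteq> X \<longrightarrow> X = M"
  proof (rule subset_Zorn_nonempty)
    show "\<N> \<noteq> {}" using assms by (auto simp: \<N>_def)
    fix \<C> assume C: "\<C> \<noteq> {}" "subset.chain \<N> \<C>"
    then have ri: "\<And>A. A \<in> \<C> \<Longrightarrow> right_ideal R A"
      and lin: "\<And>A B. A \<in> \<C> \<Longrightarrow> B \<in> \<C> \<Longrightarrow> A \<subseteq> B \<or> B \<subseteq> A"
      and av: "\<And>A. A \<in> \<C> \<Longrightarrow> I \<subseteq> A \<and> s \<notin> A"
      unfolding subset_chain_def \<N>_def by blast+
    show "\<Union>\<C> \<in> \<N>"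
      using right_ideal_Union_chain[OF C(1) ri lin] av C(1) by (auto simp: \<N>_def)
  qed
  then obtain M where M: "M \<in> \<N>" "\<And>X. X \<in> \<N> \<Longrightarrow> M \<subseteq> X \<Longrightarrow> X = M" by blast
  show ?thesis
  proof (rule that[of M])
    fix N assume N: "right_ideal R N" "M \<subset> N"
    then show "s \<in> N" using M(1) M(2)[of N] by (auto simp: \<N>_def)
  qed (use M(1) in \<open>auto simp: \<N>_def\<close>)
qed

lemma exists_maximal_right_ideal:
  assumes I: "right_ideal R I" "I \<noteq> carrier R"
  obtains m where "maximal_right_ideal R m" "I \<subseteq> m"
proof -
  have "\<one> \<notin> I" using right_ideal_one[OF I(1)] I(2) by blast
  then obtain K where K: "right_ideal R K" "I \<subseteq> K" "\<one> \<notin> K"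
    and max: "\<And>N. right_ideal R N \<Longrightarrow> K \<subset> N \<Longrightarrow> \<one> \<in> N"
    using exists_maximal_avoiding[OF I(1)] by metis
  have "maximal_right_ideal R K"
    unfolding maximal_right_ideal_def
    using K(1,3) max right_ideal_one by (auto simp: psubset_eq)
  then show ?thesis using that K(2) by blast
qed

text \<open>The class of \<open>r\<close> generates the simple module \<open>R/m\<close>, so that
  \<open>R/(m : r) \<cong> R/m\<close>.\<close>

lemma residual_maximal:
  assumes m: "maximal_right_ideal R m" and r: "r \<in> carrier R" "r \<notin> m"
  shows "maximal_right_ideal R (residual R m r)"
proof -
  note mI = maximal_right_idealD(1)[OF m]
  let ?P = "residual R m r"
  have P: "right_ideal R ?P" by (rule right_ideal_residual[OF mI r(1)])
  have "\<one> \<notin> ?P" using r by (simp add: residual_def)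
  then have "?P \<noteq> carrier R" by blast
  moreover have "J = carrier R" if J: "right_ideal R J" "?P \<subset> J" for J
  proof -
    obtain y where y: "y \<in> J" "y \<notin> ?P" using J(2) by blast
    have yR: "y \<in> carrier R" using y(1) right_ideal_carrier[OF J(1)] by simp
    let ?N = "adjoin R m r J"
    have N: "right_ideal R ?N" by (rule right_ideal_adjoin[OF mI J(1) r(1)])
    have "r \<otimes> y \<in> ?N" "r \<otimes> y \<notin> m"
      using adjoin_mem[OF mI J(1) r(1) y(1)] y yR by (auto simp: residual_def)
    then have "?N = carrier R"
      using maximal_right_idealD(3)[OF m N] adjoin_upper[OF mI J(1) r(1)] by blast
    then have "residual R ?N r = carrier R" using r(1) by (auto simp: residual_def)
    then show ?thesis using residual_adjoin[OF mI J(1) r(1)] J(2) by simp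
  qed
  ultimately show ?thesis unfolding maximal_right_ideal_def using P by (auto simp: psubset_eq)
qed

lemma right_ideal_jacobson: "right_ideal R (jacobson R)"
  unfolding jacobson_def by (rule right_ideal_Inter) (simp add: maximal_right_ideal_def)

text \<open>For \<open>r \<notin> m\<close> the residual \<open>(m : r)\<close> is again a maximal
  right ideal, so it contains \<open>x\<close>. Thus \<open>J\<close> is two-sided although defined
  by right ideals only.\<close>

lemma jacobson_left:
  assumes "r \<in> carrier R" "x \<in> jacobson R"
  shows "r \<otimes> x \<in> jacobson R"
proof -
  have "r \<otimes> x \<in> m" if m: "maximal_right_ideal R m" for m
  proof (cases "r \<in> m")
    case True
    then show ?thesis using right_ideal_mult[OF maximal_right_idealD(1)[OF m]] assms(2)
      by (simp add: jacobson_def)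
  next
    case False
    then have "x \<in> residual R m r"
      using residual_maximal[OF m assms(1)] assms(2) by (simp add: jacobson_def)
    then show ?thesis by (simp add: residual_def)
  qed
  then show ?thesis using assms by (auto simp: jacobson_def)
qed

text \<open>A maximal right ideal containing \<open>1 - x\<close> would also contain
  \<open>x\<close>, hence \<open>1\<close>.\<close>

lemma jacobson_right_inverse:
  assumes x: "x \<in> jacobson R"
  obtains c where "c \<in> carrier R" "(\<one> \<ominus> x) \<otimes> c = \<one>"
proof -
  have xR: "x \<in> carrier R" using x by (simp add: jacobson_def)
  let ?I = "(\<otimes>) (\<one> \<ominus> x) ` carrier R"
  have I: "right_ideal R ?I" using xR by (intro right_ideal_image right_ideal_full) simp
  have mem: "\<one> \<ominus> x \<in> ?I" using xR by (metis image_eqI minus_closed one_closed r_one)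
  have "?I = carrier R"
  proof (rule ccontr)
    assume "?I \<noteq> carrier R"
    then obtain m where m: "maximal_right_ideal R m" "?I \<subseteq> m"
      using exists_maximal_right_ideal[OF I] by blast
    have mI: "right_ideal R m" using maximal_right_idealD(1)[OF m(1)] .
    have "x \<in> m" using x m(1) by (auto simp: jacobson_def)
    moreover have "\<one> \<ominus> x \<in> m" using mem m(2) by blast
    ultimately have "\<one> \<in> m" using right_ideal_diffD[OF mI, of \<one> x] by simp
    then show False using right_ideal_one[OF mI] maximal_right_idealD(2)[OF m(1)] by simp
  qed
  then obtain c where "c \<in> carrier R" "\<one> = (\<one> \<ominus> x) \<otimes> c" by (metis imageE one_closed)
  then show ?thesis using that by simp
qed

text \<open>\<open>R/J\<close> is semisimple: a minimal \<open>D\<close> with \<open>D + C = R\<close> satisfies \<open>D \<inter> C \<subseteq> J\<close>.  So a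
  factor of \<open>R/J\<close> with a least nonzero submodule is simple.\<close>

lemma maximal_if_avoiding_above_jacobson:
  assumes dcc: "dcc (ideal_interval R {\<zero>} (carrier R))"
    and A: "right_ideal R A" "jacobson R \<subseteq> A" and s: "s \<in> carrier R" "s \<notin> A"
    and least: "\<And>B. right_ideal R B \<Longrightarrow> A \<subset> B \<Longrightarrow> s \<in> B"
  shows "maximal_right_ideal R A"
proof (rule ccontr)
  assume "\<not> ?thesis"
  moreover have "A \<noteq> carrier R" using s by blast
  ultimately obtain C where C: "right_ideal R C" "A \<subset> C" "C \<noteq> carrier R"
    unfolding maximal_right_ideal_def using A(1) by blast
  define X where "X = {D. right_ideal R D \<and> D <+> C = carrier R}"
  have "carrier R <+> C = carrier R"
    using right_ideal_sum_upper(1)[OF right_ideal_full C(1)]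
      right_ideal_le_carrier[OF right_ideal_sum[OF right_ideal_full C(1)]] by blast
  then have "X \<noteq> {}" using right_ideal_full by (auto simp: X_def)
  moreover have "X \<subseteq> ideal_interval R {\<zero>} (carrier R)"
    by (auto simp: X_def intro: right_ideal_in_interval)
  ultimately obtain D where D: "D \<in> X" "\<And>E. E \<in> X \<Longrightarrow> \<not> E \<subset> D"
    using wfp_on_minimal[OF dcc, of X] by blast
  then have DI: "right_ideal R D" and DC: "D <+> C = carrier R" by (auto simp: X_def)
  have "D \<inter> C \<subseteq> m" if m: "maximal_right_ideal R m" for m
  proof (rule ccontr)
    assume nsub: "\<not> D \<inter> C \<subseteq> m"
    note mI = maximal_right_idealD(1)[OF m]
    have DCI: "right_ideal R (D \<inter> C)" by (rule right_ideal_Int[OF DI C(1)])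
    \<comment> \<open>The modular law turns this into
      \<open>D = (D \<inter> C) + (m \<inter> D)\<close>, so already
      \<open>(m \<inter> D) + C = R\<close>. Minimality of \<open>D\<close> forces
      \<open>D \<subseteq> m\<close>, against \<open>nsub\<close>.\<close>
    have "(D \<inter> C) <+> m = carrier R"
      using maximal_right_idealD(3)[OF m right_ideal_sum[OF DCI mI]]
        right_ideal_sum_upper[OF DCI mI] nsub by blast
    moreover have "((D \<inter> C) <+> m) \<inter> D = (D \<inter> C) <+> (m \<inter> D)"
      by (rule modular[OF DCI mI DI]) blast
    ultimately have eq: "D = (D \<inter> C) <+> (m \<inter> D)"
      using right_ideal_le_carrier[OF DI] by blast
    have mD: "right_ideal R (m \<inter> D)" by (rule right_ideal_Int[OF mI DI])
    have sum: "right_ideal R ((m \<inter> D) <+> C)" by (rule right_ideal_sum[OF mD C(1)])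
    note up = right_ideal_sum_upper[OF mD C(1)]
    have "D \<subseteq> (m \<inter> D) <+> C"
      using right_ideal_sum_least[OF sum, of "D \<inter> C" "m \<inter> D"] up eq by blast
    then have "carrier R \<subseteq> (m \<inter> D) <+> C"
      using right_ideal_sum_least[OF sum, of D C] up(2) DC by blast
    then have "m \<inter> D \<in> X" using mD right_ideal_le_carrier[OF sum] by (auto simp: X_def)
    then have "m \<inter> D = D" using D(2) by blast
    then show False using nsub by blast
  qed
  then have "D \<inter> C \<subseteq> jacobson R"
    using right_ideal_le_carrier[OF DI] by (auto simp: jacobson_def)
  then have DCA: "D \<inter> C \<subseteq> A" using A(2) by blast
  \<comment> \<open>Hence \<open>A + D\<close> and \<open>C\<close> are both strictly above
    \<open>A\<close> and contain \<open>s\<close>; but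
    \<open>(A + D) \<inter> C = A + (D \<inter> C) = A\<close> by the modular law.\<close>
  have "\<not> D \<subseteq> A"
  proof
    assume "D \<subseteq> A"
    then have "D <+> C \<subseteq> C" using C(2) by (intro right_ideal_sum_least[OF C(1)]) auto
    then show False using DC C(3) right_ideal_le_carrier[OF C(1)] by blast
  qed
  then have "s \<in> A <+> D"
    using least[OF right_ideal_sum[OF A(1) DI]] right_ideal_sum_upper[OF A(1) DI] by blast
  moreover have "s \<in> C" by (rule least[OF C(1,2)])
  ultimately have "s \<in> A <+> (D \<inter> C)" using modular[OF A(1) DI C(1)] C(2) by blast
  moreover have "A <+> (D \<inter> C) \<subseteq> A" using DCA by (intro right_ideal_sum_least[OF A(1)]) auto
  ultimately show False using s(2) by blast
qed

text \<open>\<open>I/L\<close> is a module over the semisimple ring \<open>R/J\<close>. Take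
  \<open>K0\<close> minimal such that \<open>I/K0\<close> is noetherian. For
  \<open>x \<in> K0\<close> outside \<open>L\<close> there is a right ideal
  \<open>K \<inter> I\<close> avoiding \<open>x\<close> such that \<open>I/(K \<inter> I)\<close> is
  simple; intersecting it with \<open>K0\<close> contradicts minimality, so
  \<open>K0 = L\<close>.\<close>

lemma acc_if_killed_by_jacobson:
  assumes dcc: "dcc (ideal_interval R {\<zero>} (carrier R))"
    and I: "right_ideal R I" and L: "right_ideal R L" "L \<subseteq> I"
    and kill: "\<And>y j. y \<in> I \<Longrightarrow> j \<in> jacobson R \<Longrightarrow> y \<otimes> j \<in> L"
  shows "acc (ideal_interval R L I)"
proof -
  define X where "X = {K \<in> ideal_interval R L I. acc (ideal_interval R K I)}"
  have "acc (ideal_interval R I I)"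
    using interval_self[of I] by (intro inclusion_order_finite) (auto intro: finite_subset)
  then have "I \<in> X" using I L(2) by (simp add: X_def interval_iff)
  moreover have "X \<subseteq> ideal_interval R {\<zero>} (carrier R)"
    by (auto simp: X_def interval_iff intro!: right_ideal_in_interval[unfolded interval_iff]
        dest: right_ideal_zero right_ideal_carrier)
  ultimately obtain K0 where K0: "K0 \<in> X" "\<And>K. K \<in> X \<Longrightarrow> \<not> K \<subset> K0"
    using wfp_on_minimal[OF dcc, of X] by blast
  then have K0': "right_ideal R K0" "L \<subseteq> K0" "K0 \<subseteq> I" "acc (ideal_interval R K0 I)"
    by (auto simp: X_def interval_iff)
  have "K0 \<subseteq> L"
  proof
    fix x assume x: "x \<in> K0"
    show "x \<in> L"
    proof (rule ccontr)
      assume "x \<notin> L"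
      then obtain K where K: "right_ideal R K" "L \<subseteq> K" "x \<notin> K"
        and max: "\<And>N. right_ideal R N \<Longrightarrow> K \<subset> N \<Longrightarrow> x \<in> N"
        using exists_maximal_avoiding[OF L(1)] by metis
      have xI: "x \<in> I" using x K0'(3) by blast
      have KI: "right_ideal R (K \<inter> I)" by (rule right_ideal_Int[OF K(1) I])
      \<comment> \<open>In \<open>R/K\<close> the class of \<open>x\<close> generates the least
        nonzero submodule, and \<open>(K + y R)/K \<cong> R/(K : y)\<close> inherits such a
        submodule. As \<open>y J \<subseteq> K\<close>, this is a factor of \<open>R/J\<close>,
        hence simple, and so \<open>y\<close> lies in \<open>K + x R\<close>.\<close>
      have gen: "\<exists>k\<in>K. \<exists>r\<in>carrier R. y = k \<oplus> x \<otimes> r" if y: "y \<in> I" "y \<notin> K" for y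
      proof -
        have yR: "y \<in> carrier R" using y(1) right_ideal_carrier[OF I] by simp
        have xR: "x \<in> carrier R" using xI right_ideal_carrier[OF I] by simp
        let ?A = "residual R K y"
        have A: "right_ideal R ?A" by (rule right_ideal_residual[OF K(1) yR])
        have expand: "\<exists>k\<in>K. \<exists>b\<in>B. x = k \<oplus> y \<otimes> b" if B: "right_ideal R B" "\<not> B \<subseteq> ?A" for B
        proof -
          obtain b where b: "b \<in> B" "b \<notin> ?A" using B(2) by blast
          have "y \<otimes> b \<in> adjoin R K y B" by (rule adjoin_mem[OF K(1) B(1) yR b(1)])
          moreover have "y \<otimes> b \<notin> K" using b right_ideal_carrier[OF B(1)] by (auto simp: residual_def)
          ultimately have "x \<in> adjoin R K y B"
            using max[OF right_ideal_adjoin[OF K(1) B(1) yR]] adjoin_upper[OF K(1) B(1) yR] by blast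
          then show ?thesis by (simp add: adjoin_iff)
        qed
        have "\<one> \<notin> ?A" using y(2) yR by (simp add: residual_def)
        then obtain k s where ks: "k \<in> K" "s \<in> carrier R" "x = k \<oplus> y \<otimes> s"
          using expand[OF right_ideal_full] by blast
        have kR: "k \<in> carrier R" using ks(1) right_ideal_carrier[OF K(1)] by simp
        have sA: "s \<notin> ?A" using ks K(3) right_ideal_add[OF K(1)] by (auto simp: residual_def)
        have "maximal_right_ideal R ?A"
        proof (rule maximal_if_avoiding_above_jacobson[OF dcc A _ ks(2) sA])
          show "jacobson R \<subseteq> ?A"
            using kill[OF y(1)] K(2) by (auto simp: residual_def jacobson_def)
          \<comment> \<open>From \<open>x = k + y s\<close> and \<open>x = k' + y b\<close> follows
            \<open>y (s - b) = k' - k\<close>, an element of \<open>K\<close>; so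
            \<open>s - b\<close> is in \<open>(K : y)\<close>, which \<open>B\<close>
            contains.\<close>
          fix B assume B: "right_ideal R B" "?A \<subset> B"
          then obtain k' b where kb: "k' \<in> K" "b \<in> B" "x = k' \<oplus> y \<otimes> b" using expand[of B] by blast
          have bR: "b \<in> carrier R" "k' \<in> carrier R"
            using kb right_ideal_carrier[OF B(1)] right_ideal_carrier[OF K(1)] by auto
          have "y \<otimes> (s \<ominus> b) = k' \<ominus> k"
          proof -
            have "y \<otimes> s = \<ominus> k \<oplus> x"
              using ks(2) kR yR by (subst ks(3)) (simp add: r_neg1)
            moreover have "y \<otimes> b = \<ominus> k' \<oplus> x"
              using bR yR by (subst kb(3)) (simp add: r_neg1)
            ultimately have "y \<otimes> (s \<ominus> b) = (\<ominus> k \<oplus> x) \<ominus> (\<ominus> k' \<oplus> x)"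
              using ks(2) bR yR by (simp add: minus_eq r_distr r_minus)
            also have "\<dots> = k' \<ominus> k"
            proof -
              have "(\<ominus> k \<oplus> x) \<ominus> (\<ominus> k' \<oplus> x) = \<ominus> k \<oplus> (x \<oplus> (\<ominus> x \<oplus> k'))"
                using bR kR xR by (simp add: minus_eq minus_add a_ac)
              also have "\<dots> = \<ominus> k \<oplus> k'" using bR kR xR by (simp add: r_neg2)
              also have "\<dots> = k' \<ominus> k" using bR kR by (simp add: minus_eq a_comm)
              finally show ?thesis .
            qed
            finally show ?thesis .
          qed
          then have "s \<ominus> b \<in> ?A"
            using right_ideal_diff[OF K(1) kb(1) ks(1)] ks(2) bR by (simp add: residual_def)
          then show "s \<in> B" using B kb(2) ks(2) right_ideal_diffD[OF B(1)] by blast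
        qed
        \<comment> \<open>Maximality gives \<open>1 = a + s t\<close> with
          \<open>a \<in> (K : y)\<close>; multiplying by \<open>y\<close> on the left and replacing
          \<open>y s\<close> by \<open>x - k\<close> puts \<open>y\<close> into
          \<open>K + x R\<close>.\<close>
        then have "adjoin R ?A s (carrier R) = carrier R"
          using maximal_right_idealD(3) right_ideal_adjoin[OF A right_ideal_full ks(2)]
            adjoin_upper[OF A right_ideal_full ks(2)] adjoin_self[OF A ks(2)] sA by blast
        then have "\<one> \<in> adjoin R ?A s (carrier R)" by simp
        then obtain a t where at: "a \<in> ?A" "t \<in> carrier R" "\<one> = a \<oplus> s \<otimes> t"
          by (auto simp: adjoin_iff)
        have aR: "a \<in> carrier R" using at(1) by (simp add: residual_def)
        have "y = y \<otimes> (a \<oplus> s \<otimes> t)" using at(3)[symmetric] yR by simp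
        also have "\<dots> = y \<otimes> a \<oplus> (y \<otimes> s) \<otimes> t"
          using yR aR at ks(2) by (simp add: r_distr m_assoc)
        also have "y \<otimes> s = \<ominus> k \<oplus> x"
          using ks kR yR by (simp add: a_assoc[symmetric] l_neg)
        also have "y \<otimes> a \<oplus> (\<ominus> k \<oplus> x) \<otimes> t = (y \<otimes> a \<oplus> (\<ominus> k) \<otimes> t) \<oplus> x \<otimes> t"
          using yR aR kR xR at(2) by (simp add: l_distr a_assoc)
        finally have "y = (y \<otimes> a \<oplus> (\<ominus> k) \<otimes> t) \<oplus> x \<otimes> t" .
        moreover have "y \<otimes> a \<in> K" using at(1) by (simp add: residual_def)
        moreover have "(\<ominus> k) \<otimes> t \<in> K"
          by (rule right_ideal_mult[OF K(1) right_ideal_minus[OF K(1) ks(1)] at(2)])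
        ultimately show ?thesis using at(2) right_ideal_add[OF K(1)] by blast
      qed
      \<comment> \<open>If \<open>C\<close> strictly exceeds \<open>K \<inter> I\<close>, then
        \<open>x = k + d\<close> with \<open>k \<in> K\<close> and \<open>d \<in> C\<close>. Here
        \<open>k = x - d\<close> is in \<open>I\<close>, so \<open>k\<close> and with it
        \<open>x\<close> lie in \<open>C\<close>; then \<open>gen\<close> gives
        \<open>I \<subseteq> C\<close>.\<close>
      have "ideal_interval R (K \<inter> I) I \<subseteq> {K \<inter> I, I}"
      proof
        fix C assume C: "C \<in> ideal_interval R (K \<inter> I) I"
        then have C': "right_ideal R C" "K \<inter> I \<subseteq> C" "C \<subseteq> I" by (auto simp: interval_iff)
        have "I \<subseteq> C" if ne: "C \<noteq> K \<inter> I"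
        proof -
          obtain c where c: "c \<in> C" "c \<notin> K" using ne C' by blast
          have "x \<in> K <+> C"
            using max[OF right_ideal_sum[OF K(1) C'(1)]] right_ideal_sum_upper[OF K(1) C'(1)] c
            by blast
          then obtain k d where kd: "k \<in> K" "d \<in> C" "x = k \<oplus> d" by (auto simp: set_add_iff)
          have kR: "k \<in> carrier R" and dR: "d \<in> carrier R"
            using kd right_ideal_carrier[OF K(1)] right_ideal_carrier[OF C'(1)] by auto
          have "k \<in> I"
            using right_ideal_add_cancel[OF I, of d k] xI kd C'(3) kR dR by (auto simp: a_comm)
          then have xC: "x \<in> C" using kd C'(2) right_ideal_add[OF C'(1)] by blast
          show "I \<subseteq> C"
          proof
            fix y assume y: "y \<in> I"
            show "y \<in> C"
            proof (cases "y \<in> K")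
              case True
              then show ?thesis using y C'(2) by blast
            next
              case False
              then obtain k r where kr: "k \<in> K" "r \<in> carrier R" "y = k \<oplus> x \<otimes> r"
                using gen y by blast
              have xr: "x \<otimes> r \<in> I" "x \<otimes> r \<in> C"
                using right_ideal_mult[OF I xI kr(2)] right_ideal_mult[OF C'(1) xC kr(2)] by auto
              have "k \<in> carrier R" using kr(1) right_ideal_carrier[OF K(1)] by simp
              then have "k \<in> I"
                using right_ideal_add_cancel[OF I, of "x \<otimes> r" k] xr(1) y kr right_ideal_carrier[OF I]
                by (simp add: a_comm)
              then show ?thesis using kr xr(2) C'(2) right_ideal_add[OF C'(1)] by blast
            qed
          qed
        qed
        then show "C \<in> {K \<inter> I, I}" using C'(3) by blast
      qed
      then have "acc (ideal_interval R (K \<inter> I) I)"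
        by (intro inclusion_order_finite) (auto intro: finite_subset)
      then have "acc (ideal_interval R ((K \<inter> I) \<inter> K0) I)"
        using wfp_on_interval_Int[OF inclusion_order_simps(2) KI K0'(1) _ K0'(3) I _ K0'(4)] by blast
      moreover have "right_ideal R ((K \<inter> I) \<inter> K0)" by (rule right_ideal_Int[OF KI K0'(1)])
      ultimately have "(K \<inter> I) \<inter> K0 \<in> X"
        using K(2) K0' L(2) by (auto simp: X_def interval_iff)
      then have "\<not> (K \<inter> I) \<inter> K0 \<subset> K0" by (rule K0(2))
      then show False using x K(3) by blast
    qed
  qed
  then have "K0 = L" using K0'(2) by blast
  then show ?thesis using K0'(4) by simp
qed

section \<open>Powers of the radical and its nilpotency\<close>

lemma right_ideal_jacobson_power: "right_ideal R (jacobson_power R n)"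
  by (induction n) (auto simp: right_ideal_full intro!: right_ideal_Inter)

lemma jacobson_power_mult:
  assumes "x \<in> jacobson_power R n" "y \<in> jacobson R"
  shows "x \<otimes> y \<in> jacobson_power R (Suc n)"
  using assms right_ideal_carrier[OF right_ideal_jacobson_power] right_ideal_carrier[OF right_ideal_jacobson]
  by auto

lemma jacobson_power_Suc_least:
  assumes "right_ideal R N" "\<And>x y. x \<in> jacobson_power R n \<Longrightarrow> y \<in> jacobson R \<Longrightarrow> x \<otimes> y \<in> N"
  shows "jacobson_power R (Suc n) \<subseteq> N"
  using assms by auto

lemma jacobson_power_decreasing: "jacobson_power R (Suc n) \<subseteq> jacobson_power R n"
  using right_ideal_carrier[OF right_ideal_jacobson]
  by (intro jacobson_power_Suc_least right_ideal_jacobson_power)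
    (auto intro: right_ideal_mult[OF right_ideal_jacobson_power])

lemma jacobson_power_Suc_sub: "jacobson_power R (Suc n) \<subseteq> jacobson R"
  using right_ideal_carrier[OF right_ideal_jacobson_power]
  by (intro jacobson_power_Suc_least right_ideal_jacobson jacobson_left) auto

text \<open>Induction on \<open>k\<close>, applied to \<open>N' = {z. z J \<subseteq> N}\<close> in
  place of \<open>N\<close>; this is a right ideal because \<open>J\<close> is closed under left
  multiplication. It allows a stable power to be compared with its own square.\<close>

lemma jacobson_power_add_least:
  assumes "right_ideal R N"
    and "\<And>x y. x \<in> jacobson_power R m \<Longrightarrow> y \<in> jacobson_power R k \<Longrightarrow> x \<otimes> y \<in> N"
  shows "jacobson_power R (m + k) \<subseteq> N"
  using assms
proof (induction k arbitrary: N)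
  case 0
  have "x \<in> N" if "x \<in> jacobson_power R m" for x
    using "0.prems"(2)[of x \<one>] that right_ideal_carrier[OF right_ideal_jacobson_power that] by simp
  then show ?case by auto
next
  case (Suc k)
  define N' where "N' = {z \<in> carrier R. \<forall>y\<in>jacobson R. z \<otimes> y \<in> N}"
  have JR: "y \<in> carrier R" if "y \<in> jacobson R" for y
    using that right_ideal_carrier[OF right_ideal_jacobson] by simp
  have N': "right_ideal R N'"
    unfolding right_ideal_iff N'_def
    using JR Suc.prems(1)
    by (auto simp: l_distr m_assoc right_ideal_zero right_ideal_add jacobson_left)
  have "x \<otimes> y \<in> N'" if x: "x \<in> jacobson_power R m" and y: "y \<in> jacobson_power R k" for x y
  proof -
    have "x \<in> carrier R" "y \<in> carrier R"
      using x y right_ideal_carrier[OF right_ideal_jacobson_power] by auto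
    then show ?thesis
      using Suc.prems(2)[OF x jacobson_power_mult[OF y]] JR by (simp add: N'_def m_assoc)
  qed
  then have "jacobson_power R (m + k) \<subseteq> N'" using Suc.IH[OF N'] by blast
  then show ?case
    unfolding add_Suc_right by (intro jacobson_power_Suc_least Suc.prems(1)) (auto simp: N'_def)
qed

text \<open>The powers become stable at some \<open>B\<close>. If \<open>B\<close> is not zero, take
  a right ideal \<open>A\<close> minimal with \<open>A B\<close> nonzero and
  \<open>a \<in> A\<close> with \<open>a B\<close> nonzero; since \<open>a B B\<close> is nonzero
  too, \<open>A = a B\<close>. So \<open>a = a c\<close> with
  \<open>c \<in> B \<subseteq> J\<close>, and as \<open>1 - c\<close> has a right inverse,
  \<open>a = 0\<close>.\<close>

lemma jacobson_nilpotent: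
  assumes dcc: "dcc (ideal_interval R {\<zero>} (carrier R))"
  obtains n where "jacobson_power R n = {\<zero>}"
proof -
  let ?P = "jacobson_power R"
  have "\<exists>n. \<forall>i\<ge>n. ?P i = ?P n"
    using dcc jacobson_power_decreasing right_ideal_in_interval[OF right_ideal_jacobson_power]
    unfolding dcc_iff_chain by blast
  then obtain n where n: "\<And>i. n \<le> i \<Longrightarrow> ?P i = ?P n" by blast
  define B where "B = ?P n"
  \<comment> \<open>Only positive powers are known to lie in \<open>J\<close>, and \<open>n\<close>
    may be \<open>0\<close>; stability identifies \<open>B\<close> with the power of exponent
    \<open>n + 1\<close>.\<close>
  have B: "right_ideal R B" "B \<subseteq> jacobson R"
    using right_ideal_jacobson_power[of n] jacobson_power_Suc_sub[of n] n[of "Suc n"]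
    by (simp_all add: B_def)
  have BR: "b \<in> carrier R" if "b \<in> B" for b using right_ideal_carrier[OF B(1) that] .
  \<comment> \<open>Stability at exponent \<open>n + n\<close> makes \<open>B\<close> idempotent: it
    lies in each right ideal containing the products of its elements.\<close>
  have BB: "B \<subseteq> N" if "right_ideal R N" "\<And>x y. x \<in> B \<Longrightarrow> y \<in> B \<Longrightarrow> x \<otimes> y \<in> N" for N
    using jacobson_power_add_least[OF that(1), of n n] that(2) n[of "n + n"] by (simp add: B_def)
  have "B = {\<zero>}"
  proof (rule ccontr)
    assume "B \<noteq> {\<zero>}"
    then obtain b0 where b0: "b0 \<in> B" "b0 \<noteq> \<zero>" using right_ideal_zero[OF B(1)] by blast
    define X where "X = {A. right_ideal R A \<and> (\<exists>a\<in>A. \<exists>b\<in>B. a \<otimes> b \<noteq> \<zero>)}"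
    have "\<one> \<otimes> b0 \<noteq> \<zero>" using b0 BR by simp
    then have "carrier R \<in> X" using right_ideal_full b0 by (auto simp: X_def)
    moreover have "X \<subseteq> ideal_interval R {\<zero>} (carrier R)"
      by (auto simp: X_def intro: right_ideal_in_interval)
    ultimately obtain A where A: "A \<in> X" "\<And>E. E \<in> X \<Longrightarrow> \<not> E \<subset> A"
      using wfp_on_minimal[OF dcc, of X] by blast
    then obtain a b where ab: "right_ideal R A" "a \<in> A" "b \<in> B" "a \<otimes> b \<noteq> \<zero>"
      by (auto simp: X_def)
    have aR: "a \<in> carrier R" using ab right_ideal_carrier by blast
    let ?aB = "(\<otimes>) a ` B"
    have aB: "right_ideal R ?aB" by (rule right_ideal_image[OF B(1) aR])
    have "\<exists>c\<in>?aB. \<exists>b'\<in>B. c \<otimes> b' \<noteq> \<zero>"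
    proof (rule ccontr)
      assume zero: "\<not> ?thesis"
      \<comment> \<open>If \<open>a B B = 0\<close>, then \<open>(0 : a)\<close> contains all
        products of elements of \<open>B\<close>, hence \<open>B\<close>, contrary to
        \<open>a b \<noteq> 0\<close>.\<close>
      have "B \<subseteq> residual R {\<zero>} a"
      proof (rule BB[OF right_ideal_residual[OF right_ideal_trivial aR]])
        fix x y assume "x \<in> B" "y \<in> B"
        then show "x \<otimes> y \<in> residual R {\<zero>} a"
          using zero BR aR by (auto simp: residual_def m_assoc)
      qed
      then show False using ab by (auto simp: residual_def)
    qed
    then have "?aB \<in> X" using aB by (simp add: X_def)
    moreover have "?aB \<subseteq> A" using ab BR right_ideal_mult by auto
    ultimately have "a \<in> ?aB" using A(2) ab(2) by blast
    then obtain c where c: "c \<in> B" "a = a \<otimes> c" by blast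
    obtain d where d: "d \<in> carrier R" "(\<one> \<ominus> c) \<otimes> d = \<one>"
      using jacobson_right_inverse[of c] c(1) B(2) by blast
    have cR: "c \<in> carrier R" using c(1) BR by simp
    have "a \<otimes> (\<one> \<ominus> c) = \<zero>"
      using c(2) aR cR by (simp add: minus_eq r_distr r_minus r_neg)
    then have "a = \<zero>" using d aR cR by (metis l_null m_assoc minus_closed one_closed r_one)
    then show False using ab BR by simp
  qed
  then show ?thesis using that by (simp add: B_def)
qed

text \<open>Each layer of the filtration by powers of \<open>J\<close> is killed by
  \<open>J\<close>, hence noetherian, and nilpotency lets the filtration end at zero after finitely
  many extensions.\<close>

theorem hopkins_levitzki:
  assumes dcc: "dcc (ideal_interval R {\<zero>} (carrier R))"
  shows "acc (ideal_interval R {\<zero>} (carrier R))"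
proof -
  let ?P = "jacobson_power R"
  have "acc (ideal_interval R (?P n) (carrier R))" for n
  proof (induction n)
    case 0
    show ?case using interval_self[of "carrier R"]
      by (intro inclusion_order_finite) (auto intro: finite_subset)
  next
    case (Suc n)
    have "acc (ideal_interval R (?P (Suc n)) (?P n))"
      by (rule acc_if_killed_by_jacobson[OF dcc right_ideal_jacobson_power
            right_ideal_jacobson_power jacobson_power_decreasing jacobson_power_mult])
    then show ?case
      using wfp_on_interval_extend[OF inclusion_order_simps(2) right_ideal_jacobson_power
          jacobson_power_decreasing right_ideal_le_carrier[OF right_ideal_jacobson_power]
          right_ideal_full _ Suc.IH] by blast
  qed
  moreover obtain n where "?P n = {\<zero>}" using jacobson_nilpotent[OF dcc] .
  ultimately show ?thesis by metis
qed

end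
section \<open>Modules presented as subquotients of the ring\<close>

text \<open>The map \<open>f\<close> induces \<open>M \<cong> B/A\<close>, so that the submodules of \<open>M\<close> correspond to the right ideals
  between \<open>A\<close> and \<open>B\<close>.\<close>

locale presentation = right_module R M
  for R :: "('a, 'r) ring_scheme" (structure) and M :: "('a, 'b) rmodule" (structure) +
  fixes f :: "'a \<Rightarrow> 'b" and A B :: "'a set"
  assumes A: "right_ideal R A" and B: "right_ideal R B" and AB: "A \<subseteq> B"
    and image: "f ` B = carrier M"
    and f_add: "\<lbrakk>x \<in> B; y \<in> B\<rbrakk> \<Longrightarrow> f (x \<oplus>\<^bsub>R\<^esub> y) = f x \<oplus>\<^bsub>M\<^esub> f y"
    and f_mult: "\<lbrakk>x \<in> B; a \<in> carrier R\<rbrakk> \<Longrightarrow> f (x \<otimes>\<^bsub>R\<^esub> a) = f x \<cdot>\<^bsub>M\<^esub> a"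
    and f_zero_iff: "x \<in> B \<Longrightarrow> f x = \<zero>\<^bsub>M\<^esub> \<longleftrightarrow> x \<in> A"
begin

definition pre :: "'b set \<Rightarrow> 'a set" where
  "pre N = {x \<in> B. f x \<in> N}"

lemma B_carrier: "x \<in> B \<Longrightarrow> x \<in> carrier R"
  by (rule R.right_ideal_carrier[OF B])

lemma f_closed: "x \<in> B \<Longrightarrow> f x \<in> carrier M"
  using image by blast

lemma f_A: "x \<in> A \<Longrightarrow> f x = \<zero>\<^bsub>M\<^esub>"
  using f_zero_iff AB by blast

lemma f_diff:
  assumes "x \<in> B" "y \<in> B" "f x = f y"
  shows "x \<ominus>\<^bsub>R\<^esub> y \<in> A"
proof -
  have m: "\<ominus>\<^bsub>R\<^esub> y = y \<otimes>\<^bsub>R\<^esub> (\<ominus>\<^bsub>R\<^esub> \<one>\<^bsub>R\<^esub>)" using B_carrier[OF assms(2)] by (simp add: R.r_minus)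
  have "f (\<ominus>\<^bsub>R\<^esub> y) = \<ominus>\<^bsub>M\<^esub> f y"
    using f_mult[OF assms(2), of "\<ominus>\<^bsub>R\<^esub> \<one>\<^bsub>R\<^esub>"] rsmult_minus[OF f_closed[OF assms(2)], of "\<one>\<^bsub>R\<^esub>"]
      f_closed[OF assms(2)] by (simp add: m)
  then have "f (x \<ominus>\<^bsub>R\<^esub> y) = \<zero>\<^bsub>M\<^esub>"
    using f_add[OF assms(1) R.right_ideal_minus[OF B assms(2)]] assms(3) f_closed[OF assms(2)]
    by (simp add: R.minus_eq M.r_neg)
  then show ?thesis using f_zero_iff R.right_ideal_diff[OF B assms(1,2)] by blast
qed

lemma pre_interval:
  assumes N: "rsubmodule R M N"
  shows "pre N \<in> ideal_interval R A B"
proof -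
  have "right_ideal R (pre N)"
    unfolding R.right_ideal_iff
    using N B_carrier f_zero_iff[of "\<zero>\<^bsub>R\<^esub>"] R.right_ideal_zero[OF A] R.right_ideal_zero[OF B]
      R.right_ideal_add[OF B] R.right_ideal_mult[OF B]
    by (auto simp: pre_def rsubmodule_iff f_add f_mult)
  moreover have "A \<subseteq> pre N"
    using N AB by (auto simp: pre_def rsubmodule_iff f_A)
  ultimately show ?thesis by (auto simp: R.interval_iff pre_def)
qed

lemma image_submodule:
  assumes "D \<in> ideal_interval R A B"
  shows "rsubmodule R M (f ` D)"
proof -
  have D: "right_ideal R D" "A \<subseteq> D" "D \<subseteq> B" using assms by (auto simp: R.interval_iff)
  have DB: "x \<in> B" if "x \<in> D" for x using that D(3) by blast
  have "\<zero>\<^bsub>M\<^esub> \<in> f ` D"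
    using f_zero_iff[of "\<zero>\<^bsub>R\<^esub>"] R.right_ideal_zero[OF A] R.right_ideal_zero[OF D(1)] DB
    by (metis image_eqI)
  moreover have "f x \<oplus>\<^bsub>M\<^esub> f y \<in> f ` D" if "x \<in> D" "y \<in> D" for x y
    using that R.right_ideal_add[OF D(1) that] by (simp add: f_add[symmetric] DB)
  moreover have "f x \<cdot>\<^bsub>M\<^esub> a \<in> f ` D" if "x \<in> D" "a \<in> carrier R" for x a
    using that R.right_ideal_mult[OF D(1) that] by (simp add: f_mult[symmetric] DB)
  ultimately show ?thesis using f_closed DB by (auto simp: rsubmodule_iff)
qed

lemma pre_image:
  assumes "D \<in> ideal_interval R A B"
  shows "pre (f ` D) = D"
proof
  have D: "right_ideal R D" "A \<subseteq> D" "D \<subseteq> B" using assms by (auto simp: R.interval_iff)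
  then show "D \<subseteq> pre (f ` D)" by (auto simp: pre_def)
  show "pre (f ` D) \<subseteq> D"
  proof
    fix x assume "x \<in> pre (f ` D)"
    then obtain d where d: "x \<in> B" "d \<in> D" "f x = f d" by (auto simp: pre_def)
    then have "x \<ominus>\<^bsub>R\<^esub> d \<in> D" using f_diff[of x d] D by blast
    then show "x \<in> D" using R.right_ideal_diffD[OF D(1)] d B_carrier by blast
  qed
qed

lemma image_pre: "rsubmodule R M N \<Longrightarrow> f ` pre N = N"
  using image by (auto simp: pre_def rsubmodule_iff)

lemma image_A: "f ` A = {\<zero>\<^bsub>M\<^esub>}"
  using f_A R.right_ideal_zero[OF A] by force

lemma pre_zero: "pre {\<zero>\<^bsub>M\<^esub>} = A"
  using f_zero_iff AB by (auto simp: pre_def)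

lemma pre_carrier: "pre (carrier M) = B"
  using f_closed by (auto simp: pre_def)

lemma zero_module_iff: "zero_module M \<longleftrightarrow> A = B"
  using image image_A pre_zero pre_carrier by (metis zero_module_def)

lemma interval_in:
  assumes "right_ideal R D" "right_ideal R E" "A \<subseteq> D" "D \<subseteq> E" "E \<subseteq> B"
  shows "D \<in> ideal_interval R A B" "E \<in> ideal_interval R A B"
  using assms by (auto simp: R.interval_iff)

text \<open>This is \<open>f(E)/f(D) \<cong> E/D\<close>: the factors of a chain in \<open>M\<close>
  are again presented by right ideals of \<open>R\<close>, whatever the type of their
  elements.\<close>

lemma subquotient:
  assumes D: "right_ideal R D" and E: "right_ideal R E" and le: "A \<subseteq> D" "D \<subseteq> E" "E \<subseteq> B"
  shows "presentation R (quotmod (submod M (f ` E)) (f ` D))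
    (\<lambda>x. f ` D +>\<^bsub>submod M (f ` E)\<^esub> f x) D E"
proof -
  let ?S = "submod M (f ` E)"
  note DE = interval_in[OF D E le]
  have mod: "right_module R ?S" by (rule submod_right_module[OF image_submodule[OF DE(2)]])
  interpret S: right_module R ?S by (rule mod)
  have EB: "x \<in> B" if "x \<in> E" for x using that le(3) by blast
  have carS: "carrier ?S = f ` E" by (simp add: submod_def)
  have subS: "rsubmodule R ?S (f ` D)"
    using image_submodule[OF DE(1)] le(2)
    unfolding S.rsubmodule_iff rsubmodule_iff by (auto simp: submod_def)
  note Q = S.quotmod_right_module[OF subS]
  interpret Q: right_module R "quotmod ?S (f ` D)" by (rule Q(1))
  show ?thesis
  proof (unfold_locales, rule D, rule E, rule le(2))
    show "(\<lambda>x. f ` D +>\<^bsub>?S\<^esub> f x) ` E = carrier (quotmod ?S (f ` D))"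
      unfolding Q(2) carS by (simp add: image_image)
  next
    fix x y assume xy: "x \<in> E" "y \<in> E"
    show "f ` D +>\<^bsub>?S\<^esub> f (x \<oplus>\<^bsub>R\<^esub> y) =
      (f ` D +>\<^bsub>?S\<^esub> f x) \<oplus>\<^bsub>quotmod ?S (f ` D)\<^esub> (f ` D +>\<^bsub>?S\<^esub> f y)"
      using Q(3)[of "f x" "f y"] xy by (simp add: carS f_add EB) (simp add: submod_def)
  next
    fix x a assume xa: "x \<in> E" "a \<in> carrier R"
    show "f ` D +>\<^bsub>?S\<^esub> f (x \<otimes>\<^bsub>R\<^esub> a) = (f ` D +>\<^bsub>?S\<^esub> f x) \<cdot>\<^bsub>quotmod ?S (f ` D)\<^esub> a"
      using Q(4)[of "f x" a] xa by (simp add: carS f_mult EB) (simp add: submod_def)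
  next
    fix x assume x: "x \<in> E"
    have "f x \<in> f ` D \<longleftrightarrow> x \<in> D"
      using pre_image[OF DE(1)] EB[OF x] by (auto simp: pre_def)
    then show "f ` D +>\<^bsub>?S\<^esub> f x = \<zero>\<^bsub>quotmod ?S (f ` D)\<^esub> \<longleftrightarrow> x \<in> D"
      using Q(5)[of "f x"] x by (simp add: carS)
  qed
qed

lemma quotient:
  assumes D: "D \<in> ideal_interval R A B"
  shows "presentation R (quotmod M (f ` D)) (\<lambda>x. f ` D +>\<^bsub>M\<^esub> f x) D B"
proof -
  have "submod M (f ` B) = M" by (simp add: image submod_def)
  then show ?thesis using subquotient[OF _ B, of D] D by (simp add: R.interval_iff)
qed

lemma isomorphic:
  assumes N: "right_module R N" and g: "g \<in> rmod_iso R M N"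
  shows "presentation R N (g \<circ> f) A B"
proof -
  interpret N: right_module R N by (rule N)
  have inj: "inj_on g (carrier M)" and im: "g ` carrier M = carrier N"
    and add: "\<And>x y. x \<in> carrier M \<Longrightarrow> y \<in> carrier M \<Longrightarrow> g (x \<oplus>\<^bsub>M\<^esub> y) = g x \<oplus>\<^bsub>N\<^esub> g y"
    and mult: "\<And>x a. x \<in> carrier M \<Longrightarrow> a \<in> carrier R \<Longrightarrow> g (x \<cdot>\<^bsub>M\<^esub> a) = g x \<cdot>\<^bsub>N\<^esub> a"
    using g by (auto simp: rmod_iso_def iso_def hom_def bij_betw_def)
  have zero: "g \<zero>\<^bsub>M\<^esub> = \<zero>\<^bsub>N\<^esub>"
    using add[of "\<zero>\<^bsub>M\<^esub>" "\<zero>\<^bsub>M\<^esub>"] im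
    by (metis M.l_zero M.zero_closed N.M.add.l_cancel_one image_eqI)
  show ?thesis
  proof (unfold_locales, rule A, rule B, rule AB)
    show "(g \<circ> f) ` B = carrier N" using image im by (metis image_comp)
    show "(g \<circ> f) x = \<zero>\<^bsub>N\<^esub> \<longleftrightarrow> x \<in> A" if "x \<in> B" for x
      using that f_zero_iff f_closed inj zero M.zero_closed by (metis comp_apply inj_on_eq_iff)
  qed (auto simp: f_add f_mult add mult f_closed)
qed

lemma noetherian_iff: "noetherian_module R M \<longleftrightarrow> acc (ideal_interval R A B)"
  unfolding noetherian_module_def acc_iff_chain ascending_chain_def
proof (intro iffI allI impI)
  fix C :: "nat \<Rightarrow> 'a set"
  assume *: "\<forall>C. (\<forall>i. rsubmodule R M (C i) \<and> C i \<subseteq> C (Suc i)) \<longrightarrow> (\<exists>n. \<forall>i\<ge>n. C i = C n)"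
    and C: "\<forall>i. C i \<in> ideal_interval R A B \<and> C i \<subseteq> C (Suc i)"
  then have "\<exists>n. \<forall>i\<ge>n. f ` C i = f ` C n"
    using image_submodule by (intro *[rule_format]) (simp add: image_mono)
  then show "\<exists>n. \<forall>i\<ge>n. C i = C n" using C pre_image by metis
next
  fix C :: "nat \<Rightarrow> 'b set"
  assume *: "\<forall>C. (\<forall>i. C i \<in> ideal_interval R A B \<and> C i \<subseteq> C (Suc i)) \<longrightarrow> (\<exists>n. \<forall>i\<ge>n. C i = C n)"
    and C: "\<forall>i. rsubmodule R M (C i) \<and> C i \<subseteq> C (Suc i)"
  then have "\<exists>n. \<forall>i\<ge>n. pre (C i) = pre (C n)"
    using pre_interval by (intro *[rule_format]) (auto simp: pre_def)
  then show "\<exists>n. \<forall>i\<ge>n. C i = C n" using C image_pre by metis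
qed

lemma artinian_iff: "artinian_module R M \<longleftrightarrow> dcc (ideal_interval R A B)"
  unfolding artinian_module_def dcc_iff_chain descending_chain_def
proof (intro iffI allI impI)
  fix C :: "nat \<Rightarrow> 'a set"
  assume *: "\<forall>C. (\<forall>i. rsubmodule R M (C i) \<and> C (Suc i) \<subseteq> C i) \<longrightarrow> (\<exists>n. \<forall>i\<ge>n. C i = C n)"
    and C: "\<forall>i. C i \<in> ideal_interval R A B \<and> C (Suc i) \<subseteq> C i"
  then have "\<exists>n. \<forall>i\<ge>n. f ` C i = f ` C n"
    using image_submodule by (intro *[rule_format]) (simp add: image_mono)
  then show "\<exists>n. \<forall>i\<ge>n. C i = C n" using C pre_image by metis
next
  fix C :: "nat \<Rightarrow> 'b set"
  assume *: "\<forall>C. (\<forall>i. C i \<in> ideal_interval R A B \<and> C (Suc i) \<subseteq> C i) \<longrightarrow> (\<exists>n. \<forall>i\<ge>n. C i = C n)"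
    and C: "\<forall>i. rsubmodule R M (C i) \<and> C (Suc i) \<subseteq> C i"
  then have "\<exists>n. \<forall>i\<ge>n. pre (C i) = pre (C n)"
    using pre_interval by (intro *[rule_format]) (auto simp: pre_def)
  then show "\<exists>n. \<forall>i\<ge>n. C i = C n" using C image_pre by metis
qed

lemma simple_iff: "simple_module R M \<longleftrightarrow> A \<noteq> B \<and> ideal_interval R A B \<subseteq> {A, B}"
proof
  assume M: "simple_module R M"
  have "D = A \<or> D = B" if D: "D \<in> ideal_interval R A B" for D
    using M image_submodule[OF D] pre_image[OF D] pre_zero pre_carrier
    unfolding simple_module_def by metis
  then show "A \<noteq> B \<and> ideal_interval R A B \<subseteq> {A, B}"
    using M by (auto simp: simple_module_def zero_module_iff)
next
  assume *: "A \<noteq> B \<and> ideal_interval R A B \<subseteq> {A, B}"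
  have "N = {\<zero>\<^bsub>M\<^esub>} \<or> N = carrier M" if N: "rsubmodule R M N" for N
  proof -
    have "pre N = A \<or> pre N = B" using * pre_interval[OF N] by blast
    then show ?thesis using image_pre[OF N] image_A image by metis
  qed
  then show "simple_module R M" using * by (auto simp: simple_module_def zero_module_iff)
qed

lemma finite_length_iff: "finite_length R M \<longleftrightarrow> (\<exists>n C. composition_series R A B n C)"
proof
  assume "finite_length R M"
  then obtain n C where C: "C 0 = {\<zero>\<^bsub>M\<^esub>}" "C n = carrier M" "\<And>i. i \<le> n \<Longrightarrow> rsubmodule R M (C i)"
    "\<And>i. i < n \<Longrightarrow> C i \<subseteq> C (Suc i) \<and> simple_module R (quotmod (submod M (C (Suc i))) (C i))"
    unfolding finite_length_def by blast
  have "composition_series R A B n (\<lambda>i. pre (C i))"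
    unfolding composition_series_def
  proof (intro conjI allI impI)
    show "right_ideal R (pre (C i))" if "i \<le> n" for i
      using pre_interval[OF C(3)[OF that]] by (simp add: R.interval_iff)
    fix i assume i: "i < n"
    have sub: "rsubmodule R M (C i)" "rsubmodule R M (C (Suc i))" using C(3) i by auto
    have mono: "pre (C i) \<subseteq> pre (C (Suc i))" using C(4)[OF i] by (auto simp: pre_def)
    interpret Q: presentation R "quotmod (submod M (C (Suc i))) (C i)"
      "\<lambda>x. C i +>\<^bsub>submod M (C (Suc i))\<^esub> f x" "pre (C i)" "pre (C (Suc i))"
      using subquotient[of "pre (C i)" "pre (C (Suc i))"] pre_interval[OF sub(1)]
        pre_interval[OF sub(2)] mono image_pre[OF sub(1)] image_pre[OF sub(2)]
      by (simp add: R.interval_iff)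
    show "pre (C i) \<subset> pre (C (Suc i))"
      "ideal_interval R (pre (C i)) (pre (C (Suc i))) \<subseteq> {pre (C i), pre (C (Suc i))}"
      using C(4)[OF i] mono by (auto simp: Q.simple_iff)
  qed (simp_all add: C pre_zero pre_carrier)
  then show "\<exists>n C. composition_series R A B n C" by blast
next
  assume "\<exists>n C. composition_series R A B n C"
  then obtain n C where C: "composition_series R A B n C" by blast
  have mono: "C i \<subseteq> C (Suc i)" if "i < n" for i using C that by (auto simp: composition_series_def)
  have lo: "A \<subseteq> C i" if "i \<le> n" for i
    using that
  proof (induction i)
    case (Suc i)
    then show ?case using mono[of i] by simp
  qed (use C in \<open>simp add: composition_series_def\<close>)
  have up: "C i \<subseteq> B" if "i \<le> n" for i
    using that
  proof (induction i rule: inc_induct)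
    case (step i)
    then show ?case using mono[of i] by simp
  qed (use C in \<open>simp add: composition_series_def\<close>)
  have CI: "C i \<in> ideal_interval R A B" if "i \<le> n" for i
    using C that lo up by (auto simp: composition_series_def R.interval_iff)
  show "finite_length R M"
    unfolding finite_length_def
  proof (intro exI[of _ n] exI[of _ "\<lambda>i. f ` C i"] conjI allI impI)
    show "f ` C 0 = {\<zero>\<^bsub>M\<^esub>}" "f ` C n = carrier M"
      using C image_A image by (simp_all add: composition_series_def)
    show "rsubmodule R M (f ` C i)" if "i \<le> n" for i by (rule image_submodule[OF CI[OF that]])
    fix i assume i: "i < n"
    show "f ` C i \<subseteq> f ` C (Suc i)" using mono[OF i] by blast
    interpret Q: presentation R "quotmod (submod M (f ` C (Suc i))) (f ` C i)"
      "\<lambda>x. f ` C i +>\<^bsub>submod M (f ` C (Suc i))\<^esub> f x" "C i" "C (Suc i)"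
      using subquotient[of "C i" "C (Suc i)"] CI[of i] CI[of "Suc i"] mono[OF i] i
      by (simp add: R.interval_iff)
    show "simple_module R (quotmod (submod M (f ` C (Suc i))) (f ` C i))"
      using C i by (auto simp: Q.simple_iff composition_series_def)
  qed
qed

lemma Inter_zero_iff:
  assumes "G \<subseteq> Collect (rsubmodule R M)"
  shows "carrier M \<inter> \<Inter>G = {\<zero>\<^bsub>M\<^esub>} \<longleftrightarrow> B \<inter> \<Inter>(pre ` G) = A"
proof -
  have sub: "rsubmodule R M (carrier M \<inter> \<Inter>G)"
    using assms by (auto simp: rsubmodule_iff subset_iff)
  have "pre (carrier M \<inter> \<Inter>G) = B \<inter> \<Inter>(pre ` G)"
    using f_closed by (auto simp: pre_def)
  then show ?thesis using image_pre[OF sub] image_A pre_zero by metis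
qed

lemma finitely_cogenerated_iff:
  "finitely_cogenerated R M \<longleftrightarrow>
     (\<forall>F. F \<subseteq> ideal_interval R A B \<and> B \<inter> \<Inter>F = A \<longrightarrow>
       (\<exists>G. G \<subseteq> F \<and> finite G \<and> B \<inter> \<Inter>G = A))"
  unfolding finitely_cogenerated_def
proof (intro iffI allI impI)
  fix F
  assume *: "\<forall>F. F \<subseteq> Collect (rsubmodule R M) \<and> carrier M \<inter> \<Inter>F = {\<zero>\<^bsub>M\<^esub>} \<longrightarrow>
      (\<exists>G. G \<subseteq> F \<and> finite G \<and> carrier M \<inter> \<Inter>G = {\<zero>\<^bsub>M\<^esub>})"
    and F: "F \<subseteq> ideal_interval R A B \<and> B \<inter> \<Inter>F = A"
  let ?F = "(`) f ` F"
  have sub: "?F \<subseteq> Collect (rsubmodule R M)" using F image_submodule by blast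
  have "pre (f ` D) = D" if "D \<in> F" for D using F that by (intro pre_image) blast
  then have preF: "pre ` ?F = F" by (force simp: image_image)
  then have "carrier M \<inter> \<Inter>?F = {\<zero>\<^bsub>M\<^esub>}" using Inter_zero_iff[OF sub] F by simp
  from *[rule_format, OF conjI[OF sub this]]
  obtain G where G: "G \<subseteq> ?F" "finite G" "carrier M \<inter> \<Inter>G = {\<zero>\<^bsub>M\<^esub>}"
    by (elim exE conjE)
  from Inter_zero_iff[OF subset_trans[OF G(1) sub], THEN iffD1, OF G(3)]
  have "B \<inter> \<Inter>(pre ` G) = A" .
  moreover have "pre ` G \<subseteq> F" using image_mono[OF G(1), of pre] preF by simp
  ultimately show "\<exists>G. G \<subseteq> F \<and> finite G \<and> B \<inter> \<Inter>G = A" using G(2) by blast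
next
  fix F
  assume *: "\<forall>F. F \<subseteq> ideal_interval R A B \<and> B \<inter> \<Inter>F = A \<longrightarrow>
      (\<exists>G. G \<subseteq> F \<and> finite G \<and> B \<inter> \<Inter>G = A)"
    and F: "F \<subseteq> Collect (rsubmodule R M) \<and> carrier M \<inter> \<Inter>F = {\<zero>\<^bsub>M\<^esub>}"
  have sub: "pre ` F \<subseteq> ideal_interval R A B" using F pre_interval by blast
  have "B \<inter> \<Inter>(pre ` F) = A" using Inter_zero_iff[of F] F by simp
  from *[rule_format, OF conjI[OF sub this]]
  obtain G where G: "G \<subseteq> pre ` F" "finite G" "B \<inter> \<Inter>G = A" by (elim exE conjE)
  then obtain G' where G': "G' \<subseteq> F" "finite G'" "G = pre ` G'"
    by (metis finite_subset_image)
  then have "carrier M \<inter> \<Inter>G' = {\<zero>\<^bsub>M\<^esub>}" using Inter_zero_iff[of G'] F G(3) by auto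
  then show "\<exists>G. G \<subseteq> F \<and> finite G \<and> carrier M \<inter> \<Inter>G = {\<zero>\<^bsub>M\<^esub>}" using G' by blast
qed

lemma point_annihilatorD:
  assumes "point_annihilator R M P"
  shows "\<exists>x\<in>B. x \<notin> A \<and> P = residual R A x"
proof -
  obtain m where m: "m \<in> carrier M" "m \<noteq> \<zero>\<^bsub>M\<^esub>" "P = annih R M m"
    using assms by (auto simp: point_annihilator_def)
  then obtain x where x: "x \<in> B" "m = f x" using image by blast
  have "r \<in> annih R M m \<longleftrightarrow> r \<in> residual R A x" for r
    using x f_mult[OF x(1), of r] f_zero_iff[OF R.right_ideal_mult[OF B x(1)], of r]
    by (auto simp: annih_def residual_def)
  then show ?thesis using m x f_zero_iff[OF x(1)] by blast
qed

end

context ring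
begin

section \<open>The ring, its cyclic modules and its right ideals\<close>

lemma regmod_presentation: "presentation R (regmod R) (\<lambda>x. x) {\<zero>} (carrier R)"
proof -
  interpret right_module R "regmod R" by (rule regmod_right_module)
  show ?thesis
    by unfold_locales
      (auto simp: right_ideal_trivial right_ideal_full regmod_def)
qed

lemma cyclic_presentation:
  assumes I: "right_ideal R I"
  shows "presentation R (quotmod (regmod R) I) (\<lambda>x. I +>\<^bsub>regmod R\<^esub> x) I (carrier R)"
  using presentation.quotient[OF regmod_presentation right_ideal_in_interval[OF I]] by simp

lemma right_noetherian_iff: "right_noetherian R \<longleftrightarrow> acc (ideal_interval R {\<zero>} (carrier R))"
  unfolding right_noetherian_def by (rule presentation.noetherian_iff[OF regmod_presentation])

lemma right_artinian_iff: "right_artinian R \<longleftrightarrow> dcc (ideal_interval R {\<zero>} (carrier R))"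
  unfolding right_artinian_def by (rule presentation.artinian_iff[OF regmod_presentation])

lemma residual_test_set_if_point_annihilator_set:
  assumes "right_noetherian_point_annihilator_set R S"
  shows "residual_test_set R S"
  unfolding residual_test_set_def
proof (intro allI impI)
  fix I assume I: "right_ideal R I \<and> I \<noteq> carrier R \<and> acc (ideal_interval R I (carrier R))"
  then interpret Q: presentation R "quotmod (regmod R) I" "\<lambda>x. I +>\<^bsub>regmod R\<^esub> x" I "carrier R"
    by (intro cyclic_presentation) simp
  have "right_module R (quotmod (regmod R) I)" by (rule Q.right_module_axioms)
  then obtain P where "P \<in> S" "point_annihilator R (quotmod (regmod R) I) P"
    using assms I Q.noetherian_iff Q.zero_module_iff
    unfolding right_noetherian_point_annihilator_set_def by blast
  then show "\<exists>x\<in>carrier R. x \<notin> I \<and> residual R I x \<in> S"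
    using Q.point_annihilatorD by blast
qed

lemma finitely_generated_iff:
  assumes P: "right_ideal R P"
  shows "finitely_generated R (submod (regmod R) P) \<longleftrightarrow> fg_ideal R P"
proof -
  interpret M: right_module R "regmod R" by (rule regmod_right_module)
  have sub: "rsubmodule R (regmod R) P" using P by (simp add: right_ideal_def)
  interpret S: right_module R "submod (regmod R) P" by (rule M.submod_right_module[OF sub])
  have iff: "rsubmodule R (submod (regmod R) P) N \<longleftrightarrow> right_ideal R N \<and> N \<subseteq> P" for N
    unfolding S.rsubmodule_iff right_ideal_iff using right_ideal_le_carrier[OF P]
    by (auto simp: submod_def regmod_def)
  have "span_rmod R (submod (regmod R) P) X = P \<longleftrightarrow>
      (\<forall>N. right_ideal R N \<and> X \<subseteq> N \<longrightarrow> P \<subseteq> N)" if X: "X \<subseteq> P" for X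
  proof
    assume eq: "span_rmod R (submod (regmod R) P) X = P"
    show "\<forall>N. right_ideal R N \<and> X \<subseteq> N \<longrightarrow> P \<subseteq> N"
    proof (intro allI impI)
      fix N assume N: "right_ideal R N \<and> X \<subseteq> N"
      \<comment> \<open>The span inside the module \<open>P\<close> is formed from right ideals
        contained in \<open>P\<close>, so \<open>N\<close> is cut down to
        \<open>N \<inter> P\<close>.\<close>
      then have "rsubmodule R (submod (regmod R) P) (N \<inter> P)"
        using right_ideal_Int P by (simp add: iff)
      then have "span_rmod R (submod (regmod R) P) X \<subseteq> N \<inter> P"
        unfolding span_rmod_def using N X by (intro Inter_lower) simp
      then show "P \<subseteq> N" using eq by blast
    qed
  next
    assume *: "\<forall>N. right_ideal R N \<and> X \<subseteq> N \<longrightarrow> P \<subseteq> N"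
    show "span_rmod R (submod (regmod R) P) X = P"
      unfolding span_rmod_def iff
      using * P X by (intro equalityI Inter_lower Inter_greatest) auto
  qed
  moreover have "carrier (submod (regmod R) P) = P" by (simp add: submod_def)
  ultimately show ?thesis
    unfolding finitely_generated_def fg_ideal_def using P by auto
qed

lemma cyclic_finitely_cogenerated_iff:
  assumes P: "right_ideal R P"
  shows "finitely_cogenerated R (quotmod (regmod R) P) \<longleftrightarrow> cogen_ideal R P"
  using presentation.finitely_cogenerated_iff[OF cyclic_presentation[OF P]] P
  by (simp add: cogen_ideal_def)

end
section \<open>Krull dimension of intervals of right ideals\<close>

text \<open>The deviation of the lattice of right ideals between \<open>A\<close> and
  \<open>B\<close>, that is, the Krull class of \<open>B/A\<close>. A factor of a chain is again an
  interval, so the recursion passes through no isomorphic copy.\<close>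

inductive kdev ::
    "('a, 'r) ring_scheme \<Rightarrow> 'o::wellorder option \<Rightarrow> 'a set \<Rightarrow> 'a set \<Rightarrow> bool"
  for R :: "('a, 'r) ring_scheme" where
  minus_one: "kdev R None A A"
| ordinal: "(\<forall>C. (\<forall>i. C i \<in> ideal_interval R A B \<and> C (Suc i) \<subseteq> C i) \<longrightarrow>
       (\<exists>n. \<forall>i\<ge>n. \<exists>\<beta><Some a. kdev R \<beta> (C (Suc i)) (C i))) \<Longrightarrow>
    kdev R (Some a) A B"

lemma kdev_None: "kdev R None A B \<longleftrightarrow> A = B"
  by (auto elim: kdev.cases intro: kdev.minus_one)

lemma kdev_Some:
  "kdev R (Some a) A B \<longleftrightarrow>
    (\<forall>C. (\<forall>i. C i \<in> ideal_interval R A B \<and> C (Suc i) \<subseteq> C i) \<longrightarrow>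
       (\<exists>n. \<forall>i\<ge>n. \<exists>\<beta><Some a. kdev R \<beta> (C (Suc i)) (C i)))"
  by (subst kdev.simps) simp

lemma kdev_subinterval:
  assumes "kdev R \<alpha> A B" "A \<subseteq> A'" "A' \<subseteq> B'" "B' \<subseteq> B"
  shows "kdev R \<alpha> A' B'"
proof (cases \<alpha>)
  case None
  then have "A' = B'" using assms by (auto simp: kdev_None)
  then show ?thesis using None by (simp add: kdev_None)
next
  case (Some a)
  have "ideal_interval R A' B' \<subseteq> ideal_interval R A B"
    using assms by (auto simp: ideal_interval_def)
  show ?thesis
    unfolding Some kdev_Some
  proof (intro allI impI)
    fix C assume "\<forall>i. C i \<in> ideal_interval R A' B' \<and> C (Suc i) \<subseteq> C i"
    then have "\<forall>i. C i \<in> ideal_interval R A B \<and> C (Suc i) \<subseteq> C i"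
      using \<open>ideal_interval R A' B' \<subseteq> ideal_interval R A B\<close> by (meson subsetD)
    then show "\<exists>n. \<forall>i\<ge>n. \<exists>\<beta><Some a. kdev R \<beta> (C (Suc i)) (C i)"
      by (rule assms(1)[unfolded Some kdev_Some, THEN spec, THEN mp])
  qed
qed

lemma krull_class_right_module: "krull_class R \<alpha> M \<Longrightarrow> right_module R M"
  by (auto elim: krull_class.cases)

lemma krull_class_least:
  fixes \<gamma> :: "'o::wellorder option"
  assumes "krull_class R \<gamma> M"
  shows "\<exists>\<beta>\<le>\<gamma>. has_Kdim R M \<beta>"
proof -
  obtain \<beta> :: "'o option" where "krull_class R \<beta> M" "\<forall>\<delta><\<beta>. \<not> krull_class R \<delta> M"
    using assms exists_least_iff[of "\<lambda>\<beta> :: 'o option. krull_class R \<beta> M"] by blast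
  then show ?thesis using assms unfolding has_Kdim_def by (metis not_le)
qed

text \<open>Induction on \<open>\<alpha>\<close> over all presented modules on type
  \<open>'b\<close> at once, because the copy \<open>N\<close> of a factor of a chain has a
  presentation of its own.\<close>

lemma krull_class_iff_kdev:
  fixes M :: "('a, 'b) rmodule"
  assumes "presentation R M f A B"
  shows "krull_class R \<alpha> M \<longleftrightarrow> kdev R \<alpha> A B"
  using assms
proof (induction \<alpha> arbitrary: M f A B rule: less_induct)
  case (less \<alpha>)
  interpret presentation R M f A B by (rule less.prems)
  show ?case
  proof (cases \<alpha>)
    case None
    then show ?thesis
      by (simp add: krull_class_None kdev_None zero_module_iff right_module_axioms)
  next
    case (Some a)
    show ?thesis
      unfolding Some
    proof
      assume M: "krull_class R (Some a) M"
      show "kdev R (Some a) A B"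
        unfolding kdev_Some
      proof (intro allI impI)
        fix C :: "nat \<Rightarrow> 'a set"
        assume C: "\<forall>i. C i \<in> ideal_interval R A B \<and> C (Suc i) \<subseteq> C i"
        then have "descending_chain R M (\<lambda>i. f ` C i)"
          unfolding descending_chain_def using image_submodule by blast
        then obtain n where n: "\<forall>i\<ge>n. \<exists>\<beta><Some a. \<exists>N :: ('a, 'b) rmodule. krull_class R \<beta> N \<and>
            rmod_iso R (quotmod (submod M (f ` C i)) (f ` C (Suc i))) N \<noteq> {}"
          using M unfolding krull_class_Some by blast
        have "\<exists>\<beta><Some a. kdev R \<beta> (C (Suc i)) (C i)" if "n \<le> i" for i
        proof -
          obtain \<beta> and N :: "('a, 'b) rmodule" and g where N: "\<beta> < Some a" "krull_class R \<beta> N"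
            "g \<in> rmod_iso R (quotmod (submod M (f ` C i)) (f ` C (Suc i))) N"
            using n \<open>n \<le> i\<close> by blast
          have "presentation R (quotmod (submod M (f ` C i)) (f ` C (Suc i)))
              (\<lambda>x. f ` C (Suc i) +>\<^bsub>submod M (f ` C i)\<^esub> f x) (C (Suc i)) (C i)"
            using C by (intro subquotient) (auto simp: R.interval_iff)
          from presentation.isomorphic[OF this krull_class_right_module[OF N(2)] N(3)]
          have "kdev R \<beta> (C (Suc i)) (C i)" using less.IH N(1,2) Some by blast
          then show ?thesis using N(1) by blast
        qed
        then show "\<exists>n. \<forall>i\<ge>n. \<exists>\<beta><Some a. kdev R \<beta> (C (Suc i)) (C i)" by blast
      qed
    next
      assume kd: "kdev R (Some a) A B"
      show "krull_class R (Some a) M"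
        unfolding krull_class_Some
      proof (intro conjI right_module_axioms allI impI)
        fix C assume "descending_chain R M C"
        then have sub: "\<And>i. rsubmodule R M (C i)" and dec: "\<And>i. C (Suc i) \<subseteq> C i"
          by (auto simp: descending_chain_def)
        have "\<forall>i. pre (C i) \<in> ideal_interval R A B \<and> pre (C (Suc i)) \<subseteq> pre (C i)"
          using pre_interval[OF sub] dec by (auto simp: pre_def)
        then obtain n where n: "\<forall>i\<ge>n. \<exists>\<beta><Some a. kdev R \<beta> (pre (C (Suc i))) (pre (C i))"
          using kd[unfolded kdev_Some, rule_format, of "\<lambda>i. pre (C i)"] by blast
        have "\<exists>\<beta><Some a. \<exists>N :: ('a, 'b) rmodule. krull_class R \<beta> N \<and>
            rmod_iso R (quotmod (submod M (C i)) (C (Suc i))) N \<noteq> {}" if "n \<le> i" for i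
        proof -
          obtain \<beta> where \<beta>: "\<beta> < Some a" "kdev R \<beta> (pre (C (Suc i))) (pre (C i))"
            using n \<open>n \<le> i\<close> by blast
          let ?Q = "quotmod (submod M (C i)) (C (Suc i))"
          define h where "h = (\<lambda>x. C (Suc i) +>\<^bsub>submod M (C i)\<^esub> f x)"
          have pre_sub: "pre (C (Suc i)) \<subseteq> pre (C i)" using dec by (auto simp: pre_def)
          have Q: "presentation R ?Q h (pre (C (Suc i))) (pre (C i))"
            using subquotient[of "pre (C (Suc i))" "pre (C i)"] pre_interval[OF sub] pre_sub
              image_pre[OF sub] by (simp add: R.interval_iff h_def)
          then interpret Q: presentation R ?Q h "pre (C (Suc i))" "pre (C i)" .
          \<comment> \<open>One element of \<open>M\<close> is chosen from each coset. This injects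
            the factor into the type \<open>'b\<close>, where \<open>rmodule_transport\<close>
            builds the copy that \<open>krull_class\<close> asks for.\<close>
          define \<phi> where "\<phi> X = f (inv_into (pre (C i)) h X)" for X
          have "h (inv_into (pre (C i)) h X) = X" if "X \<in> carrier ?Q" for X
            using that Q.image by (intro f_inv_into_f) simp
          then have "inj_on \<phi> (carrier ?Q)"
            unfolding \<phi>_def h_def by (intro inj_onI) metis
          then obtain N :: "('a, 'b) rmodule" where N: "right_module R N" "\<phi> \<in> rmod_iso R ?Q N"
            using rmodule_transport[OF Q.right_module_axioms] by blast
          have "krull_class R \<beta> N"
            using less.IH[OF _ Q.isomorphic[OF N]] \<beta> Some by blast
          then show ?thesis using \<beta>(1) N(2) by blast
        qed
        then show "\<exists>n. \<forall>i\<ge>n. \<exists>\<beta><Some a. \<exists>N :: ('a, 'b) rmodule. krull_class R \<beta> N \<and>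
            rmod_iso R (quotmod (submod M (C i)) (C (Suc i))) N \<noteq> {}" by blast
      qed
    qed
  qed
qed

text \<open>A module presented as \<open>(A + x R)/A\<close> is also presented as
  \<open>R/(A : x)\<close>, by \<open>r \<mapsto> f (x r)\<close>. As both presentations belong to
  one module, \<open>kdev_residual\<close> follows from two uses of
  \<open>krull_class_iff_kdev\<close>.\<close>

lemma (in presentation) residual_presentation:
  assumes x: "x \<in> carrier R" and B_eq: "B = adjoin R A x (carrier R)"
  shows "presentation R M (\<lambda>r. f (x \<otimes>\<^bsub>R\<^esub> r)) (residual R A x) (carrier R)"
proof -
  have xr: "x \<otimes>\<^bsub>R\<^esub> r \<in> B" if "r \<in> carrier R" for r
    unfolding B_eq using R.adjoin_mem[OF A R.right_ideal_full x that] .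
  show ?thesis
  proof (unfold_locales, rule R.right_ideal_residual[OF A x], rule R.right_ideal_full)
    show "residual R A x \<subseteq> carrier R" by (auto simp: residual_def)
    show "(\<lambda>r. f (x \<otimes>\<^bsub>R\<^esub> r)) ` carrier R = carrier M"
    proof (intro equalityI subsetI)
      fix m assume "m \<in> carrier M"
      then obtain b where b: "b \<in> B" "m = f b" using image by blast
      then obtain i r where ir: "i \<in> A" "r \<in> carrier R" "b = i \<oplus>\<^bsub>R\<^esub> x \<otimes>\<^bsub>R\<^esub> r"
        unfolding B_eq R.adjoin_iff by blast
      have iB: "i \<in> B" using ir(1) AB by blast
      have "f b = f (x \<otimes>\<^bsub>R\<^esub> r)"
        using ir iB f_zero_iff[OF iB] f_closed[OF xr[OF ir(2)]] by (simp add: f_add xr)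
      then show "m \<in> (\<lambda>r. f (x \<otimes>\<^bsub>R\<^esub> r)) ` carrier R" using b ir(2) by blast
    qed (use xr f_closed in auto)
  next
    fix r s assume rs: "r \<in> carrier R" "s \<in> carrier R"
    show "f (x \<otimes>\<^bsub>R\<^esub> (r \<oplus>\<^bsub>R\<^esub> s)) = f (x \<otimes>\<^bsub>R\<^esub> r) \<oplus>\<^bsub>M\<^esub> f (x \<otimes>\<^bsub>R\<^esub> s)"
      using rs x by (simp add: R.r_distr f_add xr)
    show "f (x \<otimes>\<^bsub>R\<^esub> (r \<otimes>\<^bsub>R\<^esub> s)) = f (x \<otimes>\<^bsub>R\<^esub> r) \<cdot>\<^bsub>M\<^esub> s"
      using rs x by (simp add: R.m_assoc[symmetric] f_mult xr)
    show "f (x \<otimes>\<^bsub>R\<^esub> r) = \<zero>\<^bsub>M\<^esub> \<longleftrightarrow> r \<in> residual R A x"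
      using rs xr f_zero_iff by (simp add: residual_def)
  qed
qed

lemma (in ring) subquotient_presentation:
  assumes "right_ideal R A" "right_ideal R B" "A \<subseteq> B"
  shows "presentation R (quotmod (submod (regmod R) B) A) (\<lambda>x. A +>\<^bsub>submod (regmod R) B\<^esub> x) A B"
  using presentation.subquotient[OF regmod_presentation assms(1,2) right_ideal_ge_zero[OF assms(1)]
      assms(3) right_ideal_le_carrier[OF assms(2)]] by simp

lemma (in ring) kdev_residual:
  assumes I: "right_ideal R I" and x: "x \<in> carrier R"
  shows "kdev R \<alpha> (residual R I x) (carrier R) \<longleftrightarrow> kdev R \<alpha> I (adjoin R I x (carrier R))"
proof -
  note P = subquotient_presentation[OF I right_ideal_adjoin[OF I right_ideal_full x]
      adjoin_upper[OF I right_ideal_full x]]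
  show ?thesis
    using krull_class_iff_kdev[OF P, of \<alpha>]
      krull_class_iff_kdev[OF presentation.residual_presentation[OF P x refl], of \<alpha>] by simp
qed

section \<open>Cocritical right ideals\<close>

text \<open>For \<open>'c\<close> the type of modules, \<open>'c set wo\<close> is too large to consist of Krull dimensions of
  modules only; this bounds these dimensions without taking suprema.\<close>

datatype 'c wo = Wo (unwo: 'c)

instantiation wo :: (type) wellorder
begin

text \<open>A well-order of the whole type, chosen by the well-ordering theorem.\<close>

definition less_eq_wo :: "'c wo \<Rightarrow> 'c wo \<Rightarrow> bool" where
  "less_eq_wo x y \<longleftrightarrow> (unwo x, unwo y) \<in> (SOME r. well_order_on UNIV r)"

definition less_wo :: "'c wo \<Rightarrow> 'c wo \<Rightarrow> bool" where
  "less_wo x y \<longleftrightarrow> x \<le> y \<and> x \<noteq> y"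

instance
proof
  define r :: "'c rel" where "r = (SOME r. well_order_on UNIV r)"
  have "well_order_on UNIV r" unfolding r_def using well_order_on by (rule someI_ex)
  then have r: "refl r" "trans r" "antisym r" "total_on UNIV r" "wf (r - Id)"
    by (auto simp: order_on_defs)
  have le: "x \<le> y \<longleftrightarrow> (unwo x, unwo y) \<in> r" for x y by (simp add: less_eq_wo_def r_def)
  fix x y z :: "'c wo"
  show anti: "x = y" if "x \<le> y" "y \<le> x" for x y :: "'c wo"
    using that r(3) unfolding le by (auto dest: antisymD intro: wo.expand)
  show "x < y \<longleftrightarrow> x \<le> y \<and> \<not> y \<le> x"
    unfolding less_wo_def using anti r(1) le by (auto simp: refl_on_def)
  show "x \<le> x" using r(1) by (simp add: le refl_on_def)
  show "x \<le> z" if "x \<le> y" "y \<le> z" using that r(2) unfolding le by (rule transD[rotated])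
  show "x \<le> y \<or> y \<le> x"
    using r(1,4) unfolding le by (cases "unwo x = unwo y") (auto simp: total_on_def refl_on_def)
  fix P :: "'c wo \<Rightarrow> bool" and a
  assume step: "\<And>x. (\<And>y. y < x \<Longrightarrow> P y) \<Longrightarrow> P x"
  have "P (Wo c)" for c
    using r(5)
  proof (induction c rule: wf_induct_rule)
    case (less c)
    show ?case
    proof (rule step)
      fix y assume "y < Wo c"
      then have "(unwo y, c) \<in> r - Id" unfolding less_wo_def le by (cases y) auto
      then show "P y" using less[of "unwo y"] by simp
    qed
  qed
  from this[of "unwo a"] show "P a" by simp
qed

end

text \<open>Attained dimensions form an initial segment, so without a bound every element of
  \<open>wo\<close> would be attained. Distinct dimensions need distinct modules; this would inject
  the sets of modules into the modules, against Cantor's theorem.\<close>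

lemma exists_Kdim_bound:
  "\<exists>a :: ('a, 'b) rmodule set wo. \<forall>M :: ('a, 'b) rmodule. \<forall>\<beta>. has_Kdim R M \<beta> \<longrightarrow> \<beta> < Some a"
proof (rule ccontr)
  assume no: "\<not> ?thesis"
  have "\<exists>W :: ('a, 'b) rmodule. has_Kdim R W (Some a)" for a :: "('a, 'b) rmodule set wo"
  proof -
    obtain M :: "('a, 'b) rmodule" and \<beta> where "has_Kdim R M \<beta>" "\<not> \<beta> < Some a"
      using no by blast
    then show ?thesis using Kdim_initial_segment by (metis not_less)
  qed
  then obtain W :: "('a, 'b) rmodule set wo \<Rightarrow> ('a, 'b) rmodule"
    where W: "\<And>a. has_Kdim R (W a) (Some a)" by metis
  have "inj (\<lambda>X. W (Wo X))"
  proof (rule injI)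
    fix X Y assume "W (Wo X) = W (Wo Y)"
    then have "has_Kdim R (W (Wo X)) (Some (Wo X))" "has_Kdim R (W (Wo X)) (Some (Wo Y))"
      using W by metis+
    then have "\<not> Wo X < Wo Y" "\<not> Wo Y < Wo X" unfolding has_Kdim_def by auto
    then show "X = Y" by (metis not_less_iff_gr_or_eq wo.inject)
  qed
  then have "surj (inv_into UNIV (\<lambda>X. W (Wo X)))" by (rule inj_imp_surj_inv)
  then show False using Cantors_theorem[of UNIV] by auto
qed

context ring
begin

text \<open>The bound concerns dimensions, not arbitrary indices: from \<open>\<beta>\<close> one
  passes to the least index of a class containing \<open>B/A\<close>, a dimension attained on the
  carrier type \<open>'a set\<close> and hence below \<open>a\<close>.\<close>

lemma exists_kdev_bound:
  "\<exists>a :: ('a, 'a set) rmodule set wo. \<forall>A B (\<beta> :: ('a, 'a set) rmodule set wo option).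
     right_ideal R A \<and> right_ideal R B \<and> A \<subseteq> B \<and> kdev R \<beta> A B \<longrightarrow> (\<exists>\<gamma><Some a. kdev R \<gamma> A B)"
proof -
  obtain a :: "('a, 'a set) rmodule set wo"
    where a: "\<And>(M :: ('a, 'a set) rmodule) \<beta>. has_Kdim R M \<beta> \<Longrightarrow> \<beta> < Some a"
    using exists_Kdim_bound by blast
  have "\<exists>\<gamma><Some a. kdev R \<gamma> A B"
    if "right_ideal R A \<and> right_ideal R B \<and> A \<subseteq> B \<and> kdev R \<beta> A B"
    for A B and \<beta> :: "('a, 'a set) rmodule set wo option"
  proof -
    have "presentation R (quotmod (submod (regmod R) B) A) (\<lambda>x. A +>\<^bsub>submod (regmod R) B\<^esub> x) A B"
      using that by (intro subquotient_presentation) auto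
    note iff = krull_class_iff_kdev[OF this]
    have "krull_class R \<beta> (quotmod (submod (regmod R) B) A)" using that by (simp add: iff)
    from krull_class_least[OF this]
    obtain \<gamma> :: "('a, 'a set) rmodule set wo option"
      where \<gamma>: "has_Kdim R (quotmod (submod (regmod R) B) A) \<gamma>" by blast
    then have "kdev R \<gamma> A B" by (simp add: has_Kdim_def iff)
    then show ?thesis using a[OF \<gamma>] by (intro exI conjI)
  qed
  then show ?thesis by blast
qed

text \<open>Noetherian induction: let \<open>A\<close> be maximal such that \<open>R/A\<close> has
  no dimension. In a descending chain above \<open>A\<close>, either some member equals
  \<open>A\<close> and the later factors vanish, or each factor is a submodule of some
  \<open>R/C (Suc i)\<close> with \<open>C (Suc i)\<close> strictly above \<open>A\<close>, hence
  has an index. All indices can be taken below the uniform bound \<open>a\<close>, so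
  \<open>Some a\<close> serves for \<open>R/A\<close>.\<close>

lemma exists_kdev:
  assumes I: "right_ideal R I" and acc: "acc (ideal_interval R I (carrier R))"
  shows "\<exists>\<beta> :: ('a, 'a set) rmodule set wo option. kdev R \<beta> I (carrier R)"
proof (rule ccontr)
  assume no: "\<not> ?thesis"
  obtain a :: "('a, 'a set) rmodule set wo"
    where a: "\<And>A B (\<beta> :: ('a, 'a set) rmodule set wo option).
      right_ideal R A \<Longrightarrow> right_ideal R B \<Longrightarrow> A \<subseteq> B \<Longrightarrow> kdev R \<beta> A B \<Longrightarrow>
      \<exists>\<gamma><Some a. kdev R \<gamma> A B"
    using exists_kdev_bound by blast
  define X where "X = {A \<in> ideal_interval R I (carrier R).
    \<forall>\<beta> :: ('a, 'a set) rmodule set wo option. \<not> kdev R \<beta> A (carrier R)}"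
  have "I \<in> X" using no I right_ideal_le_carrier by (auto simp: X_def interval_iff)
  then obtain A where A: "A \<in> X" "\<And>E. E \<in> X \<Longrightarrow> \<not> A \<subset> E"
    using wfp_on_minimal[OF acc, of X] X_def by blast
  then have AI: "right_ideal R A" "I \<subseteq> A" by (auto simp: X_def interval_iff)
  have above: "\<exists>\<beta> :: ('a, 'a set) rmodule set wo option. kdev R \<beta> D (carrier R)"
    if "right_ideal R D" "A \<subset> D" for D
    using A(2)[of D] that AI(2) right_ideal_le_carrier[OF that(1)] by (auto simp: X_def interval_iff)
  have "kdev R (Some a) A (carrier R)"
    unfolding kdev_Some
  proof (intro allI impI)
    fix C assume C: "\<forall>i. C i \<in> ideal_interval R A (carrier R) \<and> C (Suc i) \<subseteq> C i"
    then have C': "\<And>i. right_ideal R (C i)" "\<And>i. A \<subseteq> C i" "\<And>i. C i \<subseteq> carrier R"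
      by (auto simp: interval_iff)
    show "\<exists>n. \<forall>i\<ge>n. \<exists>\<beta><Some a. kdev R \<beta> (C (Suc i)) (C i)"
    proof (cases "\<exists>n. C n = A")
      case True
      then obtain n where n: "C n = A" by blast
      have eq: "C i = A" if "n \<le> i" for i
        using that
      proof (induction i rule: dec_induct)
        case (step i)
        then show ?case using C C'(2)[of "Suc i"] by blast
      qed (rule n)
      have "kdev R None (C (Suc i)) (C i)" if "n \<le> i" for i
        using eq[OF that] eq[of "Suc i"] that by (simp add: kdev_None)
      moreover have "None < Some a" by simp
      ultimately show ?thesis by blast
    next
      case False
      have "\<exists>\<gamma><Some a. kdev R \<gamma> (C (Suc i)) (C i)" for i
      proof -
        have "A \<subset> C (Suc i)" using False C'(2)[of "Suc i"] by blast
        then obtain \<beta> :: "('a, 'a set) rmodule set wo option"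
          where "kdev R \<beta> (C (Suc i)) (carrier R)"
          using above[OF C'(1)] by blast
        moreover have dec: "C (Suc i) \<subseteq> C i" using C by blast
        ultimately have "kdev R \<beta> (C (Suc i)) (C i)"
          using kdev_subinterval[OF _ order_refl _ C'(3)] by blast
        from a[OF C'(1) C'(1) dec this] show ?thesis .
      qed
      then show ?thesis by blast
    qed
  qed
  then show False using A(1) by (auto simp: X_def)
qed

text \<open>Among the nonzero submodules of \<open>R/I\<close> let \<open>B/I\<close> have least
  index \<open>b\<close>. Some \<open>E/I\<close> inside it is critical, and so is its cyclic
  submodule \<open>(I + x R)/I \<cong> R/(I : x)\<close> for \<open>x \<in> E\<close> outside
  \<open>I\<close>: the minimality of \<open>b\<close> over all submodules keeps the dimension from
  dropping.\<close>

lemma cocritical_residual: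
  assumes I: "right_ideal R I" "I \<noteq> carrier R" and acc: "acc (ideal_interval R I (carrier R))"
  shows "\<exists>x\<in>carrier R. x \<notin> I \<and> cocritical R (residual R I x)"
proof -
  let ?\<L> = "ideal_interval R I (carrier R)"
  define dims :: "('a, 'a set) rmodule set wo option \<Rightarrow> bool"
    where "dims \<beta> \<longleftrightarrow> (\<exists>B\<in>?\<L>. B \<noteq> I \<and> kdev R \<beta> I B)" for \<beta>
  have "carrier R \<in> ?\<L>"
    using right_ideal_full right_ideal_le_carrier[OF I(1)] by (simp add: interval_iff)
  then have "\<exists>\<beta>. dims \<beta>" using exists_kdev[OF I(1) acc] I(2) unfolding dims_def by metis
  then obtain \<beta> where \<beta>: "dims \<beta>" "\<And>\<gamma>. \<gamma> < \<beta> \<Longrightarrow> \<not> dims \<gamma>"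
    using exists_least_iff[of dims] by blast
  obtain B where B: "right_ideal R B" "I \<subset> B" "B \<subseteq> carrier R" "kdev R \<beta> I B"
  proof -
    obtain B where "B \<in> ?\<L>" "B \<noteq> I" "kdev R \<beta> I B" using \<beta>(1) by (auto simp: dims_def)
    then show thesis using that[of B] by (auto simp: interval_iff)
  qed
  obtain b where b: "\<beta> = Some b" using B by (cases \<beta>) (auto simp: kdev_None)
  define small where "small N E \<longleftrightarrow> (\<exists>\<gamma><Some b. kdev R \<gamma> N E)" for N E
  \<comment> \<open>Otherwise each nonzero \<open>E/I\<close> has a nonzero submodule
    \<open>h E/I\<close> whose factor \<open>E/h E\<close> is not small. Iterating \<open>h\<close>
    from \<open>B\<close> gives a chain with no small factor, contrary to the index of
    \<open>B/I\<close>.\<close>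
  have "\<exists>E\<in>ideal_interval R I B. E \<noteq> I \<and> (\<forall>N\<in>ideal_interval R I E. N \<noteq> I \<longrightarrow> small N E)"
  proof (rule ccontr)
    assume no: "\<not> ?thesis"
    have "\<exists>N. N \<in> ideal_interval R I E \<and> N \<noteq> I \<and> \<not> small N E"
      if "E \<in> ideal_interval R I B" "E \<noteq> I" for E
      using no that by blast
    then obtain h where h: "\<And>E. E \<in> ideal_interval R I B \<Longrightarrow> E \<noteq> I \<Longrightarrow>
        h E \<in> ideal_interval R I E \<and> h E \<noteq> I \<and> \<not> small (h E) E" by metis
    define C where "C i = (h ^^ i) B" for i
    have C: "C i \<in> ideal_interval R I B \<and> C i \<noteq> I" for i
    proof (induction i)
      case 0
      then show ?case using B by (auto simp: C_def interval_iff)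
    next
      case (Suc i)
      then show ?case using h[of "C i"] by (auto simp: C_def interval_iff)
    qed
    have step: "C (Suc i) \<subseteq> C i" "\<not> small (C (Suc i)) (C i)" for i
      using h[of "C i"] C[of i] by (simp_all add: C_def interval_iff)
    have "\<forall>i. C i \<in> ideal_interval R I B \<and> C (Suc i) \<subseteq> C i" using C step(1) by simp
    from B(4)[unfolded b kdev_Some, THEN spec, THEN mp, OF this]
    show False unfolding small_def[symmetric] using step(2) by blast
  qed
  then obtain E where "E \<in> ideal_interval R I B" "E \<noteq> I"
    and Ecrit: "\<And>N. N \<in> ideal_interval R I E \<Longrightarrow> N \<noteq> I \<Longrightarrow> small N E"
    by blast
  then have E: "right_ideal R E" "I \<subset> E" "E \<subseteq> B" by (auto simp: interval_iff)
  then obtain x where x: "x \<in> E" "x \<notin> I" by blast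
  have xR: "x \<in> carrier R" using right_ideal_carrier[OF E(1) x(1)] .
  let ?J = "adjoin R I x (carrier R)" and ?P = "residual R I x"
  have J: "right_ideal R ?J" by (rule right_ideal_adjoin[OF I(1) right_ideal_full xR])
  have IJ: "I \<subset> ?J"
    using adjoin_upper[OF I(1) right_ideal_full xR] adjoin_self[OF I(1) xR] x(2) by blast
  have JE: "?J \<subseteq> E" using E(2) x(1) by (intro adjoin_least[OF E(1)]) auto
  have P: "right_ideal R ?P" by (rule right_ideal_residual[OF I(1) xR])
  let ?Q = "quotmod (regmod R) ?P"
  interpret Q: presentation R ?Q "\<lambda>x. ?P +>\<^bsub>regmod R\<^esub> x" ?P "carrier R"
    by (rule cyclic_presentation[OF P])
  have "critical_of_dim R b ?Q"
    unfolding critical_of_dim_def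
  proof (intro conjI allI impI)
    have K: "krull_class R \<gamma> ?Q \<longleftrightarrow> kdev R \<gamma> I ?J" for \<gamma> :: "('a, 'a set) rmodule set wo option"
      using krull_class_iff_kdev[OF Q.presentation_axioms, of \<gamma>] kdev_residual[OF I(1) xR, of \<gamma>]
      by simp
    have "kdev R (Some b) I ?J"
      unfolding b[symmetric]
      by (rule kdev_subinterval[OF B(4) order_refl psubset_imp_subset[OF IJ] subset_trans[OF JE E(3)]])
    \<comment> \<open>\<open>(I + x R)/I\<close> is itself one of the nonzero submodules over which
      \<open>\<beta>\<close> is least.\<close>
    moreover have "\<not> kdev R \<gamma> I ?J" if "\<gamma> < Some b" for \<gamma>
    proof
      assume "kdev R \<gamma> I ?J"
      moreover have "?J \<in> ?\<L>" "?J \<noteq> I"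
        using J IJ right_ideal_le_carrier[OF J] unfolding interval_iff by blast+
      ultimately have "dims \<gamma>" unfolding dims_def by blast
      then show False using \<beta>(2) that b by simp
    qed
    ultimately show "has_Kdim R ?Q (Some b)" by (simp add: has_Kdim_def K)
  next
    fix N assume N: "rsubmodule R ?Q N \<and> N \<noteq> {\<zero>\<^bsub>?Q\<^esub>}"
    define D where "D = Q.pre N"
    have D: "D \<in> ideal_interval R ?P (carrier R)" using N Q.pre_interval by (simp add: D_def)
    then have rD: "right_ideal R D" "?P \<subseteq> D" by (auto simp: interval_iff)
    have "D \<noteq> ?P" using N Q.image_pre Q.image_A unfolding D_def by metis
    let ?I = "adjoin R I x D"
    have I': "right_ideal R ?I" by (rule right_ideal_adjoin[OF I(1) rD(1) xR])
    have res: "residual R ?I x = D" by (rule residual_adjoin[OF I(1) rD(1) xR rD(2)])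
    have IJ': "?I \<subseteq> ?J"
      using adjoin_upper[OF I(1) right_ideal_full xR] adjoin_self[OF I(1) xR]
        right_ideal_le_carrier[OF rD(1)] by (intro adjoin_least[OF J])
    \<comment> \<open>Replacing \<open>I\<close> by \<open>I + x D\<close> leaves the sum with
      \<open>x R\<close> unchanged, so \<open>kdev_residual\<close> for \<open>I + x D\<close>,
      whose residual at \<open>x\<close> is \<open>D\<close>, expresses
      \<open>R/D \<cong> (I + x R)/(I + x D)\<close>.\<close>
    have "adjoin R ?I x (carrier R) = ?J"
    proof
      show "adjoin R ?I x (carrier R) \<subseteq> ?J"
        by (rule adjoin_least[OF J IJ' adjoin_self[OF I(1) xR] order_refl])
      show "?J \<subseteq> adjoin R ?I x (carrier R)"
        using adjoin_upper[OF I(1) rD(1) xR] unfolding adjoin_def by (intro set_add_mono) auto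
    qed
    then have kd: "kdev R \<gamma> D (carrier R) \<longleftrightarrow> kdev R \<gamma> ?I ?J"
      for \<gamma> :: "('a, 'a set) rmodule set wo option"
      using kdev_residual[OF I' xR, of \<gamma>] res by simp
    have "?I \<noteq> I" using res \<open>D \<noteq> ?P\<close> by metis
    moreover have "?I \<in> ideal_interval R I E"
      using I' adjoin_upper[OF I(1) rD(1) xR] IJ' JE by (auto simp: interval_iff)
    ultimately obtain \<gamma> where \<gamma>: "\<gamma> < Some b" "kdev R \<gamma> ?I E"
      using Ecrit unfolding small_def by blast
    \<comment> \<open>\<open>(I + x R)/(I + x D)\<close> is a submodule of
      \<open>E/(I + x D)\<close>, and the latter is small by the choice of \<open>E\<close>.\<close>
    have "kdev R \<gamma> D (carrier R)"
      unfolding kd by (rule kdev_subinterval[OF \<gamma>(2) order_refl IJ' JE])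
    moreover have "presentation R (quotmod ?Q N) (\<lambda>y. N +>\<^bsub>?Q\<^esub> (?P +>\<^bsub>regmod R\<^esub> y)) D (carrier R)"
      using Q.quotient[OF D] Q.image_pre N unfolding D_def by simp
    ultimately have "krull_class R \<gamma> (quotmod ?Q N)"
      using krull_class_iff_kdev by blast
    from krull_class_least[OF this] show "\<exists>\<gamma><Some b. has_Kdim R (quotmod ?Q N) \<gamma>"
      using \<gamma>(1) order_le_less_trans by blast
  qed
  \<comment> \<open>Here \<open>b\<close> belongs to the auxiliary type \<open>wo\<close>; the
    transfer lemma replaces it by an element of the ordinal type prescribed in
    \<open>critical\<close>.\<close>
  then have "critical R ?Q" by (rule critical_of_dim_imp_critical)
  then have "cocritical R ?P" using P by (simp add: cocritical_def)
  then show ?thesis using x(2) xR by blast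
qed

lemma residual_test_set_cocritical: "residual_test_set R {I. cocritical R I}"
  unfolding residual_test_set_def using cocritical_residual by simp

text \<open>Descending chains in \<open>R/I\<close> become stable, so \<open>R/I\<close> belongs to
  the class of every ordinal index. Being critical, it has the least ordinal as its dimension; the
  factors by nonzero submodules then have index \<open>-1\<close> and vanish.\<close>

lemma cocritical_maximal:
  assumes dcc: "dcc (ideal_interval R {\<zero>} (carrier R))" and I: "cocritical R I"
  shows "maximal_right_ideal R I"
proof -
  have rI: "right_ideal R I" using I by (simp add: cocritical_def)
  let ?Q = "quotmod (regmod R) I"
  interpret Q: presentation R ?Q "\<lambda>x. I +>\<^bsub>regmod R\<^esub> x" I "carrier R"
    by (rule cyclic_presentation[OF rI])
  obtain a :: "('a, 'a set) rmodule ordinal" where a: "critical_of_dim R a ?Q"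
    using I by (auto simp: cocritical_def critical_def)
  have dcc': "dcc (ideal_interval R I (carrier R))"
    using wfp_on_subset[OF dcc interval_mono[OF right_ideal_ge_zero[OF rI] order_refl]] .
  have K: "krull_class R (Some c) ?Q" for c :: "('a, 'a set) rmodule ordinal"
    unfolding krull_class_iff_kdev[OF Q.presentation_axioms] kdev_Some
  proof (intro allI impI)
    fix C assume "\<forall>i. C i \<in> ideal_interval R I (carrier R) \<and> C (Suc i) \<subseteq> C i"
    from dcc'[unfolded dcc_iff_chain, THEN spec, THEN mp, OF this]
    obtain n where n: "\<forall>i\<ge>n. C i = C n" by (elim exE)
    have "kdev R None (C (Suc i)) (C i)" if "n \<le> i" for i
      unfolding kdev_None using n that by (metis le_SucI)
    moreover have "None < Some c" by simp
    ultimately show "\<exists>n. \<forall>i\<ge>n. \<exists>\<beta><Some c. kdev R \<beta> (C (Suc i)) (C i)" by blast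
  qed
  have none: "\<not> krull_class R \<beta> ?Q" if "\<beta> < Some a" for \<beta>
    using a that by (auto simp: critical_of_dim_def has_Kdim_def)
  \<comment> \<open>An index \<open>Some c\<close> below \<open>Some a\<close> would contradict
    \<open>K\<close>, so \<open>a\<close> is the least ordinal.\<close>
  have least: "\<beta> = None" if "\<beta> < Some a" for \<beta>
    using none[OF that] K by (cases \<beta>) auto
  have "I \<noteq> carrier R"
    using none[of None]
      krull_class_iff_kdev[OF Q.presentation_axioms, of "None :: ('a, 'a set) rmodule ordinal option"]
    by (auto simp: kdev_None)
  moreover have "J = carrier R" if J: "right_ideal R J" "I \<subset> J" for J
  proof -
    let ?N = "(\<lambda>x. I +>\<^bsub>regmod R\<^esub> x) ` J"
    have JI: "J \<in> ideal_interval R I (carrier R)"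
      using J right_ideal_le_carrier[OF J(1)] by (auto simp: interval_iff)
    have "?N \<noteq> {\<zero>\<^bsub>?Q\<^esub>}" using Q.pre_image[OF JI] Q.pre_zero J(2) by auto
    then obtain \<beta> where \<beta>: "\<beta> < Some a" "has_Kdim R (quotmod ?Q ?N) \<beta>"
      using a Q.image_submodule[OF JI] unfolding critical_of_dim_def by blast
    then have "krull_class R None (quotmod ?Q ?N :: ('a, 'a set set) rmodule)"
      using least[OF \<beta>(1)] by (auto simp: has_Kdim_def krull_class_None)
    then show ?thesis
      using presentation.zero_module_iff[OF Q.quotient[OF JI]] by (simp add: krull_class_None)
  qed
  ultimately show ?thesis unfolding maximal_right_ideal_def using rI by (auto simp: psubset_eq)
qed

lemma cogen_maximal:
  assumes m: "maximal_right_ideal R m"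
  shows "cogen_ideal R m"
proof (rule cogen_if_dcc[OF maximal_right_idealD(1)[OF m]])
  have "ideal_interval R m (carrier R) \<subseteq> {m, carrier R}"
  proof
    fix J assume "J \<in> ideal_interval R m (carrier R)"
    then have "right_ideal R J" "m \<subseteq> J" by (auto simp: interval_iff)
    then show "J \<in> {m, carrier R}" using maximal_right_idealD(3)[OF m, of J] by blast
  qed
  then show "dcc (ideal_interval R m (carrier R))"
    by (intro inclusion_order_finite) (auto intro: finite_subset)
qed

end
theorem proposition4p7:
  fixes R :: "('a, 'r) ring_scheme" and S :: "'a set set"
  assumes "ring R"
    and "right_noetherian_point_annihilator_set R S"
  shows
    "(right_artinian R \<longleftrightarrow>
        right_noetherian R \<and> (\<forall>P\<in>S. finite_length R (quotmod (regmod R) P))) \<and>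
     (right_artinian R \<longleftrightarrow>
        (\<forall>P\<in>S. finitely_generated R (submod (regmod R) P) \<and>
                finite_length R (quotmod (regmod R) P))) \<and>
     (right_artinian R \<longleftrightarrow>
        (\<forall>P\<in>S. finitely_generated R (submod (regmod R) P) \<and>
                finitely_cogenerated R (quotmod (regmod R) P))) \<and>
     (right_artinian R \<longleftrightarrow>
        right_noetherian R \<and> (\<forall>I. cocritical R I \<longrightarrow> maximal_right_ideal R I)) \<and>
     (right_artinian R \<longleftrightarrow>
        (\<forall>I. cocritical R I \<longrightarrow>
             finitely_generated R (submod (regmod R) I) \<and> maximal_right_ideal R I))"
proof -
  interpret ring R by fact
  let ?S' = "{I. cocritical R I}"
  have S: "residual_test_set R S"
    by (rule residual_test_set_if_point_annihilator_set[OF assms(2)])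
  have S': "residual_test_set R ?S'" by (rule residual_test_set_cocritical)
  have ri: "right_ideal R P" if "P \<in> S" for P
    using assms(2) that by (simp add: right_noetherian_point_annihilator_set_def)
  have ri': "right_ideal R P" if "cocritical R P" for P using that by (simp add: cocritical_def)
  have cogen: "cogen_ideal R P"
    if "right_ideal R P" "finite_length R (quotmod (regmod R) P)" for P
    using presentation.finite_length_iff[OF cyclic_presentation] that
    by (auto intro!: cogen_if_dcc dest: dcc_if_composition_series)
  \<comment> \<open>\<open>T\<close> will be \<open>S\<close> and the set of cocritical right ideals
    in turn; the requirement on its members holds for right ideals with a factor of finite length by
    \<open>cogen\<close> and for maximal ones by \<open>cogen_maximal\<close>.\<close>
  have art: "right_artinian R"
    if "right_noetherian R" "residual_test_set R T" "\<And>P. P \<in> T \<Longrightarrow> cogen_ideal R P" for T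
    using that dcc_if_cogen_test_set by (simp add: right_noetherian_iff right_artinian_iff)
  have noeth: "right_noetherian R"
    if "residual_test_set R T" "\<And>P. P \<in> T \<Longrightarrow> right_ideal R P"
      "\<And>P. P \<in> T \<Longrightarrow> finitely_generated R (submod (regmod R) P)" for T
    using that cohen by (simp add: right_noetherian_iff finitely_generated_iff)
  have 1: "right_noetherian R" if "right_artinian R"
    using that hopkins_levitzki by (simp add: right_noetherian_iff right_artinian_iff)
  have fg: "finitely_generated R (submod (regmod R) P)" if "right_artinian R" "right_ideal R P" for P
    using 1 that fg_if_acc by (simp add: right_noetherian_iff finitely_generated_iff)
  have fl: "finite_length R (quotmod (regmod R) P)" if R: "right_artinian R" and P: "right_ideal R P" for P
  proof -
    note mono = wfp_on_subset[OF _ interval_mono[OF right_ideal_ge_zero[OF P] order_refl]]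
    have "acc (ideal_interval R P (carrier R))" "dcc (ideal_interval R P (carrier R))"
      using R 1 mono by (simp_all add: right_noetherian_iff right_artinian_iff)
    then show ?thesis
      using presentation.finite_length_iff[OF cyclic_presentation[OF P]]
        composition_series_if_acc_dcc[OF P right_ideal_full right_ideal_le_carrier[OF P]] by blast
  qed
  have fc: "finitely_cogenerated R (quotmod (regmod R) P) \<longleftrightarrow> cogen_ideal R P" if "right_ideal R P" for P
    by (rule cyclic_finitely_cogenerated_iff[OF that])
  have max: "maximal_right_ideal R I" if "right_artinian R" "cocritical R I" for I
    using that cocritical_maximal by (simp add: right_artinian_iff)
  show ?thesis
  proof (intro conjI)
    show "right_artinian R \<longleftrightarrow>
        right_noetherian R \<and> (\<forall>P\<in>S. finite_length R (quotmod (regmod R) P))"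
      using 1 fl ri cogen art[OF _ S] by blast
    show "right_artinian R \<longleftrightarrow> (\<forall>P\<in>S. finitely_generated R (submod (regmod R) P) \<and>
        finite_length R (quotmod (regmod R) P))"
      using fg fl ri cogen noeth[OF S] art[OF _ S] by blast
    show "right_artinian R \<longleftrightarrow> (\<forall>P\<in>S. finitely_generated R (submod (regmod R) P) \<and>
        finitely_cogenerated R (quotmod (regmod R) P))"
      using fg fl ri cogen fc noeth[OF S] art[OF _ S] by blast
    show "right_artinian R \<longleftrightarrow>
        right_noetherian R \<and> (\<forall>I. cocritical R I \<longrightarrow> maximal_right_ideal R I)"
      using 1 max cogen_maximal art[OF _ S'] by blast
    show "right_artinian R \<longleftrightarrow> (\<forall>I. cocritical R I \<longrightarrow>
        finitely_generated R (submod (regmod R) I) \<and> maximal_right_ideal R I)"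
      using fg max ri' cogen_maximal noeth[OF S'] art[OF _ S'] by blast
  qed
qed

end
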